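(* Let $\Omega\subset\mathbb C^n$ be a bounded domain. (1) For all $z,w\in\Omega$: $\lim_{s\to p-}m_s(z,w)=m_p(z,w)$ for $p>1$, and $\lim_{s\to p+}m_s(z,w)$ exists for $p\ge1$. Moreover, for $p\ge 1$, if $A^{p'}(\Omega)$ lies dense in $A^p(\Omega)$ for some $p'>p$, then $$m_p(z,w)=\lim_{s\to p+}m_s(z,w).$$ (2) For all $z\in\Omega$ and $X\in\mathbb C^n$: the limits $\lim_{s\to p\pm}B_s(z;X)$ exist for $p>0$, and $B_p(z;X)=\lim_{s\to p-}B_s(z;X)$. Moreover, if there exists $p'>p$ such that $A^{p'}(\Omega)$ lies dense in $A^p(\Omega)$, then $$B_p(z;X)=\lim_{s\to p}B_s(z;X).$$ Conclusion (1) also holds with the off-diagonal kernels $K_s(z,w)$, $K_p(z,w)$ in place of $m_s(z,w)$, $m_p(z,w)$.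
   Context: For $p>0$, $A^p(\Omega)$ is the space of holomorphic functions $f$ on $\Omega$ with $\|f\|_p^p:=\int_\Omega|f|^p<\infty$ (Lebesgue measure). Put $m_p(z):=\inf\{\|f\|_p: f\in A^p(\Omega),\ f(z)=1\}$. For $p\ge1$ the infimum is attained by exactly one function, denoted $m_p(\cdot,z)$ (so $m_p(\zeta,z)$ is its value at $\zeta$). Set $K_p(z):=m_p(z)^{-p}$ for $p>0$ and $K_p(z,w):=m_p(z,w)K_p(w)$ for $p\ge1$. Identify $X=\sum_jX_j\,\partial/\partial z_j$ with $(X_1,\dots,X_n)$, write $Xf=\sum_jX_j\,\partial f/\partial z_j$, and set $B_p(z;X):=K_p(z)^{-1/p}\cdot\sup\{|Xf(z)|: f\in A^p(\Omega),\ f(z)=0,\ \|f\|_p=1\}$. Density of $A^{p'}(\Omega)$ in $A^p(\Omega)$ is with respect to $\|\cdot\|_p$. *)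

theory Defs
  imports "HOL-Analysis.Analysis" "HOL-Library.FuncSet"
begin

text \<open>Holomorphy in several variables: complex Frechet differentiability, i.e. the real
  Frechet derivative exists and is complex linear.\<close>

definition holo_on :: "(complex ^ 'n \<Rightarrow> complex) \<Rightarrow> (complex ^ 'n) set \<Rightarrow> bool" where
  "holo_on f \<Omega> \<longleftrightarrow>
     (\<forall>z\<in>\<Omega>. \<exists>L. (f has_derivative L) (at z) \<and> (\<forall>c v. L (c *s v) = c * L v))"

definition Lp_norm :: "(complex ^ 'n) set \<Rightarrow> real \<Rightarrow> (complex ^ 'n \<Rightarrow> complex) \<Rightarrow> real" where
  "Lp_norm \<Omega> p f = (LINT x:\<Omega>|lborel. norm (f x) powr p) powr (1 / p)"

text \<open>Elements are functions on \<open>\<Omega>\<close> proper: being extensional makes HOL equality coincide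
  with equality on \<open>\<Omega>\<close>, so that the uniqueness of the minimizer below is meaningful.\<close>

definition bergman_space :: "(complex ^ 'n) set \<Rightarrow> real \<Rightarrow> (complex ^ 'n \<Rightarrow> complex) set" where
  "bergman_space \<Omega> p =
     {f \<in> extensional \<Omega>. holo_on f \<Omega> \<and> set_integrable lborel \<Omega> (\<lambda>x. norm (f x) powr p)}"

definition m_val :: "(complex ^ 'n) set \<Rightarrow> real \<Rightarrow> complex ^ 'n \<Rightarrow> real" where
  "m_val \<Omega> p z = Inf {Lp_norm \<Omega> p f | f. f \<in> bergman_space \<Omega> p \<and> f z = 1}"

text \<open>For \<open>p \<ge> 1\<close> on a bounded domain the minimizer exists and is unique; the first
  argument \<open>\<zeta>\<close> is the point of evaluation, the second one \<open>z\<close> the point of normalization.\<close>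

definition m_fun :: "(complex ^ 'n) set \<Rightarrow> real \<Rightarrow> complex ^ 'n \<Rightarrow> complex ^ 'n \<Rightarrow> complex" where
  "m_fun \<Omega> p \<zeta> z =
     (THE f. f \<in> bergman_space \<Omega> p \<and> f z = 1 \<and> Lp_norm \<Omega> p f = m_val \<Omega> p z) \<zeta>"

definition K_diag :: "(complex ^ 'n) set \<Rightarrow> real \<Rightarrow> complex ^ 'n \<Rightarrow> real" where
  "K_diag \<Omega> p z = m_val \<Omega> p z powr (- p)"

definition K_off :: "(complex ^ 'n) set \<Rightarrow> real \<Rightarrow> complex ^ 'n \<Rightarrow> complex ^ 'n \<Rightarrow> complex" where
  "K_off \<Omega> p z w = m_fun \<Omega> p z w * complex_of_real (K_diag \<Omega> p w)"

definition cpartial :: "'n \<Rightarrow> (complex ^ 'n \<Rightarrow> complex) \<Rightarrow> complex ^ 'n \<Rightarrow> complex" where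
  "cpartial j f z = deriv (\<lambda>t. f (z + axis j t)) 0"

definition dir_deriv :: "complex ^ 'n \<Rightarrow> (complex ^ 'n \<Rightarrow> complex) \<Rightarrow> complex ^ 'n \<Rightarrow> complex" where
  "dir_deriv X f z = (\<Sum>j\<in>UNIV. X $ j * cpartial j f z)"

definition B_metric :: "(complex ^ 'n) set \<Rightarrow> real \<Rightarrow> complex ^ 'n \<Rightarrow> complex ^ 'n \<Rightarrow> real" where
  "B_metric \<Omega> p z X = K_diag \<Omega> p z powr (- 1 / p) *
     Sup {norm (dir_deriv X f z) | f.
            f \<in> bergman_space \<Omega> p \<and> f z = 0 \<and> Lp_norm \<Omega> p f = 1}"

definition bergman_dense :: "(complex ^ 'n) set \<Rightarrow> real \<Rightarrow> real \<Rightarrow> bool" where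
  "bergman_dense \<Omega> p' p \<longleftrightarrow>
     bergman_space \<Omega> p' \<subseteq> bergman_space \<Omega> p \<and>
     (\<forall>f\<in>bergman_space \<Omega> p. \<forall>\<epsilon>>0. \<exists>g\<in>bergman_space \<Omega> p'. Lp_norm \<Omega> p (\<lambda>x. f x - g x) < \<epsilon>)"

end

theory Submission
  imports Defs "HOL-Complex_Analysis.Complex_Analysis" "HOL-Library.Numeral_Type"
begin

text \<open>
  Normalise Lebesgue measure on \<open>\<Omega>\<close> to total mass one and write
  \<open>N\<^sub>p f\<close> for the mean of \<open>|f|\<^sup>p\<close> to the power \<open>1/p\<close> (\<open>nrm p f\<close> below). By Jensen's
  inequality \<open>N\<^sub>p f\<close> is nondecreasing in \<open>p\<close>. Hence the spaces \<open>A\<^sup>p\<close> shrink as \<open>p\<close>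
  grows, the normalised minimum \<open>mu p z\<close> (the least \<open>N\<^sub>p f\<close> with \<open>f z = 1\<close>) is
  nondecreasing, and the normalised extremal derivative \<open>tau p z X\<close> (the largest \<open>|X f z|\<close> with
  \<open>f z = 0\<close> and \<open>N\<^sub>p f = 1\<close>) is nonincreasing in \<open>p\<close>. The powers of the volume introduced by the
  normalisation cancel in \<open>B\<^sub>p = mu p z * tau p z X\<close>, and the diagonal kernel is
  \<open>(mu p z) powr (-p) / vol\<close>. So one-sided limits of \<open>B\<close> and of the diagonal kernel exist by
  monotonicity, and the rest of the theorem is about identifying limits and about the minimizers.

  Compactness (\<open>bergman_compactness\<close>). If \<open>s\<^sub>k\<close> tends to \<open>p > 0\<close> and the functions
  \<open>f\<^sub>k\<close> in the spaces of exponent \<open>s\<^sub>k\<close> are bounded in norm, then a subsequence converges, together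
  with its first derivatives, to some \<open>g\<close>, and Fatou's lemma bounds \<open>N\<^sub>p g\<close>. The ingredients are
  Montel's theorem in several variables and the bound of \<open>|f|\<close> on small balls by \<open>N\<^sub>q f\<close> for
  arbitrarily small \<open>q > 0\<close>. Consequently minimizers exist, and a limit of extremal functions for
  exponents increasing to \<open>p\<close> is a competitor for \<open>p\<close>; so \<open>mu\<close> and \<open>tau\<close> are left continuous.

  Minimizers (\<open>minimizer_limits_agree\<close>). Let \<open>f\<close> and \<open>g\<close> be minimizers for exponents \<open>s\<close>
  and \<open>t\<close>, let \<open>u = min s t \<ge> 1\<close>, and let \<open>h\<close> be the midpoint of \<open>f\<close> and \<open>g\<close>, a competitor for
  \<open>u\<close>. The mean of \<open>(|f|\<^sup>u + |g|\<^sup>u) / 2 - |h|\<^sup>u\<close> is at most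
  \<open>((mu s)\<^sup>u + (mu t)\<^sup>u) / 2 - (mu u)\<^sup>u\<close>, and the integrand is nonnegative by convexity. When the
  three values of \<open>mu\<close> tend to the same limit, Fatou's lemma shows that the integrand formed with the
  limits \<open>F\<close>, \<open>G\<close> of the minimizers vanishes identically, so \<open>|F + G| = |F| + |G|\<close>. Then \<open>F / G\<close> is
  holomorphic and real near the point of normalisation, hence equal to \<open>1\<close> there, and \<open>F = G\<close> by the
  identity theorem on the connected set \<open>\<Omega>\<close>. No uniform convexity enters, which is why the
  argument reaches \<open>p = 1\<close>. With \<open>s = t = p\<close> it is uniqueness of the minimizer; with two sequences
  decreasing to \<open>p\<close> it shows that the right limit exists; with one of the sequences constantly \<open>p\<close> it
  identifies a one-sided limit with \<open>m\<^sub>p\<close> whenever \<open>mu\<close> is continuous at \<open>p\<close> from that side.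

  Density. A fixed \<open>h\<close> in the space of exponent \<open>p' > p\<close> has \<open>N\<^sub>s h \<rightarrow> N\<^sub>p h\<close> as \<open>s\<close> decreases to
  \<open>p\<close>, by dominated convergence, so it bounds the right limits of \<open>mu\<close> and \<open>tau\<close>. If these functions
  are dense, they suffice to compute \<open>mu p z\<close> and \<open>tau p z X\<close>, and both are right continuous at \<open>p\<close>.
\<close>

section \<open>Complex differentiation along complex lines\<close>

lemma norm_vector_smult_complex: "norm (c *s v) = norm c * norm (v :: complex ^ 'n)"
  by (simp add: norm_vec_def L2_set_right_distrib norm_mult)

lemma bounded_linear_vector_smult: "bounded_linear (\<lambda>t. t *s (v :: complex ^ 'n))"
  by (intro linear_conv_bounded_linear[THEN iffD1] linearI) (auto simp: vec_eq_iff algebra_simps)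

lemma
  assumes "holo_on f \<Omega>" "z \<in> \<Omega>"
  shows holo_on_has_derivative: "(f has_derivative frechet_derivative f (at z)) (at z)"
    and holo_on_frechet_smult: "frechet_derivative f (at z) (c *s v) = c * frechet_derivative f (at z) v"
proof -
  obtain L where L: "(f has_derivative L) (at z)" "\<And>c v. L (c *s v) = c * L v"
    using assms unfolding holo_on_def by blast
  have "frechet_derivative f (at z) = L"
    using frechet_derivative_at[OF L(1)] by (rule sym)
  with L show "(f has_derivative frechet_derivative f (at z)) (at z)"
     "frechet_derivative f (at z) (c *s v) = c * frechet_derivative f (at z) v" by auto
qed

lemma holo_onI:
  assumes "\<And>z. z \<in> \<Omega> \<Longrightarrow> (f has_derivative L z) (at z)" "\<And>z c v. z \<in> \<Omega> \<Longrightarrow> L z (c *s v) = c * L z v"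
  shows "holo_on f \<Omega>"
  using assms unfolding holo_on_def by blast

lemma holo_on_subset: "holo_on f \<Omega> \<Longrightarrow> U \<subseteq> \<Omega> \<Longrightarrow> holo_on f U"
  unfolding holo_on_def by blast

lemma holo_on_continuous_on: "holo_on f \<Omega> \<Longrightarrow> continuous_on \<Omega> f"
  by (intro continuous_at_imp_continuous_on ballI)
    (auto simp: holo_on_def dest: has_derivative_continuous)

lemma holo_on_cong:
  assumes "open \<Omega>" "\<And>x. x \<in> \<Omega> \<Longrightarrow> f x = g x"
  shows "holo_on f \<Omega> \<longleftrightarrow> holo_on g \<Omega>"
proof -
  have *: "holo_on h \<Omega>" if "holo_on k \<Omega>" "\<And>x. x \<in> \<Omega> \<Longrightarrow> h x = k x" for h k
    by (rule holo_onI[of _ _ "\<lambda>z. frechet_derivative k (at z)"])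
      (auto simp: that(2) holo_on_frechet_smult[OF that(1)]
        intro: has_derivative_transform_within_open[OF holo_on_has_derivative[OF that(1)] \<open>open \<Omega>\<close>])
  show ?thesis using *[of f g] *[of g f] assms(2) by auto
qed

lemma frechet_derivative_cong_open:
  assumes "open \<Omega>" "\<And>x. x \<in> \<Omega> \<Longrightarrow> f x = g x" "z \<in> \<Omega>"
  shows "frechet_derivative f (at z) = frechet_derivative g (at z)"
proof -
  have "(f has_derivative L) (at z) \<longleftrightarrow> (g has_derivative L) (at z)" for L
    using assms by (metis has_derivative_transform_within_open)
  then show ?thesis unfolding frechet_derivative_def by simp
qed

lemma holo_on_const: "holo_on (\<lambda>x. c) \<Omega>"
  unfolding holo_on_def by (auto intro!: exI[of _ "\<lambda>x. 0"])

lemma holo_on_component: "holo_on (\<lambda>x. x $ j) \<Omega>"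
  unfolding holo_on_def
  by (auto intro!: exI[of _ "\<lambda>x. x $ j"] bounded_linear_imp_has_derivative bounded_linear_vec_nth)

lemma holo_on_lincomb:
  assumes "holo_on f \<Omega>" "holo_on g \<Omega>"
  shows "holo_on (\<lambda>x. a * f x + b * g x) \<Omega>"
proof (rule holo_onI)
  fix z assume z: "z \<in> \<Omega>"
  note [derivative_intros] = holo_on_has_derivative[OF assms(1) z] holo_on_has_derivative[OF assms(2) z]
  show "((\<lambda>x. a * f x + b * g x) has_derivative
     (\<lambda>v. a * frechet_derivative f (at z) v + b * frechet_derivative g (at z) v)) (at z)"
    by (auto intro!: derivative_eq_intros)
  show "a * frechet_derivative f (at z) (c *s v) + b * frechet_derivative g (at z) (c *s v)
     = c * (a * frechet_derivative f (at z) v + b * frechet_derivative g (at z) v)" for c v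
    using holo_on_frechet_smult[OF assms(1) z] holo_on_frechet_smult[OF assms(2) z]
    by (simp add: algebra_simps)
qed

lemma frechet_derivative_lincomb:
  assumes "holo_on f \<Omega>" "holo_on g \<Omega>" "z \<in> \<Omega>"
  shows "frechet_derivative (\<lambda>x. a * f x + b * g x) (at z) v =
    a * frechet_derivative f (at z) v + b * frechet_derivative g (at z) v"
proof -
  note [derivative_intros] = holo_on_has_derivative[OF assms(1,3)] holo_on_has_derivative[OF assms(2,3)]
  have "((\<lambda>x. a * f x + b * g x) has_derivative
     (\<lambda>v. a * frechet_derivative f (at z) v + b * frechet_derivative g (at z) v)) (at z)"
    by (auto intro!: derivative_eq_intros)
  from frechet_derivative_at[OF this, symmetric] show ?thesis by simp
qed

text \<open>
  Restriction to complex lines carries the one-variable theory over: the chain rule gives a real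
  derivative, and complex linearity turns it into a complex one.
\<close>

lemma holo_on_slice:
  assumes "holo_on f \<Omega>" "a + t *s v \<in> \<Omega>"
  shows "((\<lambda>t. f (a + t *s v)) has_field_derivative frechet_derivative f (at (a + t *s v)) v) (at t)"
proof -
  let ?L = "frechet_derivative f (at (a + t *s v))"
  have 1: "((\<lambda>t. a + t *s v) has_derivative (\<lambda>t. t *s v)) (at t)"
    using bounded_linear_imp_has_derivative[OF bounded_linear_vector_smult[of v]]
    by (auto intro!: derivative_eq_intros)
  have "((\<lambda>t. f (a + t *s v)) has_derivative (\<lambda>t. ?L (t *s v))) (at t)"
    using has_derivative_compose[OF 1 holo_on_has_derivative[OF assms]] .
  then show ?thesis
    using holo_on_frechet_smult[OF assms] by (simp add: has_field_derivative_def mult_commute_abs)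
qed

lemma holo_on_slice_holomorphic:
  assumes "holo_on f \<Omega>" "\<And>t. t \<in> T \<Longrightarrow> a + t *s v \<in> \<Omega>"
  shows "(\<lambda>t. f (a + t *s v)) holomorphic_on T"
  using holo_on_slice[OF assms(1) assms(2)]
  by (auto simp: holomorphic_on_def field_differentiable_def intro: has_field_derivative_at_within)

text \<open>
  Complex linearity of the derivative reassembles the directional derivative, given as a combination
  of partial derivatives, into one value of the Frechet derivative. Limits and estimates below are
  therefore stated for the Frechet derivative only.
\<close>

lemma dir_deriv_eq_frechet:
  assumes "holo_on f \<Omega>" "z \<in> \<Omega>"
  shows "dir_deriv X f z = frechet_derivative f (at z) X"
proof -
  let ?L = "frechet_derivative f (at z)"
  have ax: "axis j t = t *s axis j 1" for t :: complex and j :: 'a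
    by (simp add: vec_eq_iff axis_def)
  have "cpartial j f z = ?L (axis j 1)" for j
  proof -
    have "(\<lambda>t. f (z + axis j t)) = (\<lambda>t. f (z + t *s axis j 1))"
      by (rule ext) (subst ax, rule refl)
    then show ?thesis
      unfolding cpartial_def
      using holo_on_slice[OF assms(1), of z 0 "axis j 1"] assms(2) by (auto intro!: DERIV_imp_deriv)
  qed
  then have "dir_deriv X f z = (\<Sum>j\<in>UNIV. ?L (X $ j *s axis j 1))"
    unfolding dir_deriv_def using holo_on_frechet_smult[OF assms] by simp
  also have "\<dots> = ?L (\<Sum>j\<in>UNIV. X $ j *s axis j 1)"
    using has_derivative_linear[OF holo_on_has_derivative[OF assms]] by (simp add: linear_sum)
  also have "(\<Sum>j\<in>UNIV. X $ j *s axis j 1) = X"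
    by (simp add: vec_eq_iff axis_def if_distrib if_distribR cong: if_cong)
  finally show ?thesis .
qed

text \<open>
  The one-variable Cauchy estimate on the line through \<open>a\<close> in direction \<open>v\<close>, where the ball of radius
  \<open>r\<close> cuts out a disc of radius \<open>r / norm v\<close>.
\<close>

lemma holo_on_Cauchy_estimate:
  assumes f: "holo_on f (ball a r)" and M: "\<And>x. x \<in> ball a r \<Longrightarrow> norm (f x) \<le> M" and "0 < r"
  shows "norm (frechet_derivative f (at a) v) \<le> M / r * norm v"
proof (cases "v = 0")
  case True
  have "linear (frechet_derivative f (at a))"
    using has_derivative_linear[OF holo_on_has_derivative[OF f]] \<open>0 < r\<close> by auto
  then show ?thesis using True by (simp add: linear_0)
next
  case False
  have le: "norm (frechet_derivative f (at a) v) \<le> M / s" if s: "0 < s" "s < r / norm v" for s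
  proof -
    have in_ball: "a + t *s v \<in> ball a r" if "norm t \<le> s" for t
    proof -
      have "norm t * norm v \<le> s * norm v" using that by (intro mult_right_mono) auto
      also have "\<dots> < r" using s False by (simp add: pos_less_divide_eq)
      finally show ?thesis by (simp add: dist_norm norm_vector_smult_complex)
    qed
    have hol: "(\<lambda>t. f (a + t *s v)) holomorphic_on cball 0 s"
      by (rule holo_on_slice_holomorphic[OF f], rule in_ball) auto
    have "norm ((deriv ^^ 1) (\<lambda>t. f (a + t *s v)) 0) \<le> fact 1 * M / s ^ 1"
      by (rule Cauchy_inequality)
        (use hol s in \<open>auto intro!: M in_ball holomorphic_on_imp_continuous_on elim: holomorphic_on_subset\<close>)
    moreover have "deriv (\<lambda>t. f (a + t *s v)) 0 = frechet_derivative f (at a) v"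
      using holo_on_slice[OF f, of a 0 v] \<open>0 < r\<close> by (auto intro!: DERIV_imp_deriv)
    ultimately show ?thesis by simp
  qed
  \<comment> \<open>the slice is known only on the open disc, so the estimate comes from smaller circles in the limit\<close>
  define R where "R = r / norm v"
  have R: "R > 0" using False \<open>0 < r\<close> by (simp add: R_def)
  have "((\<lambda>s. M / s) \<longlongrightarrow> M / R) (at_left R)"
    using R by (auto intro!: tendsto_eq_intros)
  moreover have "\<forall>\<^sub>F s in at_left R. norm (frechet_derivative f (at a) v) \<le> M / s"
    using eventually_at_left_real[OF R] by eventually_elim (use le in \<open>auto simp: R_def\<close>)
  ultimately have "norm (frechet_derivative f (at a) v) \<le> M / R"
    by (rule tendsto_lowerbound) simp
  then show ?thesis using False by (simp add: R_def)
qed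

text \<open>
  The Cauchy estimate applies at each point of the smaller ball with the same radius \<open>r\<close>. The Lipschitz
  constant depends on \<open>f\<close> only through the bound \<open>M\<close>, which is the equicontinuity that Montel's theorem
  needs.
\<close>

lemma holo_on_Lipschitz:
  assumes f: "holo_on f (ball a (2*r))" and M: "\<And>x. x \<in> ball a (2*r) \<Longrightarrow> norm (f x) \<le> M" and "0 < r"
    and xy: "x \<in> ball a r" "y \<in> ball a r"
  shows "norm (f x - f y) \<le> M / r * norm (x - y)"
proof (rule differentiable_bound[OF convex_ball])
  fix u assume u: "u \<in> ball a r"
  have sub: "ball u r \<subseteq> ball a (2*r)"
  proof
    fix w assume "w \<in> ball u r"
    then show "w \<in> ball a (2*r)" using u dist_triangle[of a w u] by simp
  qed
  show "(f has_derivative frechet_derivative f (at u)) (at u within ball a r)"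
    by (rule has_derivative_at_withinI, rule holo_on_has_derivative[OF f])
      (use sub \<open>0 < r\<close> in \<open>meson centre_in_ball subsetD\<close>)
  have "norm (f w) \<le> M" if "w \<in> ball u r" for w
    using that sub M by blast
  from holo_on_Cauchy_estimate[OF holo_on_subset[OF f sub] this \<open>0 < r\<close>]
  show "onorm (frechet_derivative f (at u)) \<le> M / r"
    by (rule onorm_le)
qed (use xy in auto)

section \<open>Normal families in several variables\<close>

text \<open>
  Weierstrass' theorem. The Cauchy estimate for differences \<open>F m - F n\<close> makes the derivatives a
  uniformly Cauchy sequence, so the limit may be differentiated term by term, and complex linearity
  survives the limit.
\<close>

lemma holo_on_uniform_limit_ball:
  fixes F :: "nat \<Rightarrow> complex ^ 'n \<Rightarrow> complex"
  assumes F: "\<And>k. holo_on (F k) (ball a (2*r))" and r: "0 < r"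
    and lim: "uniform_limit (ball a (2*r)) F g sequentially"
  obtains L where "\<And>x. x \<in> ball a r \<Longrightarrow> (g has_derivative L x) (at x)"
    and "\<And>x c v. x \<in> ball a r \<Longrightarrow> L x (c *s v) = c * L x v"
    and "\<And>x v. x \<in> ball a r \<Longrightarrow> (\<lambda>k. frechet_derivative (F k) (at x) v) \<longlonglongrightarrow> L x v"
proof -
  define D where "D k x = frechet_derivative (F k) (at x)" for k x
  have sub: "ball x r \<subseteq> ball a (2*r)" if "x \<in> ball a r" for x
  proof
    fix w assume "w \<in> ball x r"
    then show "w \<in> ball a (2*r)" using that dist_triangle[of a w x] by simp
  qed
  have cen: "x \<in> ball a (2*r)" if "x \<in> ball a r" for x
    using that r by simp
  have *: "\<exists>N. \<forall>m\<ge>N. \<forall>n\<ge>N. \<forall>x\<in>ball a r. \<forall>v. norm (D m x v - D n x v) \<le> e * norm v" if e: "e > 0" for e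
  proof -
    have "\<forall>\<^sub>F n in sequentially. \<forall>x\<in>ball a (2*r). dist (F n x) (g x) < e * r / 2"
      using uniform_limitD[OF lim, of "e * r / 2"] e r by simp
    then obtain N where N: "\<And>n x. n \<ge> N \<Longrightarrow> x \<in> ball a (2*r) \<Longrightarrow> dist (F n x) (g x) < e * r / 2"
      unfolding eventually_sequentially by blast
    have "norm (D m x v - D n x v) \<le> e * norm v" if mn: "m \<ge> N" "n \<ge> N" and x: "x \<in> ball a r" for m n x v
    proof -
      have hol: "holo_on (F k) (ball x r)" for k
        using holo_on_subset[OF F sub[OF x]] .
      have "norm (1 * F m w + (-1) * F n w) \<le> e * r" if "w \<in> ball x r" for w
      proof -
        have w: "w \<in> ball a (2*r)" using sub[OF x] that by blast
        have "dist (F m w) (F n w) \<le> dist (F m w) (g w) + dist (F n w) (g w)"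
          by (rule dist_triangle2)
        also have "\<dots> \<le> e * r" using N[OF mn(1) w] N[OF mn(2) w] by simp
        finally show ?thesis by (simp add: dist_norm)
      qed
      then have "norm (frechet_derivative (\<lambda>w. 1 * F m w + (-1) * F n w) (at x) v) \<le> e * r / r * norm v"
        by (intro holo_on_Cauchy_estimate[OF holo_on_lincomb[OF hol hol] _ r])
      moreover have "frechet_derivative (\<lambda>w. 1 * F m w + (-1) * F n w) (at x) v = 1 * D m x v + (-1) * D n x v"
        unfolding D_def by (rule frechet_derivative_lincomb[OF hol hol]) (use r in simp)
      ultimately have "norm (1 * D m x v + (-1) * D n x v) \<le> e * r / r * norm v" by metis
      then show ?thesis using r by simp
    qed
    then show ?thesis by blast
  qed
  have conv: "convergent (\<lambda>k. D k x v)" if x: "x \<in> ball a r" for x v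
  proof -
    have "Cauchy (\<lambda>k. D k x v)"
    proof (rule CauchyI)
      fix e :: real assume "e > 0"
      then have "e / (norm v + 1) > 0" by (simp add: add_nonneg_pos)
      from *[OF this] obtain N where
        N: "\<And>m n. m \<ge> N \<Longrightarrow> n \<ge> N \<Longrightarrow> norm (D m x v - D n x v) \<le> e / (norm v + 1) * norm v"
        using x by blast
      have "e / (norm v + 1) * norm v < e"
        using \<open>e > 0\<close> \<open>e / (norm v + 1) > 0\<close>
        by (simp add: zero_less_divide_iff pos_divide_less_eq distrib_left)
      with N show "\<exists>M. \<forall>m\<ge>M. \<forall>n\<ge>M. norm (D m x v - D n x v) < e" by (meson le_less_trans)
    qed
    then show ?thesis by (simp add: Cauchy_convergent_iff)
  qed
  define L where "L x v = lim (\<lambda>k. D k x v)" for x v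
  have L: "(\<lambda>k. D k x v) \<longlonglongrightarrow> L x v" if "x \<in> ball a r" for x v
    using conv[OF that] by (simp add: L_def convergent_LIMSEQ_iff)
  have nle: "\<forall>\<^sub>F n in sequentially. \<forall>x\<in>ball a r. \<forall>h. norm (D n x h - L x h) \<le> e * norm h" if "e > 0" for e
  proof -
    from *[OF that] obtain N where
      N: "\<And>m n x v. m \<ge> N \<Longrightarrow> n \<ge> N \<Longrightarrow> x \<in> ball a r \<Longrightarrow> norm (D m x v - D n x v) \<le> e * norm v"
      by blast
    have "norm (D n x h - L x h) \<le> e * norm h" if "n \<ge> N" "x \<in> ball a r" for n x h
    proof (rule tendsto_upperbound)
      show "(\<lambda>m. norm (D n x h - D m x h)) \<longlonglongrightarrow> norm (D n x h - L x h)"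
        by (intro tendsto_intros L that)
      show "\<forall>\<^sub>F m in sequentially. norm (D n x h - D m x h) \<le> e * norm h"
        using eventually_ge_at_top[of N] by eventually_elim (use N that in blast)
    qed simp
    then show ?thesis unfolding eventually_sequentially by blast
  qed
  have ga: "(\<lambda>n. F n a) \<longlonglongrightarrow> g a"
    using tendsto_uniform_limitI[OF lim] r by simp
  have dF: "(F n has_derivative D n x) (at x within ball a r)" if "x \<in> ball a r" for n x
    unfolding D_def by (rule has_derivative_at_withinI[OF holo_on_has_derivative[OF F cen[OF that]]])
  have "\<exists>g'. \<forall>x\<in>ball a r. (\<lambda>n. F n x) \<longlonglongrightarrow> g' x \<and> (g' has_derivative L x) (at x within ball a r)"
    by (rule has_derivative_sequence[OF convex_ball dF nle _ ga]) (use r in auto)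
  then obtain g' where g': "\<And>x. x \<in> ball a r \<Longrightarrow> (\<lambda>n. F n x) \<longlonglongrightarrow> g' x"
    "\<And>x. x \<in> ball a r \<Longrightarrow> (g' has_derivative L x) (at x within ball a r)" by blast
  have eq: "g' x = g x" if "x \<in> ball a r" for x
    using LIMSEQ_unique[OF g'(1)[OF that] tendsto_uniform_limitI[OF lim cen[OF that]]] .
  show thesis
  proof
    fix x assume x: "x \<in> ball a r"
    have "(g' has_derivative L x) (at x)"
      using g'(2)[OF x] x at_within_open[OF x open_ball] by simp
    then show "(g has_derivative L x) (at x)"
      by (rule has_derivative_transform_within_open[OF _ open_ball x]) (rule eq)
    show "(\<lambda>k. frechet_derivative (F k) (at x) v) \<longlonglongrightarrow> L x v" for v
      using L[OF x] by (simp add: D_def)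
    show "L x (c *s v) = c * L x v" for c v
    proof (rule LIMSEQ_unique[OF L[OF x]])
      have "(\<lambda>k. c * D k x v) \<longlonglongrightarrow> c * L x v" by (intro tendsto_intros L x)
      then show "(\<lambda>k. D k x (c *s v)) \<longlonglongrightarrow> c * L x v"
        unfolding D_def holo_on_frechet_smult[OF F cen[OF x]] .
    qed
  qed
qed

text \<open>
  A diagonal subsequence converges on a countable dense subset. Local equicontinuity spreads the
  convergence to all of \<open>\<Omega>\<close>, locally uniformly, and Weierstrass' theorem applies to the limit. The
  convergence of derivatives is part of the conclusion because the extremal problem for \<open>tau\<close> is about
  derivatives.
\<close>

theorem Montel_holo_on:
  fixes F :: "nat \<Rightarrow> complex ^ 'n \<Rightarrow> complex"
  assumes F: "\<And>k. holo_on (F k) \<Omega>"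
    and bdd: "\<And>a. a \<in> \<Omega> \<Longrightarrow> \<exists>r>0. \<exists>M. ball a r \<subseteq> \<Omega> \<and> (\<forall>k. \<forall>x\<in>ball a r. norm (F k x) \<le> M)"
  obtains \<phi> :: "nat \<Rightarrow> nat" and g where "strict_mono \<phi>" "holo_on g \<Omega>"
    and "\<And>x. x \<in> \<Omega> \<Longrightarrow> (\<lambda>k. F (\<phi> k) x) \<longlonglongrightarrow> g x"
    and "\<And>x v. x \<in> \<Omega> \<Longrightarrow>
           (\<lambda>k. frechet_derivative (F (\<phi> k)) (at x) v) \<longlonglongrightarrow> frechet_derivative g (at x) v"
proof -
  obtain T where T: "countable T" "T \<subseteq> \<Omega>" "\<Omega> \<subseteq> closure T"
    using separable by blast
  have "\<forall>x\<in>\<Omega>. \<exists>M. \<forall>k. norm (F k x) \<le> M" using bdd centre_in_ball by metis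
  then obtain b where b: "\<And>x k. x \<in> \<Omega> \<Longrightarrow> norm (F k x) \<le> b x" by metis
  \<comment> \<open>the diagonal argument wants one bound for all points, so values are divided by a bound valid at the point\<close>
  define c where "c x = b x + 1" for x
  have c: "c x > 0" if "x \<in> \<Omega>" for x
    using order_trans[OF norm_ge_zero b[OF that, of 0]] by (simp add: c_def)
  have nl: "norm (F k x / of_real (c x)) \<le> 1" if "x \<in> T" for k x
    using b[of x k] c[of x] that T(2) by (auto simp: norm_divide divide_le_eq c_def)
  obtain \<phi> :: "nat \<Rightarrow> nat"
    where \<phi>: "strict_mono \<phi>" and ex: "\<And>x. x \<in> T \<Longrightarrow> \<exists>l. (\<lambda>n. F (\<phi> n) x / of_real (c x)) \<longlonglongrightarrow> l"
    by (rule function_convergent_subsequence[OF T(1), where f = "\<lambda>k x. F k x / of_real (c x)" and M = 1],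
        erule nl) blast
  have convT: "Cauchy (\<lambda>n. F (\<phi> n) x)" if x: "x \<in> T" for x
  proof -
    obtain l where "(\<lambda>n. F (\<phi> n) x / of_real (c x)) \<longlonglongrightarrow> l" using ex[OF x] by blast
    then have "(\<lambda>n. of_real (c x) * (F (\<phi> n) x / of_real (c x))) \<longlonglongrightarrow> of_real (c x) * l"
      by (intro tendsto_intros)
    moreover have "c x \<noteq> 0" using c x T(2) by force
    ultimately show ?thesis by (auto intro: LIMSEQ_imp_Cauchy)
  qed
  define g where "g x = lim (\<lambda>n. F (\<phi> n) x)" for x
  \<comment> \<open>local equicontinuity turns convergence on a dense set into locally uniform convergence\<close>
  have unif: "\<exists>r>0. ball a (2*r) \<subseteq> \<Omega> \<and> uniform_limit (ball a (2*r)) (\<lambda>n. F (\<phi> n)) g sequentially" if a: "a \<in> \<Omega>" for a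
  proof -
    obtain R M where R: "R > 0" "ball a R \<subseteq> \<Omega>" and M: "\<And>k x. x \<in> ball a R \<Longrightarrow> norm (F k x) \<le> M"
      using bdd[OF a] by blast
    define r where "r = R / 8"
    have r: "r > 0" "R = 2 * (4 * r)" using R by (auto simp: r_def)
    have M0: "M \<ge> 0" using order_trans[OF norm_ge_zero M[of a 0]] R by simp
    have lip: "norm (F k x - F k y) \<le> M / (4 * r) * norm (x - y)" if "x \<in> ball a (4*r)" "y \<in> ball a (4*r)" for k x y
      by (rule holo_on_Lipschitz[OF holo_on_subset[OF F]]) (use R r M that in auto)
    define C where "C = M / (4 * r) + 1"
    have C: "C > 0" using M0 r by (simp add: C_def add_nonneg_pos)
    have "uniformly_Cauchy_on (cball a (2*r)) (\<lambda>n. F (\<phi> n))"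
    proof (rule uniformly_Cauchy_onI')
      fix e :: real assume e: "e > 0"
      define d where "d = min (e / (3 * C)) r"
      have d: "d > 0" "d \<le> r" "C * d \<le> e / 3" using e C r by (auto simp: d_def min_def field_simps)
      let ?T = "T \<inter> ball a (4*r)"
      have "cball a (2*r) \<subseteq> (\<Union>t\<in>?T. ball t d)"
      proof
        fix x assume x: "x \<in> cball a (2*r)"
        then have "x \<in> ball a R" using r by auto
        then have "x \<in> \<Omega>" using R(2) by blast
        then have "x \<in> closure T" using T by blast
        then obtain t where t: "t \<in> T" "dist t x < d" using d by (meson closure_approachable)
        then have "t \<in> ball a (4*r)"
          using x d r dist_triangle[of a t x] by (simp add: dist_commute)
        with t show "x \<in> (\<Union>t\<in>?T. ball t d)" by auto
      qed
      then obtain Q where Q: "Q \<subseteq> ?T" "finite Q" "cball a (2*r) \<subseteq> (\<Union>t\<in>Q. ball t d)"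
        by (rule compactE_image[OF compact_cball, rotated]) auto
      have "\<exists>N. \<forall>m\<ge>N. \<forall>n\<ge>N. dist (F (\<phi> m) t) (F (\<phi> n) t) < e / 3" if "t \<in> Q" for t
        using convT[of t] that Q(1) e unfolding Cauchy_def by (meson IntD1 subsetD zero_less_divide_iff zero_less_numeral)
      then obtain N where N: "\<And>t m n. t \<in> Q \<Longrightarrow> m \<ge> N t \<Longrightarrow> n \<ge> N t \<Longrightarrow> dist (F (\<phi> m) t) (F (\<phi> n) t) < e / 3"
        by metis
      define K where "K = Max (insert 0 (N ` Q))"
      have K: "N t \<le> K" if "t \<in> Q" for t using that Q(2) by (auto simp: K_def)
      have "dist (F (\<phi> m) x) (F (\<phi> n) x) < e" if x: "x \<in> cball a (2*r)" and mn: "m \<ge> K" "n \<ge> K" for m n x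
      proof -
        obtain t where t: "t \<in> Q" "dist t x < d" using Q(3) x by auto
        have tb: "t \<in> ball a (4*r)" using t Q(1) by auto
        have xb: "x \<in> ball a (4*r)" using x r by auto
        have near: "dist (F k x) (F k t) \<le> e / 3" for k
        proof -
          have "norm (F k x - F k t) \<le> M / (4 * r) * norm (x - t)" by (rule lip[OF xb tb])
          also have "\<dots> \<le> C * d" using t(2) M0 r
            by (intro mult_mono) (auto simp: C_def dist_norm norm_minus_commute)
          finally show ?thesis using d by (simp add: dist_norm)
        qed
        have "dist (F (\<phi> m) x) (F (\<phi> n) x) \<le> dist (F (\<phi> m) x) (F (\<phi> m) t) + dist (F (\<phi> m) t) (F (\<phi> n) t) + dist (F (\<phi> n) x) (F (\<phi> n) t)"
          using dist_triangle[of "F (\<phi> m) x" "F (\<phi> n) x" "F (\<phi> m) t"] dist_triangle2[of "F (\<phi> m) t" "F (\<phi> n) x" "F (\<phi> n) t"] by linarith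
        also have "\<dots> < e / 3 + e / 3 + e / 3"
          using near[of "\<phi> m"] near[of "\<phi> n"] N[OF t(1), of m n] K[OF t(1)] mn by simp
        finally show ?thesis by simp
      qed
      then show "\<exists>M. \<forall>x\<in>cball a (2*r). \<forall>m\<ge>M. \<forall>n>m. dist (F (\<phi> m) x) (F (\<phi> n) x) < e"
        by (metis less_imp_le order_trans)
    qed
    then have "uniform_limit (cball a (2*r)) (\<lambda>n. F (\<phi> n)) g sequentially"
      unfolding g_def using Cauchy_uniformly_convergent uniformly_convergent_uniform_limit_iff by blast
    then have "uniform_limit (ball a (2*r)) (\<lambda>n. F (\<phi> n)) g sequentially"
      by (rule uniform_limit_on_subset) auto
    moreover have "ball a (2*r) \<subseteq> \<Omega>" using R r subset_ball[of "2*r" R a] by auto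
    ultimately show ?thesis using r by blast
  qed
  have main: "\<exists>L. (g has_derivative L) (at x) \<and> (\<forall>c v. L (c *s v) = c * L v) \<and>
      (\<forall>v. (\<lambda>k. frechet_derivative (F (\<phi> k)) (at x) v) \<longlonglongrightarrow> L v) \<and> (\<lambda>k. F (\<phi> k) x) \<longlonglongrightarrow> g x" if x: "x \<in> \<Omega>" for x
  proof -
    obtain r where r: "r > 0" "ball x (2*r) \<subseteq> \<Omega>"
      and lim: "uniform_limit (ball x (2*r)) (\<lambda>n. F (\<phi> n)) g sequentially" using unif[OF x] by blast
    obtain L where L: "\<And>y. y \<in> ball x r \<Longrightarrow> (g has_derivative L y) (at y)"
      "\<And>y c v. y \<in> ball x r \<Longrightarrow> L y (c *s v) = c * L y v"
      "\<And>y v. y \<in> ball x r \<Longrightarrow> (\<lambda>k. frechet_derivative (F (\<phi> k)) (at y) v) \<longlonglongrightarrow> L y v"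
      using holo_on_uniform_limit_ball[OF holo_on_subset[OF F r(2)] r(1) lim] by blast
    have "x \<in> ball x r" "x \<in> ball x (2*r)" using r by auto
    with L tendsto_uniform_limitI[OF lim] show ?thesis by blast
  qed
  have hg: "holo_on g \<Omega>" using main unfolding holo_on_def by blast
  have "(\<lambda>k. frechet_derivative (F (\<phi> k)) (at x) v) \<longlonglongrightarrow> frechet_derivative g (at x) v" if x: "x \<in> \<Omega>" for x v
  proof -
    obtain L where "(g has_derivative L) (at x)" and "(\<lambda>k. frechet_derivative (F (\<phi> k)) (at x) v) \<longlonglongrightarrow> L v"
      using main[OF x] by blast
    then show ?thesis using frechet_derivative_at by metis
  qed
  with that[OF \<phi> hg] main show thesis by blast
qed

section \<open>The identity theorem and additive moduli\<close>

lemma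
  fixes a b v :: "complex ^ 'n"
  shows open_slice_ball: "open {t. a + t *s v \<in> ball b \<rho>}"
    and convex_slice_ball: "convex {t. a + t *s v \<in> ball b \<rho>}"
proof -
  have "continuous_on UNIV (\<lambda>t. a + t *s v)"
    by (intro continuous_intros linear_continuous_on bounded_linear_vector_smult)
  then have "open ((\<lambda>t. a + t *s v) -` ball b \<rho>)"
    by (intro open_vimage) auto
  then show "open {t. a + t *s v \<in> ball b \<rho>}" by (simp add: vimage_def)
  show "convex {t. a + t *s v \<in> ball b \<rho>}"
  proof (rule convexI)
    fix s t and p q :: real
    assume st: "s \<in> {t. a + t *s v \<in> ball b \<rho>}" "t \<in> {t. a + t *s v \<in> ball b \<rho>}"
      and pq: "0 \<le> p" "0 \<le> q" "p + q = 1"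
    have "p *\<^sub>R (a + s *s v) + q *\<^sub>R (a + t *s v) \<in> ball b \<rho>"
      using convexD[OF convex_ball _ _ pq] st by blast
    also have "p *\<^sub>R (a + s *s v) + q *\<^sub>R (a + t *s v) = (p + q) *\<^sub>R a + (p *\<^sub>R s + q *\<^sub>R t) *s v"
      by (simp add: vec_eq_iff algebra_simps)
    finally show "p *\<^sub>R s + q *\<^sub>R t \<in> {t. a + t *s v \<in> ball b \<rho>}" using pq by simp
  qed
qed

text \<open>
  The interior of the coincidence set is relatively closed: if it meets a ball inside \<open>\<Omega>\<close>, then it
  contains the ball, since every point of the ball lies on a complex line through a point of the
  interior, and the line meets the ball in a connected set where one-variable continuation works.
\<close>

theorem holo_on_identity:
  fixes f g :: "complex ^ 'n \<Rightarrow> complex"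
  assumes "open \<Omega>" "connected \<Omega>" and f: "holo_on f \<Omega>" and g: "holo_on g \<Omega>"
    and w: "w \<in> \<Omega>" and r: "r > 0" and eq: "\<And>x. x \<in> ball w r \<Longrightarrow> f x = g x" and x: "x \<in> \<Omega>"
  shows "f x = g x"
proof -
  define U where "U = \<Omega> \<inter> interior {x. f x = g x}"
  have oU: "open U" using \<open>open \<Omega>\<close> by (auto simp: U_def)
  have "w \<in> U"
    using w r eq by (auto simp: U_def mem_interior intro!: exI[of _ r])
  have spread: "ball b \<rho> \<subseteq> U" if b: "ball b \<rho> \<subseteq> \<Omega>" and a: "a \<in> U" "a \<in> ball b \<rho>" for a b \<rho>
  proof -
    have "f y = g y" if y: "y \<in> ball b \<rho>" for y
    proof -
      define v where "v = y - a"
      define T where "T = {t. a + t *s v \<in> ball b \<rho>}"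
      have oT: "open T" and cT: "connected T"
        unfolding T_def using open_slice_ball convex_slice_ball convex_connected by blast+
      have "a \<in> interior {x. f x = g x}" using a U_def by auto
      then obtain \<delta> where d: "\<delta> > 0" "ball a \<delta> \<subseteq> {x. f x = g x}" unfolding mem_interior by blast
      have 1: "1 \<in> T" using y by (simp add: T_def v_def)
      let ?S = "T \<inter> {t. a + t *s v \<in> ball a \<delta>}"
      have "f (a + 1 *s v) = g (a + 1 *s v)"
      proof (rule analytic_continuation_open[where s = ?S and s' = T and z = 1
            and f = "\<lambda>t. f (a + t *s v)" and g = "\<lambda>t. g (a + t *s v)"])
        show "open ?S" using oT open_slice_ball by (intro open_Int)
        have "0 \<in> ?S" using a d by (simp add: T_def)
        then show "?S \<noteq> {}" by blast
        show "(\<lambda>t. f (a + t *s v)) holomorphic_on T" "(\<lambda>t. g (a + t *s v)) holomorphic_on T"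
          using b by (auto simp: T_def intro!: holo_on_slice_holomorphic[OF f] holo_on_slice_holomorphic[OF g])
        show "f (a + t *s v) = g (a + t *s v)" if "t \<in> ?S" for t
          using that d(2) by auto
      qed (use oT cT 1 in auto)
      then show ?thesis by (simp add: v_def)
    qed
    then have "ball b \<rho> \<subseteq> interior {x. f x = g x}"
      by (intro interior_maximal) auto
    then show ?thesis using b U_def by blast
  qed
  have "open (\<Omega> - U)"
  proof (subst open_contains_ball, rule ballI)
    fix b assume b: "b \<in> \<Omega> - U"
    then obtain \<rho> where \<rho>: "\<rho> > 0" "ball b \<rho> \<subseteq> \<Omega>" using \<open>open \<Omega>\<close> open_contains_ball by blast
    have "ball b \<rho> \<inter> U = {}" using spread[OF \<rho>(2)] b \<rho>(1) centre_in_ball by blast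
    then show "\<exists>e>0. ball b e \<subseteq> \<Omega> - U" using \<rho> by blast
  qed
  then have "\<Omega> - U = {}"
    using connectedD[OF \<open>connected \<Omega>\<close> oU, of "\<Omega> - U"] \<open>w \<in> U\<close> w by blast
  then show ?thesis using x interior_subset unfolding U_def by blast
qed

text \<open>
  A nonconstant holomorphic function is an open map, and no nonempty open subset of the plane consists of reals.
\<close>

lemma holomorphic_real_valued_constant:
  assumes f: "f holomorphic_on T" and T: "open T" "connected T"
    and real: "\<And>t. t \<in> T \<Longrightarrow> f t \<in> \<real>" and st: "s \<in> T" "t \<in> T"
  shows "f s = f t"
proof -
  have "f constant_on T"
  proof (rule ccontr)
    assume "\<not> f constant_on T"
    then have "open (f ` T)" using open_mapping_thm[OF f T T(1) order_refl] by blast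
    then obtain e where e: "e > 0" "ball (f s) e \<subseteq> f ` T"
      using st(1) open_contains_ball by blast
    have "f s + of_real (e / 2) * \<i> \<in> ball (f s) e"
      using e(1) by (simp add: dist_norm norm_mult)
    then obtain t' where t': "t' \<in> T" "f s + of_real (e / 2) * \<i> = f t'"
      using e(2) by auto
    have "f s + of_real (e / 2) * \<i> \<in> \<real>" unfolding t'(2) by (rule real[OF t'(1)])
    then have "Im (f s) + e / 2 = 0" by (simp add: complex_is_Real_iff)
    with real[OF st(1)] e(1) show False by (simp add: complex_is_Real_iff)
  qed
  then show ?thesis using st unfolding constant_on_def by auto
qed

text \<open>
  Equality in the triangle inequality forces \<open>f\<close> and \<open>g\<close> to have the same argument, so \<open>f / g\<close> is real
  where \<open>g\<close> does not vanish. Near \<open>w\<close> it is then constant along each line through \<open>w\<close>, with value \<open>1\<close>,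
  and the identity theorem propagates \<open>f = g\<close>. This takes the place of strict convexity of the norm,
  which is missing for exponent \<open>1\<close>.
\<close>

theorem holo_on_eq_if_norm_add:
  fixes f g :: "complex ^ 'n \<Rightarrow> complex"
  assumes "open \<Omega>" "connected \<Omega>" and f: "holo_on f \<Omega>" and g: "holo_on g \<Omega>"
    and w: "w \<in> \<Omega>" "f w = 1" "g w = 1"
    and add: "\<And>x. x \<in> \<Omega> \<Longrightarrow> norm (f x + g x) = norm (f x) + norm (g x)"
    and x: "x \<in> \<Omega>"
  shows "f x = g x"
proof -
  have "open (\<Omega> \<inter> g -` (- {0}))"
    using holo_on_continuous_on[OF g] \<open>open \<Omega>\<close> by (intro continuous_open_preimage) auto
  moreover have "w \<in> \<Omega> \<inter> g -` (- {0})" using w by simp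
  ultimately obtain r where r: "r > 0" "ball w r \<subseteq> \<Omega> \<inter> g -` (- {0})"
    using open_contains_ball by blast
  have "f y = g y" if y: "y \<in> ball w r" for y
  proof -
    define v where "v = y - w"
    define T where "T = {t. w + t *s v \<in> ball w r}"
    have oT: "open T" and cT: "connected T"
      unfolding T_def using open_slice_ball convex_slice_ball convex_connected by blast+
    have 01: "0 \<in> T" "1 \<in> T" using r y by (simp_all add: T_def v_def)
    have sub: "w + t *s v \<in> \<Omega>" "g (w + t *s v) \<noteq> 0" if "t \<in> T" for t
      using that r(2) unfolding T_def by auto
    have "(\<lambda>t. f (w + t *s v) / g (w + t *s v)) 1 = (\<lambda>t. f (w + t *s v) / g (w + t *s v)) 0"
    proof (rule holomorphic_real_valued_constant[OF _ oT cT _ 01(2) 01(1)])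
      show "(\<lambda>t. f (w + t *s v) / g (w + t *s v)) holomorphic_on T"
        using sub by (intro holomorphic_on_divide holo_on_slice_holomorphic[OF f] holo_on_slice_holomorphic[OF g])
      fix t assume t: "t \<in> T"
      let ?x = "w + t *s v"
      have "norm (f ?x) *\<^sub>R g ?x = norm (g ?x) *\<^sub>R f ?x"
        using add[OF sub(1)[OF t]] norm_triangle_eq by blast
      then have "f ?x / g ?x = of_real (norm (f ?x) / norm (g ?x))"
        using sub(2)[OF t] by (simp add: field_simps scaleR_conv_of_real)
      then show "f ?x / g ?x \<in> \<real>" by (metis Reals_of_real)
    qed
    then have "f y / g y = 1" using w by (simp add: v_def)
    then show ?thesis by (metis divide_eq_1_iff)
  qed
  from holo_on_identity[OF assms(1,2) f g w(1) r(1) this x] show ?thesis by simp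
qed

section \<open>Complex rotations and the mean value inequality\<close>

text \<open>
  The theorem \<open>measure_orthogonal_image\<close> on Lebesgue measure is stated for coordinate spaces
  \<open>real ^ 'm\<close> with a well-ordered index type. An orthonormal basis, labelled by such a type, transports
  the measure.
\<close>

lemma isometry_to_coordinates:
  assumes card: "CARD('m::finite) = DIM('a::euclidean_space)"
  obtains T :: "'a::euclidean_space \<Rightarrow> real ^ 'm::finite" and T' :: "real ^ 'm::finite \<Rightarrow> 'a::euclidean_space"
  where "linear T" "linear T'" "\<And>x. norm (T x) = norm x" "\<And>y. norm (T' y) = norm y"
    "\<And>x. T' (T x) = x" "\<And>y. T (T' y) = y" "distr lborel borel T = lborel"
proof -
  have "\<exists>\<sigma>. bij_betw \<sigma> (UNIV :: 'm set) (Basis :: 'a set)"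
    using card by (intro finite_same_card_bij) auto
  then obtain \<sigma> :: "'m \<Rightarrow> 'a" where \<sigma>: "bij_betw \<sigma> UNIV Basis" by blast
  have \<sigma>B: "\<sigma> i \<in> Basis" for i using \<sigma> by (auto simp: bij_betw_def)
  have inj: "\<sigma> i = \<sigma> j \<longleftrightarrow> i = j" for i j using \<sigma> by (auto simp: bij_betw_def inj_def)
  have reindex: "(\<Sum>b\<in>Basis. h b) = (\<Sum>i\<in>UNIV. h (\<sigma> i))" for h :: "'a \<Rightarrow> 'c::comm_monoid_add"
    using sum.reindex_bij_betw[OF \<sigma>, of h] by simp
  define T where "T x = (\<chi> i. x \<bullet> \<sigma> i)" for x
  define T' where "T' y = (\<Sum>i\<in>UNIV. y $ i *\<^sub>R \<sigma> i)" for y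
  have T'in: "T' y \<bullet> \<sigma> i = y $ i" for y i
    unfolding T'_def inner_sum_left
    by (simp add: inner_Basis \<sigma>B inj if_distrib cong: if_cong)
  have lT: "linear T" unfolding T_def by (intro linearI) (auto simp: vec_eq_iff inner_add_left)
  have lT': "linear T'"
    unfolding T'_def by (intro linearI) (auto simp: scaleR_add_left sum.distrib scaleR_sum_right)
  have TT': "T (T' y) = y" for y by (simp add: T_def vec_eq_iff T'in)
  have T'T: "T' (T x) = x" for x
    unfolding T'_def T_def using euclidean_representation[of x] by (simp add: reindex)
  have nT: "norm (T x) = norm x" for x
    unfolding norm_eq_sqrt_inner by (subst (2) euclidean_inner) (simp add: T_def inner_vec_def reindex)
  have nT': "norm (T' y) = norm y" for y using nT[of "T' y"] by (simp add: TT')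
  have mT: "T \<in> borel_measurable borel"
    using linear_continuous_on[of T UNIV] lT by (simp add: borel_measurable_continuous_onI linear_conv_bounded_linear)
  have "lborel = distr lborel borel T"
  proof (rule lborel_eqI)
    fix l u :: "real ^ 'm" assume le: "\<And>b. b \<in> Basis \<Longrightarrow> l \<bullet> b \<le> u \<bullet> b"
    have le': "l $ i \<le> u $ i" for i
      using le[of "axis i 1"] by (simp add: axis_in_Basis_iff inner_axis)
    have *: "T -` box l u = box (T' l) (T' u)"
    proof -
      have "(\<forall>i. l $ i < x \<bullet> \<sigma> i \<and> x \<bullet> \<sigma> i < u $ i) \<longleftrightarrow> (\<forall>b\<in>Basis. T' l \<bullet> b < x \<bullet> b \<and> x \<bullet> b < T' u \<bullet> b)" for x
        using \<sigma> by (force simp: bij_betw_def T'in)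
      then show ?thesis by (auto simp: T_def mem_box_cart mem_box(1))
    qed
    have "emeasure (distr lborel borel T) (box l u) = emeasure lborel (box (T' l) (T' u))"
      using mT by (simp add: emeasure_distr *)
    also have "\<dots> = ennreal (\<Prod>b\<in>Basis. (T' u - T' l) \<bullet> b)"
    proof (rule emeasure_lborel_box)
      fix b :: 'a assume "b \<in> Basis"
      then obtain i where "b = \<sigma> i" using \<sigma> by (auto simp: bij_betw_def)
      then show "T' l \<bullet> b \<le> T' u \<bullet> b" using le' T'in by simp
    qed
    also have "(\<Prod>b\<in>Basis. (T' u - T' l) \<bullet> b) = (\<Prod>i\<in>UNIV. u $ i - l $ i)"
      using prod.reindex_bij_betw[OF \<sigma>, of "\<lambda>b. (T' u - T' l) \<bullet> b"] by (simp add: inner_diff_left T'in)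
    also have "\<dots> = (\<Prod>b\<in>Basis. (u - l) \<bullet> b)"
    proof -
      have "bij_betw (\<lambda>i. axis i (1::real)) (UNIV :: 'm set) Basis"
        by (auto simp: bij_betw_def inj_def axis_eq_axis Basis_vec_def)
      from prod.reindex_bij_betw[OF this, of "\<lambda>b. (u - l) \<bullet> b"] show ?thesis
        by (simp add: inner_axis)
    qed
    finally show "emeasure (distr lborel borel T) (box l u) = (\<Prod>b\<in>Basis. (u - l) \<bullet> b)" .
  qed simp
  from that[OF lT lT' nT nT' T'T TT' this[symmetric]] show thesis .
qed

lemma distr_lborel_linear_isometry:
  fixes R R' :: "'a::euclidean_space \<Rightarrow> 'a"
  assumes card: "CARD('m::{finite,wellorder}) = DIM('a)"
    and R: "linear R" and R': "linear R'" and nR': "\<And>x. norm (R' x) = norm x"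
    and inv: "\<And>x. R (R' x) = x" "\<And>x. R' (R x) = x"
  shows "distr lborel borel R = lborel"
proof -
  obtain T :: "'a \<Rightarrow> (real, 'm) vec" and T' :: "(real, 'm) vec \<Rightarrow> 'a"
    where T: "linear T" "linear T'" "\<And>x. norm (T x) = norm x" "\<And>y. norm (T' y) = norm y"
    "\<And>x. T' (T x) = x" "\<And>y. T (T' y) = y" "distr lborel borel T = lborel"
    using isometry_to_coordinates[OF card] by blast
  have mR: "R \<in> borel_measurable borel" and mT: "T \<in> borel_measurable borel" and mT': "T' \<in> borel_measurable borel"
    using R T(1,2)
    by (auto intro!: borel_measurable_continuous_onI linear_continuous_on simp: linear_conv_bounded_linear)
  have emT: "emeasure lborel A = emeasure lborel (T' -` A)" if A: "A \<in> sets borel" for A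
  proof -
    have "T' -` A \<in> sets borel" using measurable_sets[OF mT' A] by simp
    then have "emeasure (distr lborel borel T) (T' -` A) = emeasure lborel (T -` T' -` A)"
      using mT by (simp add: emeasure_distr)
    also have "T -` T' -` A = A" using T(5) by auto
    finally show ?thesis using T(7) by simp
  qed
  have orth: "orthogonal_transformation (\<lambda>y. T (R' (T' y)))"
    unfolding orthogonal_transformation using T nR' linear_compose[OF linear_compose[OF T(2) R'] T(1)]
    by (simp add: o_def)
  have "lborel = distr lborel borel R"
  proof (rule lborel_eqI)
    fix l u :: 'a assume le: "\<And>b. b \<in> Basis \<Longrightarrow> l \<bullet> b \<le> u \<bullet> b"
    let ?S = "T' -` box l u"
    have S: "?S \<in> sets borel" using measurable_sets[OF mT', of "box l u"] by simp
    have bR: "R -` box l u \<in> sets borel" using measurable_sets[OF mR, of "box l u"] by simp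
    have fin: "emeasure lborel ?S < \<infinity>"
      using emT[of "box l u"] emeasure_lborel_box_finite[of l u] by simp
    then have "?S \<in> lmeasurable"
      using S by (auto simp: fmeasurable_def)
    from measure_orthogonal_image[OF orth this] measurable_orthogonal_image[OF orth this]
    have im: "measure lebesgue ((\<lambda>y. T (R' (T' y))) ` ?S) = measure lebesgue ?S"
      "(\<lambda>y. T (R' (T' y))) ` ?S \<in> lmeasurable" by auto
    have eq: "(\<lambda>y. T (R' (T' y))) ` ?S = T' -` R -` box l u"
    proof (intro set_eqI iffI)
      fix y assume "y \<in> T' -` R -` box l u"
      then have "T (R (T' y)) \<in> ?S" "y = T (R' (T' (T (R (T' y)))))" using T inv by auto
      then show "y \<in> (\<lambda>y. T (R' (T' y))) ` ?S" by blast
    qed (use T inv in auto)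
    have "emeasure lborel (R -` box l u) = emeasure lborel (T' -` R -` box l u)"
      by (rule emT[OF bR])
    also have "\<dots> = emeasure lebesgue (T' -` R -` box l u)"
      using measurable_sets[OF mT' bR] by (simp add: vimage_def)
    also have "\<dots> = ennreal (measure lebesgue (T' -` R -` box l u))"
      using im(2) unfolding eq by (intro emeasure_eq_measure2) auto
    also have "\<dots> = ennreal (measure lebesgue ?S)" using im(1) unfolding eq by simp
    also have "\<dots> = emeasure lebesgue ?S"
      using \<open>?S \<in> lmeasurable\<close> by (intro emeasure_eq_measure2[symmetric]) auto
    also have "\<dots> = emeasure lborel ?S" using S by simp
    also have "\<dots> = emeasure lborel (box l u)" using emT[of "box l u"] by simp
    also have "\<dots> = ennreal (\<Prod>b\<in>Basis. (u - l) \<bullet> b)" using le by (rule emeasure_lborel_box)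
    finally show "emeasure (distr lborel borel R) (box l u) = (\<Prod>b\<in>Basis. (u - l) \<bullet> b)"
      using mR by (simp add: emeasure_distr)
  qed simp
  then show ?thesis ..
qed

text \<open>
  The type \<open>'n bit0\<close> is finite and well ordered and has twice as many elements as \<open>'n\<close>, the real
  dimension of the space.
\<close>

lemma distr_lborel_complex_rotation:
  fixes c :: complex
  assumes c: "norm c = 1"
  shows "distr lborel borel (\<lambda>v :: complex ^ 'n. c *s v) = lborel"
proof (rule distr_lborel_linear_isometry[where 'm = "'n bit0" and R' = "\<lambda>v. inverse c *s v"])
  have "c \<noteq> 0" using c by auto
  then show "c *s (inverse c *s x) = x" "inverse c *s (c *s x) = x" for x :: "complex ^ 'n"
    by (simp_all add: vec_eq_iff)
  show "CARD('n bit0) = DIM(complex ^ 'n)" by simp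
  have "linear (\<lambda>v :: complex ^ 'n. a *s v)" for a
    by (intro linearI) (auto simp: vec_eq_iff algebra_simps)
  then show "linear (\<lambda>v :: complex ^ 'n. c *s v)" "linear (\<lambda>v :: complex ^ 'n. inverse c *s v)"
    by blast+
  show "norm (inverse c *s x) = norm x" for x :: "complex ^ 'n"
    by (simp add: norm_vector_smult_complex norm_inverse c)
qed

lemma holomorphic_norm_le_circle_mean:
  assumes f: "f holomorphic_on cball 0 1"
  shows "ennreal (norm (f 0)) \<le>
    (\<integral>\<^sup>+t. indicator {0..1} t * ennreal (norm (f (exp (of_real (2 * pi * t) * \<i>)))) \<partial>lborel)"
proof -
  define e where "e t = exp (of_real (2 * pi * t) * \<i>)" for t :: real
  have e: "norm (e t) = 1" for t by (simp add: e_def norm_exp_eq_Re)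
  have cont: "continuous_on {0..1} (\<lambda>t. f (e t))"
  proof (rule continuous_on_compose2[OF holomorphic_on_imp_continuous_on[OF f]])
    show "continuous_on {0..1} e" unfolding e_def by (intro continuous_intros)
  qed (use e in auto)
  have "((\<lambda>u. f u / (u - 0)) has_contour_integral (2 * of_real pi * \<i> * f 0)) (circlepath 0 1)"
    by (rule Cauchy_integral_circlepath_simple[OF f]) simp
  then have "((\<lambda>t. 2 * of_real pi * \<i> * f (e t)) has_integral (2 * of_real pi * \<i> * f 0)) {0..1}"
    unfolding has_contour_integral_def
  proof (rule has_integral_eq[rotated])
    fix t :: real assume t: "t \<in> {0..1}"
    have "circlepath 0 1 t = e t" by (simp add: circlepath e_def algebra_simps)
    moreover have "e t \<noteq> 0" by (simp add: e_def)
    moreover have "vector_derivative (circlepath 0 1) (at t within {0..1}) = 2 * of_real pi * \<i> * e t"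
      using t by (simp add: vector_derivative_circlepath01 e_def algebra_simps)
    ultimately show "f (circlepath 0 1 t) / (circlepath 0 1 t - 0) *
        vector_derivative (circlepath 0 1) (at t within {0..1}) = 2 * of_real pi * \<i> * f (e t)"
      by simp
  qed
  from has_integral_mult_right[OF this, of "inverse (2 * of_real pi * \<i>)"]
  have hi: "((\<lambda>t. f (e t)) has_integral f 0) {0..1}" by (simp add: field_simps)
  have si: "set_integrable lborel {0..1} (\<lambda>t. f (e t))"
    using borel_integrable_atLeastAtMost'[OF cont] .
  have "f 0 = (LINT t:{0..1}|lborel. f (e t))"
    using set_borel_integral_eq_integral(2)[OF si] hi by (simp add: integral_unique)
  then have "ennreal (norm (f 0)) \<le> (\<integral>\<^sup>+t. ennreal (norm (indicator {0..1} t *\<^sub>R f (e t))) \<partial>lborel)"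
    using integral_norm_bound_ennreal[OF si[unfolded set_integrable_def]]
    by (simp add: set_lebesgue_integral_def)
  also have "\<dots> = (\<integral>\<^sup>+t. indicator {0..1} t * ennreal (norm (f (e t))) \<partial>lborel)"
    by (intro nn_integral_cong) (auto split: split_indicator)
  finally show ?thesis unfolding e_def .
qed

text \<open>
  On the line through \<open>a\<close> in direction \<open>v\<close> the circle mean over \<open>a + e t *s v\<close> bounds the value at \<open>a\<close>.
  Integrating over all \<open>v\<close> in the ball and exchanging the integrals leaves, for each fixed \<open>t\<close>, the
  integral of \<open>|f|\<close> over the ball around \<open>a\<close>, because \<open>v \<mapsto> a + e t *s v\<close> preserves Lebesgue measure.
\<close>

theorem holo_on_norm_le_ball_mean:
  fixes f :: "complex ^ 'n \<Rightarrow> complex"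
  assumes f: "holo_on f (ball a d)"
  shows "ennreal (norm (f a)) * emeasure lborel (ball (0 :: complex ^ 'n) d)
    \<le> (\<integral>\<^sup>+y. indicator (ball a d) y * ennreal (norm (f y)) \<partial>lborel)"
proof -
  define G where "G y = indicator (ball a d) y * ennreal (norm (f y))" for y
  define e where "e t = exp (of_real (2 * pi * t) * \<i>)" for t :: real
  have e: "norm (e t) = 1" for t by (simp add: e_def norm_exp_eq_Re)
  have "continuous_on (ball a d) (\<lambda>y. norm (f y))"
    using holo_on_continuous_on[OF f] by (intro continuous_intros)
  then have "(\<lambda>y. indicator (ball a d) y *\<^sub>R norm (f y)) \<in> borel_measurable borel"
    by (intro borel_measurable_continuous_on_indicator) auto
  then have "(\<lambda>y. ennreal (indicator (ball a d) y *\<^sub>R norm (f y))) \<in> borel_measurable borel"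
    by measurable
  also have "(\<lambda>y. ennreal (indicator (ball a d) y *\<^sub>R norm (f y))) = G"
    by (auto simp: G_def fun_eq_iff split: split_indicator)
  finally have G[measurable]: "G \<in> borel_measurable borel" .
  have line: "indicator (ball 0 d) v * ennreal (norm (f a))
      \<le> (\<integral>\<^sup>+t. indicator {0..1} t * G (a + e t *s v) \<partial>lborel)" for v
  proof (cases "v \<in> ball 0 d")
    case True
    have in_ball: "a + s *s v \<in> ball a d" if "norm s \<le> 1" for s
    proof -
      have "norm s * norm v \<le> 1 * norm v" using that by (intro mult_right_mono) auto
      then show ?thesis using True by (simp add: dist_norm norm_vector_smult_complex)
    qed
    have "(\<lambda>s. f (a + s *s v)) holomorphic_on cball 0 1"
      by (rule holo_on_slice_holomorphic[OF f], rule in_ball) auto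
    from holomorphic_norm_le_circle_mean[OF this]
    have "ennreal (norm (f a)) \<le> (\<integral>\<^sup>+t. indicator {0..1} t * ennreal (norm (f (a + e t *s v))) \<partial>lborel)"
      by (simp add: e_def)
    also have "\<dots> = (\<integral>\<^sup>+t. indicator {0..1} t * G (a + e t *s v) \<partial>lborel)"
      using in_ball[of "e _"] e by (intro nn_integral_cong) (simp add: G_def)
    finally show ?thesis using True by simp
  qed simp
  have joint: "(\<lambda>(v, t). indicator {0..1} t * G (a + e t *s v)) \<in> borel_measurable (lborel \<Otimes>\<^sub>M lborel)"
  proof -
    have "continuous_on UNIV (\<lambda>(v :: complex ^ 'n, t). a + e t *s v)"
      unfolding e_def case_prod_unfold vector_scalar_mult_def
      by (intro continuous_intros)
    then have [measurable]: "(\<lambda>(v :: complex ^ 'n, t). a + e t *s v) \<in> borel_measurable (lborel \<Otimes>\<^sub>M lborel)"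
      using borel_measurable_continuous_onI by (simp add: lborel_prod)
    have "(\<lambda>p. indicator {0..1} (snd p) * G ((\<lambda>(v, t). a + e t *s v) p)) \<in> borel_measurable (lborel \<Otimes>\<^sub>M lborel)"
      by measurable
    then show ?thesis by (simp add: case_prod_unfold)
  qed
  have rot: "(\<integral>\<^sup>+v. G (a + e t *s v) \<partial>lborel) = (\<integral>\<^sup>+y. G y \<partial>lborel)" for t
  proof -
    have [measurable]: "(\<lambda>v. e t *s v :: complex ^ 'n) \<in> borel_measurable borel"
      unfolding vector_scalar_mult_def by (intro borel_measurable_continuous_onI continuous_intros)
    have "(\<integral>\<^sup>+v. G (a + e t *s v) \<partial>lborel) = (\<integral>\<^sup>+u. G (a + u) \<partial>distr lborel borel (\<lambda>v. e t *s v))"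
      by (subst nn_integral_distr) auto
    also have "\<dots> = (\<integral>\<^sup>+u. G (a + u) \<partial>lborel)"
      by (simp add: distr_lborel_complex_rotation[OF e])
    also have "\<dots> = (\<integral>\<^sup>+y. G y \<partial>distr lborel borel ((+) a))"
      by (subst nn_integral_distr) auto
    finally show ?thesis by (simp add: lborel_distr_plus)
  qed
  have "ennreal (norm (f a)) * emeasure lborel (ball (0 :: complex ^ 'n) d)
      = (\<integral>\<^sup>+v. ennreal (norm (f a)) * indicator (ball (0 :: complex ^ 'n) d) v \<partial>lborel)"
    by (rule nn_integral_cmult_indicator[symmetric]) simp
  also have "\<dots> \<le> (\<integral>\<^sup>+v. (\<integral>\<^sup>+t. indicator {0..1} t * G (a + e t *s v) \<partial>lborel) \<partial>lborel)"
    by (intro nn_integral_mono) (use line in \<open>simp add: mult.commute\<close>)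
  also have "\<dots> = (\<integral>\<^sup>+t. (\<integral>\<^sup>+v. indicator {0..1} t * G (a + e t *s v) \<partial>lborel) \<partial>lborel)"
    by (rule lborel_pair.Fubini'[OF joint, symmetric])
  also have "\<dots> = (\<integral>\<^sup>+t. indicator {0..1::real} t * (\<integral>\<^sup>+y. G y \<partial>lborel) \<partial>lborel)"
  proof (intro nn_integral_cong)
    fix t :: real
    have [measurable]: "(\<lambda>v. e t *s v :: complex ^ 'n) \<in> borel_measurable borel"
      unfolding vector_scalar_mult_def by (intro borel_measurable_continuous_onI continuous_intros)
    have "(\<integral>\<^sup>+v. indicator {0..1} t * G (a + e t *s v) \<partial>lborel)
        = indicator {0..1} t * (\<integral>\<^sup>+v. G (a + e t *s v) \<partial>lborel)"
      by (rule nn_integral_cmult) measurable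
    then show "(\<integral>\<^sup>+v. indicator {0..1} t * G (a + e t *s v) \<partial>lborel)
        = indicator {0..1} t * (\<integral>\<^sup>+y. G y \<partial>lborel)" by (simp add: rot)
  qed
  also have "\<dots> = (\<integral>\<^sup>+y. G y \<partial>lborel)"
    by (simp add: nn_integral_multc)
  finally show ?thesis unfolding G_def .
qed

section \<open>Pointwise bounds by integrals with small exponents\<close>

text \<open>
  For exponents below \<open>1\<close> the mean value inequality is applied to \<open>|f| = |f|\<^sup>q |f| powr (1 - q)\<close>, and the
  second factor is absorbed: at a maximal point \<open>b\<close> of the weighted modulus
  \<open>(R - dist a y) powr (N / q) * |f y|\<close>, with maximum \<open>S\<close>, one gets \<open>|f| \<le> S * u powr (- (N / q))\<close> on the
  ball of radius \<open>u = (R - dist a b) / 2\<close>. The mean value inequality at \<open>b\<close> becomes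
  \<open>S \<le> A * J * S powr (1 - q)\<close> with \<open>J\<close> the integral of \<open>|f|\<^sup>q\<close>; all powers of \<open>u\<close> cancel, which is what
  determines the exponent \<open>N / q\<close> of the weight.
\<close>

theorem holo_on_local_bound_small_exponent:
  fixes a :: "complex ^ 'n"
  assumes q: "0 < q" "q \<le> 1" and R: "0 < R" "cball a R \<subseteq> \<Omega>"
  shows "\<exists>C\<ge>0. \<forall>f. holo_on f \<Omega> \<longrightarrow> set_integrable lborel \<Omega> (\<lambda>x. norm (f x) powr q) \<longrightarrow>
    (\<forall>x\<in>ball a (R/2). norm (f x) \<le> C * (LINT x:\<Omega>|lborel. norm (f x) powr q) powr (1/q))"
proof -
  define N where "N = DIM(complex ^ 'n)"
  define v where "v = unit_ball_vol (real N)"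
  have v: "v > 0" unfolding v_def by (rule unit_ball_vol_pos) simp
  define A where "A = 2 powr (N / q) / v"
  have A: "A > 0" using v by (simp add: A_def)
  define C where "C = (R / 2) powr (- (N / q)) * A powr (1 / q)"
  have "norm (f x) \<le> C * (LINT x:\<Omega>|lborel. norm (f x) powr q) powr (1/q)"
    if f: "holo_on f \<Omega>" and int: "set_integrable lborel \<Omega> (\<lambda>x. norm (f x) powr q)" and x: "x \<in> ball a (R/2)" for f x
  proof -
    define J where "J = (LINT x:\<Omega>|lborel. norm (f x) powr q)"
    have J0: "J \<ge> 0" unfolding J_def set_lebesgue_integral_def by (intro integral_nonneg_AE) auto
    define h where "h y = (R - dist a y) powr (N / q) * norm (f y)" for y
    have "continuous_on (cball a R) h"
      unfolding h_def using R q holo_on_continuous_on[OF f]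
      by (intro continuous_intros continuous_on_powr') (auto intro: continuous_on_subset simp: N_def)
    then obtain b where b: "b \<in> cball a R" and max: "\<And>y. y \<in> cball a R \<Longrightarrow> h y \<le> h b"
      using continuous_attains_sup[of "cball a R" h] R by auto
    define S where "S = h b"
    have S_le: "S \<le> (A * J) powr (1 / q)"
    proof (cases "S > 0")
      case True
      define u where "u = (R - dist a b) / 2"
      have d: "dist a b < R" using True b by (cases "dist a b = R") (auto simp: S_def h_def)
      then have u: "u > 0" by (simp add: u_def)
      define K where "K = (S * u powr (- (N / q))) powr (1 - q)"
      have K0: "K \<ge> 0" by (simp add: K_def)
      have near: "norm (f y) \<le> norm (f y) powr q * K" if y: "y \<in> ball b u" for y
      proof -
        have Ry: "R - dist a y \<ge> u" using y dist_triangle[of a y b] by (simp add: u_def)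
        have "u powr (N / q) * norm (f y) \<le> h y"
          unfolding h_def using Ry u q by (intro mult_right_mono powr_mono2) auto
        also have "\<dots> \<le> S" unfolding S_def using Ry u by (intro max) auto
        finally have "norm (f y) \<le> S * u powr (- (N / q))"
          using u by (simp add: powr_minus field_simps)
        then have "norm (f y) powr (1 - q) \<le> K" unfolding K_def using q by (intro powr_mono2) auto
        then have "norm (f y) powr q * norm (f y) powr (1 - q) \<le> norm (f y) powr q * K"
          by (intro mult_left_mono) auto
        then show ?thesis by (simp flip: powr_add)
      qed
      have sub: "ball b u \<subseteq> \<Omega>"
      proof
        fix y assume "y \<in> ball b u"
        then have "y \<in> cball a R" using dist_triangle[of a y b] d by (simp add: u_def)
        then show "y \<in> \<Omega>" using R by blast
      qed
      have "ennreal (norm (f b)) * emeasure lborel (ball (0 :: complex ^ 'n) u)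
          \<le> (\<integral>\<^sup>+y. indicator (ball b u) y * ennreal (norm (f y)) \<partial>lborel)"
        by (rule holo_on_norm_le_ball_mean[OF holo_on_subset[OF f sub]])
      also have "\<dots> \<le> (\<integral>\<^sup>+y. ennreal (indicator \<Omega> y *\<^sub>R norm (f y) powr q * K) \<partial>lborel)"
        using near sub by (intro nn_integral_mono) (auto split: split_indicator intro!: ennreal_leI)
      also have "\<dots> = ennreal (LINT y|lborel. indicator \<Omega> y *\<^sub>R norm (f y) powr q * K)"
        using int K0 unfolding set_integrable_def by (intro nn_integral_eq_integral integrable_mult_left) auto
      also have "(LINT y|lborel. indicator \<Omega> y *\<^sub>R norm (f y) powr q * K) = J * K"
        using int by (simp add: J_def set_lebesgue_integral_def set_integrable_def)
      finally have "ennreal (norm (f b) * (v * u ^ N)) \<le> ennreal (J * K)"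
        using u v by (simp add: emeasure_ball v_def N_def ennreal_mult'' unit_ball_vol_pos)
      then have 1: "norm (f b) * (v * u ^ N) \<le> J * K" using J0 K0 by (simp add: ennreal_le_iff)
      have fb: "norm (f b) = S * (2 powr (- (N / q)) * u powr (- (N / q)))"
      proof -
        have "R - dist a b = 2 * u" by (simp add: u_def)
        then have "S = 2 powr (N / q) * u powr (N / q) * norm (f b)"
          using u by (simp add: S_def h_def powr_mult)
        then show ?thesis using u by (simp add: powr_minus field_simps)
      qed
      have uN: "u ^ N = u powr N" using u by (simp add: powr_realpow)
      have K: "K = S powr (1 - q) * (u powr (- (N / q)) * u powr N)"
      proof -
        have "K = S powr (1 - q) * u powr (- (N / q) * (1 - q))"
          unfolding K_def using True u by (simp add: powr_mult powr_powr)
        also have "- (N / q) * (1 - q) = - (N / q) + N" using q by (simp add: field_simps)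
        also have "u powr (- (N / q) + N) = u powr (- (N / q)) * u powr N" by (rule powr_add)
        finally show ?thesis .
      qed
      have "S * (2 powr (- (N / q)) * v) * (u powr (- (N / q)) * u powr N)
          \<le> J * S powr (1 - q) * (u powr (- (N / q)) * u powr N)"
        using 1 unfolding fb uN K by (simp add: algebra_simps)
      then have "S * (2 powr (- (N / q)) * v) \<le> J * S powr (1 - q)"
        using u by (simp add: mult_le_cancel_right)
      then have "S \<le> A * J * S powr (1 - q)"
        using v by (simp add: A_def powr_minus field_simps)
      then have "S powr q * S powr (1 - q) \<le> A * J * S powr (1 - q)"
        using True by (simp flip: powr_add)
      then have "S powr q \<le> A * J" using True by simp
      then have "(S powr q) powr (1 / q) \<le> (A * J) powr (1 / q)" using q by (intro powr_mono2) auto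
      then show ?thesis using True q by (simp add: powr_powr)
    next
      case False
      then show ?thesis using powr_ge_zero order_trans not_less by metis
    qed
    have "dist a x < R / 2" using x by simp
    then have "(R / 2) powr (N / q) * norm (f x) \<le> h x"
      unfolding h_def using R q by (intro mult_right_mono powr_mono2) auto
    also have "\<dots> \<le> S" unfolding S_def using x R by (intro max) auto
    also note S_le
    also have "(A * J) powr (1 / q) = A powr (1 / q) * J powr (1 / q)" using A J0 by (simp add: powr_mult)
    finally show ?thesis using R by (simp add: C_def J_def powr_minus field_simps)
  qed
  moreover have "C \<ge> 0" by (simp add: C_def)
  ultimately show ?thesis by blast
qed

section \<open>Limits through sequences and convexity of powers\<close>

text \<open>
  Turns compactness statements, which only produce subsequences, into convergence.
\<close>

lemma tendsto_if_subsequences: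
  fixes X :: "nat \<Rightarrow> 'a::metric_space"
  assumes "\<And>\<phi>. strict_mono (\<phi> :: nat \<Rightarrow> nat) \<Longrightarrow> \<exists>\<psi>. strict_mono (\<psi> :: nat \<Rightarrow> nat) \<and> (\<lambda>k. X (\<phi> (\<psi> k))) \<longlonglongrightarrow> l"
  shows "X \<longlonglongrightarrow> l"
proof (rule ccontr)
  assume "\<not> X \<longlonglongrightarrow> l"
  then obtain e where e: "e > 0" "\<And>N. \<exists>n\<ge>N. \<not> dist (X n) l < e"
    unfolding lim_sequentially by blast
  then have inf: "infinite {n. \<not> dist (X n) l < e}"
    unfolding infinite_nat_iff_unbounded_le by blast
  obtain \<phi> :: "nat \<Rightarrow> nat" where \<phi>: "strict_mono \<phi>" "\<And>k. \<phi> k \<in> {n. \<not> dist (X n) l < e}"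
    using infinite_enumerate[OF inf] by blast
  obtain \<psi> where "(\<lambda>k. X (\<phi> (\<psi> k))) \<longlonglongrightarrow> l" using assms[OF \<phi>(1)] by blast
  then obtain N where "\<And>k. k \<ge> N \<Longrightarrow> dist (X (\<phi> (\<psi> k))) l < e"
    using e(1) unfolding lim_sequentially by blast
  then show False using \<phi>(2) by blast
qed

lemma LIMSEQ_strict_mono_subsequence: "X \<longlonglongrightarrow> l \<Longrightarrow> strict_mono (\<phi> :: nat \<Rightarrow> nat) \<Longrightarrow> (\<lambda>k. X (\<phi> k)) \<longlonglongrightarrow> l"
  using LIMSEQ_subseq_LIMSEQ[of X l \<phi>] by (simp add: o_def)

text \<open>
  Convexity of powers up to the boundary of the half line: the boundary value \<open>0\<close> has to be
  included since the moduli of holomorphic functions may vanish.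
\<close>

lemma powr_mean_le:
  fixes x y :: real
  assumes u: "u \<ge> 1" and "x \<ge> 0" "y \<ge> 0"
  shows "((x + y) / 2) powr u \<le> 1/2 * x powr u + 1/2 * y powr u"
proof -
  have half: "(z / 2) powr u \<le> 1/2 * z powr u" if "z \<ge> 0" for z :: real
  proof -
    have "(1 / 2 :: real) powr u \<le> (1 / 2) powr 1" using u by (intro powr_mono') auto
    then have "z powr u * (1 / 2) powr u \<le> z powr u * (1 / 2)" by (intro mult_left_mono) auto
    then show ?thesis using that powr_mult[of z "1/2" u] by simp
  qed
  show ?thesis
  proof (cases "x = 0 \<or> y = 0")
    case True
    then show ?thesis using half[of x] half[of y] assms by auto
  next
    case False
    then have "((1 - 1/2) *\<^sub>R x + (1/2) *\<^sub>R y) powr u \<le> (1 - 1/2) * x powr u + 1/2 * y powr u"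
      using assms by (intro convex_onD[OF powr_convex[OF u]]) auto
    then show ?thesis by (simp add: add_divide_distrib)
  qed
qed

lemma mono_tendsto_at_right:
  fixes F :: "real \<Rightarrow> real"
  assumes "p < b" and mono: "\<And>s t. p < s \<Longrightarrow> s \<le> t \<Longrightarrow> t < b \<Longrightarrow> F s \<le> F t"
    and below: "\<And>s. p < s \<Longrightarrow> s < b \<Longrightarrow> B \<le> F s"
  shows "\<exists>L\<ge>B. (F \<longlongrightarrow> L) (at_right p)"
proof -
  define L where "L = Inf (F ` {p<..<b})"
  have ne: "F ` {p<..<b} \<noteq> {}" using \<open>p < b\<close> by simp
  have bb: "bdd_below (F ` {p<..<b})" using below by (intro bdd_belowI[of _ B]) auto
  have "(F \<longlongrightarrow> L) (at_right p)"
  proof (rule order_tendstoI)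
    fix a assume a: "a < L"
    show "\<forall>\<^sub>F s in at_right p. a < F s"
      using eventually_at_right_real[OF \<open>p < b\<close>]
    proof eventually_elim
      case (elim s)
      then have "L \<le> F s" unfolding L_def by (intro cInf_lower bb) auto
      then show ?case using a by simp
    qed
  next
    fix a assume "L < a"
    then obtain t where t: "p < t" "t < b" "F t < a"
      using cInf_lessD[OF ne, of a] unfolding L_def by auto
    show "\<forall>\<^sub>F s in at_right p. F s < a"
      using eventually_at_right_real[OF t(1)]
    proof eventually_elim
      case (elim s)
      then have "F s \<le> F t" using t by (intro mono) auto
      then show ?case using t by simp
    qed
  qed
  moreover have "B \<le> L" unfolding L_def using ne below by (intro cInf_greatest) auto
  ultimately show ?thesis by blast
qed

lemma tendsto_at_right_if_sequences:
  fixes F :: "real \<Rightarrow> 'a::topological_space"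
  assumes "\<And>u. (\<And>k. p < u k) \<Longrightarrow> u \<longlonglongrightarrow> p \<Longrightarrow> (\<lambda>k. F (u k)) \<longlonglongrightarrow> l"
  shows "(F \<longlongrightarrow> l) (at_right p)"
  using assms unfolding tendsto_at_iff_sequentially by (auto simp: o_def)

lemma tendsto_at_left_if_sequences:
  fixes F :: "real \<Rightarrow> 'a::topological_space"
  assumes "b < p" and "\<And>u. (\<And>k. b < u k) \<Longrightarrow> (\<And>k. u k < p) \<Longrightarrow> u \<longlonglongrightarrow> p \<Longrightarrow> (\<lambda>k. F (u k)) \<longlonglongrightarrow> l"
  shows "(F \<longlongrightarrow> l) (at_left p)"
proof -
  have "at_left p = at p within {b<..<p}"
    using \<open>b < p\<close> by (intro at_within_nhd[of p "{b<..}"]) auto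
  moreover have "(F \<longlongrightarrow> l) (at p within {b<..<p})"
    using assms(2) unfolding tendsto_at_iff_sequentially by (auto simp: o_def)
  ultimately show ?thesis by simp
qed

lemma tendsto_sequence_at_right:
  fixes u :: "nat \<Rightarrow> real"
  assumes "(F \<longlongrightarrow> l) (at_right p)" "\<And>k. p < u k" "u \<longlonglongrightarrow> p"
  shows "(\<lambda>k. F (u k)) \<longlonglongrightarrow> l"
  using assms unfolding tendsto_at_iff_sequentially by (auto simp: o_def)

section \<open>Means over a bounded domain\<close>

locale bounded_domain =
  fixes \<Omega> :: "(complex ^ 'n) set"
  assumes open_dom: "open \<Omega>" and connected_dom: "connected \<Omega>"
    and nonempty_dom: "\<Omega> \<noteq> {}" and bounded_dom: "bounded \<Omega>"
begin

abbreviation A :: "real \<Rightarrow> (complex ^ 'n \<Rightarrow> complex) set" where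
  "A \<equiv> bergman_space \<Omega>"

definition vol :: real where "vol = measure lborel \<Omega>"

definition avg :: "(complex ^ 'n \<Rightarrow> real) \<Rightarrow> real" where
  "avg h = (LINT x:\<Omega>|lborel. h x) / vol"

text \<open>
  The usual norm is \<open>vol powr (1 / p) * nrm p f\<close>. Dividing by the volume makes the norm monotone in the
  exponent, so that quantities for different exponents can be compared without constants.
\<close>

definition nrm :: "real \<Rightarrow> (complex ^ 'n \<Rightarrow> complex) \<Rightarrow> real" where
  "nrm p f = avg (\<lambda>x. norm (f x) powr p) powr (1 / p)"

abbreviation int_dom :: "(complex ^ 'n \<Rightarrow> real) \<Rightarrow> bool" where
  "int_dom h \<equiv> set_integrable lborel \<Omega> h"

lemma dom_borel [measurable]: "\<Omega> \<in> sets borel"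
  using open_dom by simp

lemma emeasure_dom_finite: "emeasure lborel \<Omega> < \<infinity>"
  using emeasure_bounded_finite[OF bounded_dom] by simp

lemma vol_pos: "vol > 0"
proof -
  have "\<not> negligible \<Omega>" using open_not_negligible[OF open_dom nonempty_dom] .
  then have "\<Omega> \<notin> null_sets lborel" by (auto simp: negligible_iff_null_sets intro: null_sets_completionI)
  then have "emeasure lborel \<Omega> \<noteq> 0" by (simp add: null_sets_def)
  then show ?thesis using emeasure_dom_finite
    unfolding vol_def by (simp add: measure_def enn2real_positive_iff zero_less_iff_neq_zero)
qed

lemma int_dom_const: "int_dom (\<lambda>x. c)"
  unfolding set_integrable_def using emeasure_dom_finite
  by (intro integrable_real_indicator[THEN integrable_scaleR_left]) auto

lemma avg_const: "avg (\<lambda>x. c) = c"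
  using vol_pos by (simp add: avg_def set_lebesgue_integral_def vol_def[symmetric] emeasure_dom_finite)

lemma avg_nonneg: "(\<And>x. x \<in> \<Omega> \<Longrightarrow> 0 \<le> h x) \<Longrightarrow> 0 \<le> avg h"
  unfolding avg_def set_lebesgue_integral_def using vol_pos
  by (intro divide_nonneg_pos integral_nonneg_AE) (auto split: split_indicator)

lemma avg_mono: "int_dom h \<Longrightarrow> int_dom k \<Longrightarrow> (\<And>x. x \<in> \<Omega> \<Longrightarrow> h x \<le> k x) \<Longrightarrow> avg h \<le> avg k"
  unfolding avg_def using vol_pos by (intro divide_right_mono set_integral_mono) auto

lemma avg_cong: "(\<And>x. x \<in> \<Omega> \<Longrightarrow> h x = k x) \<Longrightarrow> avg h = avg k"
  unfolding avg_def by (intro arg_cong2[where f = "(/)"] set_lebesgue_integral_cong) auto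

lemma int_dom_cong: "(\<And>x. x \<in> \<Omega> \<Longrightarrow> h x = k x) \<Longrightarrow> int_dom h \<longleftrightarrow> int_dom k"
  by (intro set_integrable_cong) auto

lemma
  assumes "int_dom h" "int_dom k"
  shows int_dom_lincomb: "int_dom (\<lambda>x. a * h x + b * k x)"
    and avg_lincomb: "avg (\<lambda>x. a * h x + b * k x) = a * avg h + b * avg k"
proof -
  have 1: "int_dom (\<lambda>x. a * h x)" "int_dom (\<lambda>x. b * k x)"
    using assms by (auto intro: set_integrable_mult_right)
  show "int_dom (\<lambda>x. a * h x + b * k x)" using set_integral_add(1)[OF 1] .
  show "avg (\<lambda>x. a * h x + b * k x) = a * avg h + b * avg k"
    unfolding avg_def set_integral_add(2)[OF 1] by (simp add: add_divide_distrib)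
qed

lemma measurable_continuous_dom:
  "continuous_on \<Omega> h \<Longrightarrow> (\<lambda>x. indicator \<Omega> x *\<^sub>R h x) \<in> borel_measurable lborel"
  for h :: "complex ^ 'n \<Rightarrow> real"
  using borel_measurable_continuous_on_indicator[of \<Omega> h] by simp

lemma int_dom_bound:
  assumes "int_dom k" "continuous_on \<Omega> h" "\<And>x. x \<in> \<Omega> \<Longrightarrow> \<bar>h x\<bar> \<le> k x"
  shows "int_dom h"
  unfolding set_integrable_def
proof (rule Bochner_Integration.integrable_bound[OF assms(1)[unfolded set_integrable_def]])
  show "(\<lambda>x. indicator \<Omega> x *\<^sub>R h x) \<in> borel_measurable lborel"
    by (rule measurable_continuous_dom[OF assms(2)])
  show "AE x in lborel. norm (indicator \<Omega> x *\<^sub>R h x) \<le> norm (indicator \<Omega> x *\<^sub>R k x)"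
    using assms(3) by (intro AE_I2) (force split: split_indicator)
qed

text \<open>
  The set where the function is positive is open and has measure zero, hence is empty.
\<close>

lemma avg_eq_0_imp_0:
  assumes int: "int_dom h" and cont: "continuous_on \<Omega> h" and nn: "\<And>x. x \<in> \<Omega> \<Longrightarrow> 0 \<le> h x"
    and le: "avg h \<le> 0" and x: "x \<in> \<Omega>"
  shows "h x = 0"
proof (rule ccontr)
  assume "h x \<noteq> 0"
  define U where "U = \<Omega> \<inter> h -` {0<..}"
  have "open U" unfolding U_def using cont open_dom by (intro continuous_open_preimage) auto
  have "x \<in> U" using x nn[OF x] \<open>h x \<noteq> 0\<close> by (auto simp: U_def)
  have "(LINT x:\<Omega>|lborel. h x) = 0"
  proof -
    have "0 \<le> avg h" by (rule avg_nonneg) (rule nn)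
    with le vol_pos show ?thesis by (simp add: avg_def divide_le_0_iff zero_le_divide_iff)
  qed
  then have "AE x in lborel. indicator \<Omega> x *\<^sub>R h x = 0"
    using integral_nonneg_eq_0_iff_AE[OF int[unfolded set_integrable_def]] nn
    by (auto simp: set_lebesgue_integral_def split: split_indicator)
  then have "AE x in lborel. x \<notin> U"
    by eventually_elim (auto simp: U_def)
  then have "U \<in> null_sets lborel"
    using \<open>open U\<close> by (subst (asm) AE_iff_null_sets[symmetric]) auto
  then have "negligible U" by (auto simp: negligible_iff_null_sets intro: null_sets_completionI)
  then show False using open_not_negligible[OF \<open>open U\<close>] \<open>x \<in> U\<close> by blast
qed

lemma avg_Fatou:
  fixes h :: "nat \<Rightarrow> complex ^ 'n \<Rightarrow> real"
  assumes int: "\<And>k. int_dom (h k)" and nn: "\<And>k x. x \<in> \<Omega> \<Longrightarrow> 0 \<le> h k x"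
    and lim: "\<And>x. x \<in> \<Omega> \<Longrightarrow> (\<lambda>k. h k x) \<longlonglongrightarrow> g x" and cont: "continuous_on \<Omega> g"
    and le: "\<And>k. avg (h k) \<le> c k" and c: "c \<longlonglongrightarrow> d"
  shows "int_dom g" and "avg g \<le> d"
proof -
  have g0: "0 \<le> g x" if "x \<in> \<Omega>" for x
    using LIMSEQ_le_const[OF lim[OF that]] nn[OF that] by blast
  define H where "H k x = ennreal (indicator \<Omega> x *\<^sub>R h k x)" for k x
  have [measurable]: "H k \<in> borel_measurable lborel" for k
    unfolding H_def using borel_measurable_integrable[OF int[unfolded set_integrable_def]] by measurable
  have "(\<lambda>k. H k x) \<longlonglongrightarrow> ennreal (indicator \<Omega> x *\<^sub>R g x)" for x
    unfolding H_def using lim[of x] by (cases "x \<in> \<Omega>") (auto intro!: tendsto_ennrealI)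
  then have liminf: "liminf (\<lambda>k. H k x) = ennreal (indicator \<Omega> x *\<^sub>R g x)" for x
    by (intro lim_imp_Liminf) auto
  have Hk: "(\<integral>\<^sup>+x. H k x \<partial>lborel) \<le> ennreal (vol * c k)" for k
  proof -
    have "(\<integral>\<^sup>+x. H k x \<partial>lborel) = ennreal (LINT x:\<Omega>|lborel. h k x)"
      unfolding H_def set_lebesgue_integral_def using int[of k] nn
      by (intro nn_integral_eq_integral) (auto simp: set_integrable_def split: split_indicator)
    also have "(LINT x:\<Omega>|lborel. h k x) = vol * avg (h k)" using vol_pos by (simp add: avg_def)
    also have "ennreal (vol * avg (h k)) \<le> ennreal (vol * c k)"
      using le vol_pos by (intro ennreal_leI mult_left_mono) auto
    finally show ?thesis .
  qed
  have "(\<integral>\<^sup>+x. ennreal (indicator \<Omega> x *\<^sub>R g x) \<partial>lborel) \<le> liminf (\<lambda>k. \<integral>\<^sup>+x. H k x \<partial>lborel)"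
    unfolding liminf[symmetric] by (rule nn_integral_liminf) simp
  also have "\<dots> \<le> liminf (\<lambda>k. ennreal (vol * c k))"
    by (intro Liminf_mono always_eventually allI Hk)
  also have "\<dots> = ennreal (vol * d)"
    by (intro lim_imp_Liminf tendsto_ennrealI tendsto_intros c) auto
  finally have fin: "(\<integral>\<^sup>+x. ennreal (indicator \<Omega> x *\<^sub>R g x) \<partial>lborel) \<le> ennreal (vol * d)" .
  show int_g: "int_dom g"
    unfolding set_integrable_def
  proof (rule integrableI_nonneg)
    show "(\<lambda>x. indicator \<Omega> x *\<^sub>R g x) \<in> borel_measurable lborel"
      by (rule measurable_continuous_dom[OF cont])
    show "(\<integral>\<^sup>+x. ennreal (indicator \<Omega> x *\<^sub>R g x) \<partial>lborel) < \<infinity>"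
      using fin by (rule le_less_trans) simp
  qed (use g0 in \<open>auto split: split_indicator\<close>)
  have "0 \<le> c k" for k using avg_nonneg[of "h k"] nn le[of k] by (meson order_trans)
  then have d0: "0 \<le> d" using LIMSEQ_le_const[OF c] by blast
  have "ennreal (vol * avg g) = (\<integral>\<^sup>+x. ennreal (indicator \<Omega> x *\<^sub>R g x) \<partial>lborel)"
    using vol_pos int_g g0 unfolding avg_def set_lebesgue_integral_def set_integrable_def
    by (subst nn_integral_eq_integral) (auto split: split_indicator)
  then have "ennreal (vol * avg g) \<le> ennreal (vol * d)" using fin by simp
  then show "avg g \<le> d" using vol_pos d0 by (simp add: ennreal_le_iff)
qed

section \<open>Bergman spaces with normalised norms\<close>

lemma bergmanD:
  assumes "f \<in> A p"
  shows "f \<in> extensional \<Omega>" "holo_on f \<Omega>" "int_dom (\<lambda>x. norm (f x) powr p)" "continuous_on \<Omega> f"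
  using assms holo_on_continuous_on unfolding bergman_space_def by auto

lemma continuous_on_norm_powr:
  assumes "continuous_on \<Omega> f" "p > 0"
  shows "continuous_on \<Omega> (\<lambda>x. norm (f x) powr p)"
  using assms by (intro continuous_on_powr' continuous_intros) auto

lemma bergman_restrictI:
  assumes "holo_on f \<Omega>" "int_dom (\<lambda>x. norm (f x) powr p)"
  shows "restrict f \<Omega> \<in> A p"
proof -
  have "holo_on (restrict f \<Omega>) \<Omega>" using assms(1) holo_on_cong[OF open_dom, of f "restrict f \<Omega>"] by simp
  moreover have "int_dom (\<lambda>x. norm (restrict f \<Omega> x) powr p)"
    using assms(2) by (subst int_dom_cong[where k = "\<lambda>x. norm (f x) powr p"]) auto
  ultimately show ?thesis by (simp add: bergman_space_def)
qed

lemma nrm_cong: "(\<And>x. x \<in> \<Omega> \<Longrightarrow> f x = g x) \<Longrightarrow> nrm p f = nrm p g"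
  unfolding nrm_def by (intro arg_cong2[where f = "(powr)"] avg_cong) auto

lemma nrm_restrict [simp]: "nrm p (restrict f \<Omega>) = nrm p f"
  by (intro nrm_cong) simp

lemma nrm_nonneg: "0 \<le> nrm p f"
  by (simp add: nrm_def)

lemma nrm_powr: "p > 0 \<Longrightarrow> nrm p f powr p = avg (\<lambda>x. norm (f x) powr p)"
  by (simp add: nrm_def powr_powr avg_nonneg)

lemma nrm_le_iff: "p > 0 \<Longrightarrow> 0 \<le> c \<Longrightarrow> nrm p f \<le> c \<longleftrightarrow> avg (\<lambda>x. norm (f x) powr p) \<le> c powr p"
  using nrm_nonneg[of p f] nrm_powr[of p f] powr_mono2[of p c "nrm p f"] powr_mono2[of p "nrm p f" c]
    powr_less_mono2[of p c "nrm p f"] by (smt (verit))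

lemma Lp_norm_eq_nrm: "p > 0 \<Longrightarrow> Lp_norm \<Omega> p f = vol powr (1 / p) * nrm p f"
proof -
  assume "p > 0"
  have "(LINT x:\<Omega>|lborel. norm (f x) powr p) = vol * avg (\<lambda>x. norm (f x) powr p)"
    using vol_pos by (simp add: avg_def)
  then show ?thesis
    unfolding Lp_norm_def nrm_def using vol_pos by (simp add: powr_mult avg_nonneg)
qed

lemma nrm_scale: "p > 0 \<Longrightarrow> nrm p (\<lambda>x. c * f x) = norm c * nrm p f"
proof -
  assume p: "p > 0"
  have "avg (\<lambda>x. norm (c * f x) powr p) = norm c powr p * avg (\<lambda>x. norm (f x) powr p)"
    unfolding avg_def by (simp add: norm_mult powr_mult)
  then show ?thesis using p by (simp add: nrm_def powr_mult powr_powr avg_nonneg)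
qed

lemma bergman_scale: "f \<in> A p \<Longrightarrow> restrict (\<lambda>x. c * f x) \<Omega> \<in> A p"
proof (rule bergman_restrictI)
  assume f: "f \<in> A p"
  show "holo_on (\<lambda>x. c * f x) \<Omega>" using holo_on_lincomb[OF bergmanD(2)[OF f] bergmanD(2)[OF f], of c 0] by simp
  show "int_dom (\<lambda>x. norm (c * f x) powr p)"
    using set_integrable_mult_right[OF bergmanD(3)[OF f], of "norm c powr p"] by (simp add: norm_mult powr_mult)
qed

lemma bergman_const: "restrict (\<lambda>x. c) \<Omega> \<in> A p"
  by (rule bergman_restrictI[OF holo_on_const int_dom_const])

text \<open>
  Below exponent \<open>1\<close> there is no triangle inequality for the norm. This substitute holds for all
  exponents, and its first constant is arbitrarily close to \<open>1\<close>, which is all that approximation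
  arguments need. The cases compare \<open>norm b\<close> with \<open>\<eta> * norm a\<close>, and the
  dominated summand is absorbed into the other one.
\<close>

lemma norm_add_powr_le:
  fixes a b :: complex
  assumes "p > 0" "\<eta> > 0"
  shows "norm (a + b) powr p \<le> (1 + \<eta>) powr p * norm a powr p + (1 + 1 / \<eta>) powr p * norm b powr p"
proof (cases "norm b \<le> \<eta> * norm a")
  case True
  have "norm (a + b) \<le> (1 + \<eta>) * norm a" using True norm_triangle_ineq[of a b] by (simp add: algebra_simps)
  then have "norm (a + b) powr p \<le> ((1 + \<eta>) * norm a) powr p" using assms by (intro powr_mono2) auto
  then show ?thesis using assms by (simp add: powr_mult add_increasing2)
next
  case False
  then have "norm a \<le> norm b / \<eta>" using assms by (simp add: field_simps)
  then have "norm (a + b) \<le> (1 + 1 / \<eta>) * norm b" using norm_triangle_ineq[of a b] by (simp add: algebra_simps)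
  then have "norm (a + b) powr p \<le> ((1 + 1 / \<eta>) * norm b) powr p" using assms by (intro powr_mono2) auto
  then show ?thesis using assms by (simp add: powr_mult add_increasing)
qed

lemma bergman_add:
  assumes f: "f \<in> A p" and g: "g \<in> A p" and p: "p > 0"
  shows "restrict (\<lambda>x. f x + g x) \<Omega> \<in> A p"
proof (rule bergman_restrictI)
  show h: "holo_on (\<lambda>x. f x + g x) \<Omega>"
    using holo_on_lincomb[OF bergmanD(2)[OF f] bergmanD(2)[OF g], of 1 1] by simp
  show "int_dom (\<lambda>x. norm (f x + g x) powr p)"
  proof (rule int_dom_bound)
    show "int_dom (\<lambda>x. (1 + 1) powr p * norm (f x) powr p + (1 + 1 / 1) powr p * norm (g x) powr p)"
      by (intro int_dom_lincomb bergmanD(3) f g)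
    show "continuous_on \<Omega> (\<lambda>x. norm (f x + g x) powr p)"
      by (intro continuous_on_norm_powr holo_on_continuous_on h p)
  qed (use norm_add_powr_le[OF p, of 1] in auto)
qed

lemma avg_add_powr_le:
  assumes f: "f \<in> A p" and g: "g \<in> A p" and p: "p > 0" and \<eta>: "\<eta> > 0"
  shows "avg (\<lambda>x. norm (f x + g x) powr p) \<le>
    (1 + \<eta>) powr p * avg (\<lambda>x. norm (f x) powr p) + (1 + 1 / \<eta>) powr p * avg (\<lambda>x. norm (g x) powr p)"
proof -
  have "int_dom (\<lambda>x. norm (restrict (\<lambda>x. f x + g x) \<Omega> x) powr p)"
    by (rule bergmanD(3)[OF bergman_add[OF f g p]])
  then have int: "int_dom (\<lambda>x. norm (f x + g x) powr p)"
    by (subst int_dom_cong[where k = "\<lambda>x. norm (restrict (\<lambda>x. f x + g x) \<Omega> x) powr p"]) auto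
  show ?thesis
    unfolding avg_lincomb[OF bergmanD(3)[OF f] bergmanD(3)[OF g], symmetric]
    by (intro avg_mono int int_dom_lincomb bergmanD(3) f g norm_add_powr_le p \<eta>)
qed

lemma bergman_mono:
  assumes f: "f \<in> A t" and st: "0 < s" "s \<le> t"
  shows "f \<in> A s"
proof -
  have "int_dom (\<lambda>x. norm (f x) powr s)"
  proof (rule int_dom_bound)
    show "int_dom (\<lambda>x. 1 * 1 + 1 * norm (f x) powr t)"
      by (intro int_dom_lincomb int_dom_const bergmanD(3) f)
    show "continuous_on \<Omega> (\<lambda>x. norm (f x) powr s)"
      using continuous_on_norm_powr[OF bergmanD(4)[OF f] st(1)] .
    fix x
    show "\<bar>norm (f x) powr s\<bar> \<le> 1 * 1 + 1 * norm (f x) powr t"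
    proof (cases "norm (f x) \<ge> 1")
      case True
      then show ?thesis using st powr_mono[of s t "norm (f x)"] by simp
    next
      case False
      then have "norm (f x) powr s \<le> 1" using st powr_le1[of s "norm (f x)"] by simp
      then show ?thesis by (simp add: add_increasing2)
    qed
  qed
  then show ?thesis using f by (simp add: bergman_space_def)
qed

text \<open>
  Jensen's inequality for the probability measure on \<open>\<Omega>\<close>, derived from Young's inequality for
  \<open>|f| powr t / B\<close> and \<open>1\<close> with weights \<open>s / t\<close> and \<open>1 - s / t\<close>, where \<open>B\<close> is the mean of \<open>|f| powr t\<close>.
\<close>

theorem nrm_mono:
  assumes f: "f \<in> A t" and st: "0 < s" "s \<le> t"
  shows "nrm s f \<le> nrm t f"
proof -
  define B where "B = avg (\<lambda>x. norm (f x) powr t)"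
  have B0: "B \<ge> 0" unfolding B_def by (intro avg_nonneg) simp
  have fs: "f \<in> A s" by (rule bergman_mono[OF f st])
  show ?thesis
  proof (cases "B = 0")
    case True
    have "norm (f x) powr t = 0" if "x \<in> \<Omega>" for x
      by (rule avg_eq_0_imp_0[OF bergmanD(3)[OF f] continuous_on_norm_powr[OF bergmanD(4)[OF f]]])
        (use st True that in \<open>auto simp: B_def\<close>)
    then have "avg (\<lambda>x. norm (f x) powr s) = avg (\<lambda>x. 0)" by (intro avg_cong) auto
    then show ?thesis using st by (simp add: nrm_def avg_const)
  next
    case False
    then have B: "B > 0" using B0 by simp
    have pt: "norm (f x) powr s \<le> B powr (s / t) * (s / t) / B * norm (f x) powr t + B powr (s / t) * (1 - s / t) * 1" for x
    proof (cases "f x = 0")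
      case False
      have "(norm (f x) powr t / B) powr (s / t) * 1 powr (1 - s / t) \<le> s / t * (norm (f x) powr t / B) + (1 - s / t) * 1"
        using st B False by (intro Youngs_inequality_0) auto
      then have "norm (f x) powr s / B powr (s / t) \<le> s / t * (norm (f x) powr t / B) + (1 - s / t)"
        using st B False by (simp add: powr_divide powr_powr)
      then have "norm (f x) powr s \<le> B powr (s / t) * (s / t * (norm (f x) powr t / B) + (1 - s / t))"
        using B by (simp add: divide_le_eq mult.commute)
      then show ?thesis by (simp add: algebra_simps)
    qed (use st B in auto)
    have "avg (\<lambda>x. norm (f x) powr s) \<le> avg (\<lambda>x. B powr (s / t) * (s / t) / B * norm (f x) powr t + B powr (s / t) * (1 - s / t) * 1)"
      by (intro avg_mono pt int_dom_lincomb bergmanD(3) fs f int_dom_const)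
    also have "\<dots> = B powr (s / t) * (s / t) / B * B + B powr (s / t) * (1 - s / t) * 1"
      unfolding avg_lincomb[OF bergmanD(3)[OF f] int_dom_const] B_def avg_const ..
    also have "\<dots> = B powr (s / t)" using B by (simp add: algebra_simps)
    finally have "avg (\<lambda>x. norm (f x) powr s) powr (1 / s) \<le> (B powr (s / t)) powr (1 / s)"
      using st by (intro powr_mono2 avg_nonneg) auto
    then show ?thesis using st by (simp add: nrm_def powr_powr B_def)
  qed
qed

text \<open>
  The bound for exponent \<open>min q 1\<close> together with monotonicity of the norm in the exponent.
\<close>

theorem bergman_local_bound:
  assumes a: "a \<in> \<Omega>" and q: "q > 0"
  shows "\<exists>r>0. \<exists>C\<ge>0. ball a r \<subseteq> \<Omega> \<and> (\<forall>f\<in>A q. \<forall>x\<in>ball a r. norm (f x) \<le> C * nrm q f)"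
proof -
  define q' where "q' = min q 1"
  have q': "0 < q'" "q' \<le> 1" "q' \<le> q" using q by (auto simp: q'_def)
  obtain R where R: "R > 0" "cball a R \<subseteq> \<Omega>" using open_dom a open_contains_cball by blast
  obtain C where C: "C \<ge> 0" "\<And>f x. holo_on f \<Omega> \<Longrightarrow> int_dom (\<lambda>x. norm (f x) powr q') \<Longrightarrow> x \<in> ball a (R/2) \<Longrightarrow>
      norm (f x) \<le> C * (LINT x:\<Omega>|lborel. norm (f x) powr q') powr (1/q')"
    using holo_on_local_bound_small_exponent[OF q'(1,2) R] by blast
  have "norm (f x) \<le> C * vol powr (1 / q') * nrm q f" if f: "f \<in> A q" and x: "x \<in> ball a (R/2)" for f x
  proof -
    note f' = bergman_mono[OF f q'(1,3)]
    have "norm (f x) \<le> C * Lp_norm \<Omega> q' f"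
      unfolding Lp_norm_def using C(2)[OF bergmanD(2,3)[OF f'] x] .
    also have "\<dots> = C * vol powr (1 / q') * nrm q' f" by (simp add: Lp_norm_eq_nrm[OF q'(1)])
    also have "\<dots> \<le> C * vol powr (1 / q') * nrm q f"
      using nrm_mono[OF f q'(1,3)] C(1) by (intro mult_left_mono) auto
    finally show ?thesis .
  qed
  moreover have "ball a (R/2) \<subseteq> \<Omega>" using R by auto
  ultimately show ?thesis using R C(1)
    by (intro exI[of _ "R/2"] conjI exI[of _ "C * vol powr (1 / q')"]) auto
qed

text \<open>
  From some index on all exponents exceed \<open>p / 2\<close>, and monotonicity of the norm bounds the whole tail in
  the single space of exponent \<open>p / 2\<close>. This gives local bounds and Montel's theorem applies. Fatou's
  lemma, used with the varying exponents, recovers the bound in the limit space.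
\<close>

theorem bergman_compactness:
  fixes f :: "nat \<Rightarrow> complex ^ 'n \<Rightarrow> complex"
  assumes p: "p > 0" and s: "s \<longlonglongrightarrow> p" and f: "\<And>k. f k \<in> A (s k)"
    and le: "\<And>k. nrm (s k) (f k) \<le> c k" and c: "c \<longlonglongrightarrow> d"
  obtains \<phi> :: "nat \<Rightarrow> nat" and g where "strict_mono \<phi>" "g \<in> A p" "nrm p g \<le> d"
    "\<And>x. x \<in> \<Omega> \<Longrightarrow> (\<lambda>k. f (\<phi> k) x) \<longlonglongrightarrow> g x"
    "\<And>x v. x \<in> \<Omega> \<Longrightarrow> (\<lambda>k. frechet_derivative (f (\<phi> k)) (at x) v) \<longlonglongrightarrow> frechet_derivative g (at x) v"
proof -
  have "\<forall>\<^sub>F k in sequentially. p / 2 < s k"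
    using order_tendstoD(1)[OF s, of "p / 2"] p by simp
  then obtain K where K: "\<And>k. k \<ge> K \<Longrightarrow> p / 2 < s k" unfolding eventually_sequentially by blast
  define F where "F k = f (k + K)" for k
  define t where "t k = s (k + K)" for k
  define b where "b k = c (k + K)" for k
  have t: "t \<longlonglongrightarrow> p" and b: "b \<longlonglongrightarrow> d"
    unfolding t_def b_def using s c by (auto intro: LIMSEQ_ignore_initial_segment)
  have tp: "p / 2 < t k" for k using K by (simp add: t_def)
  have F: "F k \<in> A (t k)" and Fb: "nrm (t k) (F k) \<le> b k" for k
    using f le by (auto simp: F_def t_def b_def)
  obtain M where M: "\<And>k. b k \<le> M"
    using convergent_imp_Bseq[OF convergentI[OF b]] unfolding Bseq_def by (metis abs_le_D1 real_norm_def)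
  have F2: "F k \<in> A (p / 2)" "nrm (p / 2) (F k) \<le> M" for k
    using bergman_mono[OF F, of "p/2" k] nrm_mono[OF F, of "p/2" k] tp[of k] p Fb[of k] M[of k] by auto
  have bdd: "\<exists>r>0. \<exists>B. ball a r \<subseteq> \<Omega> \<and> (\<forall>k. \<forall>x\<in>ball a r. norm (F k x) \<le> B)" if a: "a \<in> \<Omega>" for a
  proof -
    obtain r C where rC: "r > 0" "C \<ge> 0" "ball a r \<subseteq> \<Omega>"
      "\<And>f x. f \<in> A (p/2) \<Longrightarrow> x \<in> ball a r \<Longrightarrow> norm (f x) \<le> C * nrm (p/2) f"
      using bergman_local_bound[OF a, of "p/2"] p by auto
    have "norm (F k x) \<le> C * M" if "x \<in> ball a r" for k x
      using rC(4)[OF F2(1) that] mult_left_mono[OF F2(2)[of k] rC(2)] by (rule order_trans)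
    with rC show ?thesis by blast
  qed
  have hol: "holo_on (F k) \<Omega>" for k by (rule bergmanD(2)[OF F])
  obtain \<phi> :: "nat \<Rightarrow> nat" and g where \<phi>: "strict_mono \<phi>" and g: "holo_on g \<Omega>"
    and lim: "\<And>x. x \<in> \<Omega> \<Longrightarrow> (\<lambda>k. F (\<phi> k) x) \<longlonglongrightarrow> g x"
    and lim': "\<And>x v. x \<in> \<Omega> \<Longrightarrow> (\<lambda>k. frechet_derivative (F (\<phi> k)) (at x) v) \<longlonglongrightarrow> frechet_derivative g (at x) v"
    using Montel_holo_on[OF hol bdd] by blast
  have b0: "b k \<ge> 0" for k using order_trans[OF nrm_nonneg Fb] .
  then have d0: "d \<ge> 0" using LIMSEQ_le_const[OF b] by blast
  note t' = LIMSEQ_strict_mono_subsequence[OF t \<phi>] and b' = LIMSEQ_strict_mono_subsequence[OF b \<phi>]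
  have Fat: "int_dom (\<lambda>x. norm (g x) powr p) \<and> avg (\<lambda>x. norm (g x) powr p) \<le> d powr p"
  proof (intro conjI)
    let ?h = "\<lambda>k x. norm (F (\<phi> k) x) powr t (\<phi> k)"
    have 1: "int_dom (?h k)" for k by (rule bergmanD(3)[OF F])
    have 2: "(\<lambda>k. ?h k x) \<longlonglongrightarrow> norm (g x) powr p" if "x \<in> \<Omega>" for x
      using p by (intro tendsto_powr' tendsto_norm lim that t') auto
    have 3: "continuous_on \<Omega> (\<lambda>x. norm (g x) powr p)"
      by (intro continuous_on_norm_powr holo_on_continuous_on g p)
    have 4: "avg (?h k) \<le> b (\<phi> k) powr t (\<phi> k)" for k
    proof -
      have "t (\<phi> k) > 0" using tp[of "\<phi> k"] p by linarith
      then show ?thesis using Fb[of "\<phi> k"] b0 by (simp add: nrm_le_iff)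
    qed
    have 5: "(\<lambda>k. b (\<phi> k) powr t (\<phi> k)) \<longlonglongrightarrow> d powr p"
      using p b0 by (intro tendsto_powr' b' t') auto
    show "int_dom (\<lambda>x. norm (g x) powr p)" by (rule avg_Fatou(1)[OF 1 _ 2 3 4 5]) auto
    show "avg (\<lambda>x. norm (g x) powr p) \<le> d powr p" by (rule avg_Fatou(2)[OF 1 _ 2 3 4 5]) auto
  qed
  show thesis
  proof (rule that[of "\<lambda>k. \<phi> k + K" "restrict g \<Omega>"])
    show "strict_mono (\<lambda>k. \<phi> k + K)" using \<phi> by (simp add: strict_mono_def)
    show "restrict g \<Omega> \<in> A p" using Fat by (intro bergman_restrictI g) auto
    show "nrm p (restrict g \<Omega>) \<le> d" using Fat p d0 by (simp add: nrm_le_iff)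
    fix x v assume x: "x \<in> \<Omega>"
    show "(\<lambda>k. f (\<phi> k + K) x) \<longlonglongrightarrow> restrict g \<Omega> x" using lim[OF x] x by (simp add: F_def)
    have "frechet_derivative (restrict g \<Omega>) (at x) = frechet_derivative g (at x)"
      by (rule frechet_derivative_cong_open[OF open_dom _ x]) simp
    then show "(\<lambda>k. frechet_derivative (f (\<phi> k + K)) (at x) v) \<longlonglongrightarrow> frechet_derivative (restrict g \<Omega>) (at x) v"
      using lim'[OF x] by (simp add: F_def)
  qed
qed

section \<open>Minimizers\<close>

definition mu :: "real \<Rightarrow> complex ^ 'n \<Rightarrow> real" where
  "mu p w = m_val \<Omega> p w / vol powr (1 / p)"

definition minimizer :: "real \<Rightarrow> complex ^ 'n \<Rightarrow> (complex ^ 'n \<Rightarrow> complex) \<Rightarrow> bool" where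
  "minimizer p w f \<longleftrightarrow> f \<in> A p \<and> f w = 1 \<and> nrm p f = mu p w"

lemma m_val_eq_mu: "m_val \<Omega> p w = vol powr (1 / p) * mu p w"
  using vol_pos by (simp add: mu_def)

lemma mu_le: "p > 0 \<Longrightarrow> f \<in> A p \<Longrightarrow> f w = 1 \<Longrightarrow> mu p w \<le> nrm p f"
proof -
  assume p: "p > 0" and f: "f \<in> A p" "f w = 1"
  have "m_val \<Omega> p w \<le> Lp_norm \<Omega> p f"
    unfolding m_val_def using f
    by (intro cInf_lower bdd_belowI[of _ 0]) (auto simp: Lp_norm_def)
  then show ?thesis using vol_pos by (simp add: m_val_eq_mu Lp_norm_eq_nrm[OF p])
qed

lemma mu_approx:
  assumes p: "p > 0" and w: "w \<in> \<Omega>" and e: "e > 0"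
  shows "\<exists>f\<in>A p. f w = 1 \<and> nrm p f < mu p w + e"
proof -
  let ?S = "{Lp_norm \<Omega> p f | f. f \<in> A p \<and> f w = 1}"
  have "restrict (\<lambda>x. 1) \<Omega> \<in> A p" "restrict (\<lambda>x. 1 :: complex) \<Omega> w = 1" using bergman_const w by auto
  then have "?S \<noteq> {}" by blast
  moreover have "Inf ?S < vol powr (1 / p) * (mu p w + e)"
    using vol_pos e by (simp add: m_val_def[symmetric] m_val_eq_mu distrib_left)
  ultimately obtain f where "f \<in> A p" "f w = 1" "Lp_norm \<Omega> p f < vol powr (1 / p) * (mu p w + e)"
    using cInf_lessD[of ?S] by blast
  then show ?thesis using vol_pos by (auto simp: Lp_norm_eq_nrm[OF p])
qed

theorem minimizer_exists:
  assumes p: "p > 0" and w: "w \<in> \<Omega>"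
  shows "\<exists>f. minimizer p w f"
proof -
  have "\<exists>f\<in>A p. f w = 1 \<and> nrm p f < mu p w + 1 / real (Suc k)" for k
    by (rule mu_approx[OF p w]) simp
  then obtain f where f: "\<And>k. f k \<in> A p" "\<And>k. f k w = 1" "\<And>k. nrm p (f k) \<le> mu p w + 1 / real (Suc k)"
    by (metis less_imp_le)
  have c: "(\<lambda>k. mu p w + 1 / real (Suc k)) \<longlonglongrightarrow> mu p w"
    using tendsto_add[OF tendsto_const LIMSEQ_inverse_real_of_nat] by (simp add: inverse_eq_divide)
  obtain \<phi> :: "nat \<Rightarrow> nat" and g where g: "g \<in> A p" "nrm p g \<le> mu p w" and "strict_mono \<phi>"
    and lim: "\<And>x. x \<in> \<Omega> \<Longrightarrow> (\<lambda>k. f (\<phi> k) x) \<longlonglongrightarrow> g x"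
    using bergman_compactness[OF p tendsto_const f(1,3) c] by metis
  have gw: "g w = 1" using LIMSEQ_unique[OF lim[OF w]] f(2) by auto
  then show ?thesis using g mu_le[OF p g(1) gw] by (auto simp: minimizer_def)
qed

lemma mu_mono: "0 < s \<Longrightarrow> s \<le> t \<Longrightarrow> w \<in> \<Omega> \<Longrightarrow> mu s w \<le> mu t w"
proof -
  assume st: "0 < s" "s \<le> t" and w: "w \<in> \<Omega>"
  then obtain f where f: "f \<in> A t" "f w = 1" "nrm t f = mu t w"
    using minimizer_exists[of t w] by (auto simp: minimizer_def)
  then show ?thesis using mu_le[OF st(1) bergman_mono[OF f(1) st] f(2)] nrm_mono[OF f(1) st] by simp
qed

lemma mu_pos: "p > 0 \<Longrightarrow> w \<in> \<Omega> \<Longrightarrow> mu p w > 0"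
proof -
  assume p: "p > 0" and w: "w \<in> \<Omega>"
  obtain f where f: "f \<in> A p" "f w = 1" "nrm p f = mu p w"
    using minimizer_exists[OF p w] by (auto simp: minimizer_def)
  obtain r C where rC: "r > 0" "C \<ge> 0" "\<And>f x. f \<in> A p \<Longrightarrow> x \<in> ball w r \<Longrightarrow> norm (f x) \<le> C * nrm p f"
    using bergman_local_bound[OF w p] by blast
  have "1 \<le> C * mu p w" using rC(3)[OF f(1), of w] rC(1) f by simp
  moreover have "mu p w \<ge> 0" using f(3) nrm_nonneg by metis
  ultimately show ?thesis by (cases "mu p w = 0") auto
qed

text \<open>
  For exponents below \<open>p\<close> the values of \<open>mu\<close> are at most \<open>mu p w\<close>; conversely a limit of minimizers is a
  competitor for exponent \<open>p\<close> whose norm is at most any limit point of those values. The value \<open>p\<close> is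
  admitted in the sequence so that it may be mixed with smaller exponents.
\<close>

theorem mu_left_continuous:
  assumes p: "p > 0" and w: "w \<in> \<Omega>" and u: "\<And>k. 0 < u k" "\<And>k. u k \<le> p" and lim: "u \<longlonglongrightarrow> p"
  shows "(\<lambda>k. mu (u k) w) \<longlonglongrightarrow> mu p w"
proof (rule tendsto_if_subsequences)
  fix \<phi> :: "nat \<Rightarrow> nat" assume \<phi>: "strict_mono \<phi>"
  have "bounded (range (\<lambda>k. mu (u (\<phi> k)) w))"
    using mu_mono[OF u w] mu_pos[OF u(1) w]
    by (intro boundedI[of _ "mu p w"]) (auto simp: less_imp_le)
  then obtain L and \<psi> :: "nat \<Rightarrow> nat" where \<psi>: "strict_mono \<psi>" and L: "(\<lambda>k. mu (u (\<phi> (\<psi> k))) w) \<longlonglongrightarrow> L"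
    using bounded_imp_convergent_subsequence[of "\<lambda>k. mu (u (\<phi> k)) w"] by (auto simp: o_def)
  have "\<exists>f. minimizer (u (\<phi> (\<psi> k))) w f" for k by (rule minimizer_exists[OF u(1) w])
  then obtain f where f: "\<And>k. minimizer (u (\<phi> (\<psi> k))) w (f k)" by metis
  have lim': "(\<lambda>k. u (\<phi> (\<psi> k))) \<longlonglongrightarrow> p" using LIMSEQ_strict_mono_subsequence[OF LIMSEQ_strict_mono_subsequence[OF lim \<phi>] \<psi>] .
  have fA: "f k \<in> A (u (\<phi> (\<psi> k)))" and fn: "nrm (u (\<phi> (\<psi> k))) (f k) \<le> mu (u (\<phi> (\<psi> k))) w" for k
    using f[of k] by (auto simp: minimizer_def)
  obtain \<theta> :: "nat \<Rightarrow> nat" and g where g: "g \<in> A p" "nrm p g \<le> L"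
    and lg: "\<And>x. x \<in> \<Omega> \<Longrightarrow> (\<lambda>k. f (\<theta> k) x) \<longlonglongrightarrow> g x"
    using bergman_compactness[OF p lim' fA fn L] by metis
  have gw: "g w = 1" using LIMSEQ_unique[OF lg[OF w]] f by (auto simp: minimizer_def)
  have "mu p w \<le> L" using mu_le[OF p g(1) gw] g(2) by simp
  moreover have "L \<le> mu p w" using LIMSEQ_le_const2[OF L] mu_mono[OF u w] by blast
  ultimately show "\<exists>\<psi>. strict_mono \<psi> \<and> (\<lambda>k. mu (u (\<phi> (\<psi> k))) w) \<longlonglongrightarrow> mu p w"
    using \<psi> L by auto
qed

text \<open>
  The midpoint of two minimizers competes for the smaller of the two exponents, where both of them are
  available. So the convexity defect of the powers has mean at most a combination of values of \<open>mu\<close> that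
  tends to \<open>L powr p / 2 + L powr p / 2 - L powr p = 0\<close>, and in the limit the defect vanishes. This gives
  equality in the triangle inequality for \<open>F\<close> and \<open>G\<close>.
\<close>

theorem minimizer_limits_agree:
  assumes p: "p \<ge> 1" and w: "w \<in> \<Omega>"
    and s: "\<And>k. s k \<ge> 1" "s \<longlonglongrightarrow> p" and t: "\<And>k. t k \<ge> 1" "t \<longlonglongrightarrow> p"
    and f: "\<And>k. minimizer (s k) w (f k)" and g: "\<And>k. minimizer (t k) w (g k)"
    and mu_s: "(\<lambda>k. mu (s k) w) \<longlonglongrightarrow> L" and mu_t: "(\<lambda>k. mu (t k) w) \<longlonglongrightarrow> L"
    and mu_min: "(\<lambda>k. mu (min (s k) (t k)) w) \<longlonglongrightarrow> L"
    and F: "holo_on F \<Omega>" "\<And>x. x \<in> \<Omega> \<Longrightarrow> (\<lambda>k. f k x) \<longlonglongrightarrow> F x"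
    and G: "holo_on G \<Omega>" "\<And>x. x \<in> \<Omega> \<Longrightarrow> (\<lambda>k. g k x) \<longlonglongrightarrow> G x"
    and x: "x \<in> \<Omega>"
  shows "F x = G x"
proof -
  define u where "u k = min (s k) (t k)" for k
  have u: "u k \<ge> 1" "u k \<le> s k" "u k \<le> t k" for k using s t by (auto simp: u_def)
  then have u0: "0 < u k" for k using less_le_trans[OF zero_less_one] by blast
  have ulim: "u \<longlonglongrightarrow> p" unfolding u_def using tendsto_min[OF s(2) t(2)] by simp
  have fA: "f k \<in> A (u k)" and gA: "g k \<in> A (u k)" for k
    using f[of k] g[of k] bergman_mono[OF _ u0] u by (auto simp: minimizer_def)
  define h where "h k = restrict (\<lambda>x. (1/2) * restrict (\<lambda>x. f k x + g k x) \<Omega> x) \<Omega>" for k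
  have hA: "h k \<in> A (u k)" for k
    unfolding h_def by (intro bergman_scale bergman_add fA gA u0)
  have hx: "h k x = (f k x + g k x) / 2" if "x \<in> \<Omega>" for k x using that by (simp add: h_def)
  have hw: "h k w = 1" for k
    unfolding hx[OF w] using f[of k] g[of k] by (simp add: minimizer_def)
  \<comment> \<open>the convexity defect, with coefficients 1 and -1 written out as nested linear combinations\<close>
  define \<Phi> where "\<Phi> k x = 1 * (1/2 * norm (f k x) powr u k + 1/2 * norm (g k x) powr u k) + (- 1) * norm (h k x) powr u k" for k x
  note I = bergmanD(3)[OF fA] bergmanD(3)[OF gA] bergmanD(3)[OF hA]
  have mean: "norm ((a + b) / 2) powr q \<le> ((norm a + norm b) / 2) powr q"
    "((norm a + norm b) / 2) powr q \<le> 1/2 * norm a powr q + 1/2 * norm b powr q" if "q \<ge> 1" for a b :: complex and q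
    using that norm_triangle_ineq[of a b] powr_mean_le[of q "norm a" "norm b"] by (auto intro!: powr_mono2 simp: norm_divide)
  have 1: "int_dom (\<Phi> k)" for k unfolding \<Phi>_def by (intro int_dom_lincomb I)
  have 2: "0 \<le> \<Phi> k x" if "x \<in> \<Omega>" for k x
    using mean[OF u(1), of "f k x" "g k x" k] unfolding \<Phi>_def hx[OF that] by simp
  define \<Psi> where "\<Psi> x = 1 * (1/2 * norm (F x) powr p + 1/2 * norm (G x) powr p) + (- 1) * norm ((F x + G x) / 2) powr p" for x
  have 3: "(\<lambda>k. \<Phi> k x) \<longlonglongrightarrow> \<Psi> x" if "x \<in> \<Omega>" for x
    unfolding \<Phi>_def \<Psi>_def hx[OF that] using p
    by (intro tendsto_intros tendsto_powr' F(2) G(2) that ulim) auto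
  have 4: "continuous_on \<Omega> \<Psi>"
    unfolding \<Psi>_def using p
    by (intro continuous_intros continuous_on_norm_powr holo_on_continuous_on F(1) G(1)) auto
  have 5: "avg (\<Phi> k) \<le> 1/2 * mu (s k) w powr u k + 1/2 * mu (t k) w powr u k - mu (u k) w powr u k" for k
  proof -
    have "avg (\<Phi> k) = 1 * (1/2 * avg (\<lambda>x. norm (f k x) powr u k) + 1/2 * avg (\<lambda>x. norm (g k x) powr u k)) + (- 1) * avg (\<lambda>x. norm (h k x) powr u k)"
      unfolding \<Phi>_def avg_lincomb[OF int_dom_lincomb[OF I(1,2)] I(3)] avg_lincomb[OF I(1,2)] ..
    also have "\<dots> = 1/2 * nrm (u k) (f k) powr u k + 1/2 * nrm (u k) (g k) powr u k - nrm (u k) (h k) powr u k"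
      by (simp add: nrm_powr[OF u0])
    also have "\<dots> \<le> 1/2 * mu (s k) w powr u k + 1/2 * mu (t k) w powr u k - mu (u k) w powr u k"
    proof -
      have "nrm (u k) (f k) \<le> mu (s k) w" "nrm (u k) (g k) \<le> mu (t k) w"
        using nrm_mono[OF _ u0 u(2), of "f k" k] nrm_mono[OF _ u0 u(3), of "g k" k] f[of k] g[of k]
        by (auto simp: minimizer_def)
      moreover have "mu (u k) w \<le> nrm (u k) (h k)" by (rule mu_le[OF u0 hA hw])
      ultimately have "nrm (u k) (f k) powr u k \<le> mu (s k) w powr u k"
        "nrm (u k) (g k) powr u k \<le> mu (t k) w powr u k" "mu (u k) w powr u k \<le> nrm (u k) (h k) powr u k"
        using u0[of k] mu_pos[OF u0 w, of k] nrm_nonneg by (auto intro!: powr_mono2)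
      then show ?thesis by linarith
    qed
    finally show ?thesis .
  qed
  have s0: "0 < s k" and t0: "0 < t k" for k using s(1)[of k] t(1)[of k] by linarith+
  have 6: "(\<lambda>k. 1/2 * mu (s k) w powr u k + 1/2 * mu (t k) w powr u k - mu (u k) w powr u k) \<longlonglongrightarrow>
      1/2 * L powr p + 1/2 * L powr p - L powr p"
    using p mu_pos[OF s0 w] mu_pos[OF t0 w] mu_pos[OF u0 w]
    by (intro tendsto_intros tendsto_powr' mu_s mu_t mu_min[folded u_def] ulim) (auto simp: less_imp_le)
  have int: "int_dom \<Psi>" by (rule avg_Fatou(1)[OF 1 2 3 4 5 6])
  have le: "avg \<Psi> \<le> 0" using avg_Fatou(2)[OF 1 2 3 4 5 6] by simp
  have nn: "0 \<le> \<Psi> y" for y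
    using mean[OF p, of "F y" "G y"] by (simp add: \<Psi>_def)
  have add: "norm (F y + G y) = norm (F y) + norm (G y)" if y: "y \<in> \<Omega>" for y
  proof (rule ccontr)
    assume "norm (F y + G y) \<noteq> norm (F y) + norm (G y)"
    then have "norm ((F y + G y) / 2) < (norm (F y) + norm (G y)) / 2"
      using norm_triangle_ineq[of "F y" "G y"] by (simp add: norm_divide)
    then have "norm ((F y + G y) / 2) powr p < ((norm (F y) + norm (G y)) / 2) powr p"
      using p by (intro powr_less_mono2) auto
    moreover have "\<Psi> y = 0" by (rule avg_eq_0_imp_0[OF int 4 nn le y])
    ultimately show False using mean(2)[OF p, of "F y" "G y"] by (simp add: \<Psi>_def)
  qed
  have "F w = 1" "G w = 1"
    using LIMSEQ_unique[OF F(2)[OF w]] LIMSEQ_unique[OF G(2)[OF w]] f g by (auto simp: minimizer_def)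
  from holo_on_eq_if_norm_add[OF open_dom connected_dom F(1) G(1) w this add x] show ?thesis .
qed

lemma minimizer_unique:
  assumes p: "p \<ge> 1" and w: "w \<in> \<Omega>" and f: "minimizer p w f" and g: "minimizer p w g"
  shows "f = g"
proof (rule extensionalityI)
  show "f \<in> extensional \<Omega>" "g \<in> extensional \<Omega>" using f g bergmanD(1) by (auto simp: minimizer_def)
  have hol: "holo_on f \<Omega>" "holo_on g \<Omega>" using f g bergmanD(2) by (auto simp: minimizer_def)
  fix x assume x: "x \<in> \<Omega>"
  show "f x = g x"
    by (rule minimizer_limits_agree[where s = "\<lambda>_. p" and t = "\<lambda>_. p" and f = "\<lambda>_. f" and g = "\<lambda>_. g" and L = "mu p w"])
      (use assms hol x in auto)
qed

lemma m_fun_eq_minimizer: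
  assumes p: "p \<ge> 1" and w: "w \<in> \<Omega>" and f: "minimizer p w f"
  shows "m_fun \<Omega> p \<zeta> w = f \<zeta>"
proof -
  have "(h \<in> A p \<and> h w = 1 \<and> Lp_norm \<Omega> p h = m_val \<Omega> p w) \<longleftrightarrow> minimizer p w h" for h
    using p vol_pos by (simp add: minimizer_def Lp_norm_eq_nrm m_val_eq_mu)
  then have "m_fun \<Omega> p \<zeta> w = (THE h. minimizer p w h) \<zeta>"
    by (simp add: m_fun_def)
  also have "(THE h. minimizer p w h) = f"
    using f minimizer_unique[OF p w] by blast
  finally show ?thesis .
qed

text \<open>
  All limit points of minimizers with exponents in \<open>T\<close> coincide, because \<open>mu\<close> has the same limit along
  every sequence in \<open>T\<close>, including the sequence of minima of two such sequences. Three sets are used: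
  exponents above \<open>p\<close> for the existence of the right limit, and exponents at least \<open>p\<close>, respectively at
  most \<open>p\<close>, for the identification of a one-sided limit, where the constant sequence \<open>p\<close> stays in \<open>T\<close>.
\<close>

theorem minimizer_limit:
  assumes p: "p \<ge> 1" and w: "w \<in> \<Omega>" and \<zeta>: "\<zeta> \<in> \<Omega>" and T: "T \<subseteq> {1..}"
    and mu: "\<And>u. (\<And>k. u k \<in> T) \<Longrightarrow> u \<longlonglongrightarrow> p \<Longrightarrow> (\<lambda>k. mu (u k) w) \<longlonglongrightarrow> L"
    and e: "\<And>k. e k \<in> T" "e \<longlonglongrightarrow> p"
  shows "\<exists>l. \<forall>u. (\<forall>k. u k \<in> T) \<longrightarrow> u \<longlonglongrightarrow> p \<longrightarrow> (\<lambda>k. m_fun \<Omega> (u k) \<zeta> w) \<longlonglongrightarrow> l"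
proof -
  have p0: "p > 0" using p by simp
  have T1: "s \<ge> 1" if "s \<in> T" for s using T that by auto
  define sel where "sel s = (SOME f. minimizer s w f)" for s
  have sel: "minimizer s w (sel s)" if "s \<in> T" for s
  proof -
    have "\<exists>f. minimizer s w f" using T1[OF that] by (intro minimizer_exists w) simp
    then show ?thesis unfolding sel_def by (rule someI_ex)
  qed
  have selA: "sel s \<in> A s" "nrm s (sel s) \<le> mu s w" if "s \<in> T" for s
    using sel[OF that] by (auto simp: minimizer_def)
  have m: "m_fun \<Omega> s \<zeta> w = sel s \<zeta>" if "s \<in> T" for s
    using m_fun_eq_minimizer[OF T1[OF that] w sel[OF that]] .
  obtain \<phi> :: "nat \<Rightarrow> nat" and F where \<phi>: "strict_mono \<phi>" and F: "F \<in> A p"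
    and limF: "\<And>x. x \<in> \<Omega> \<Longrightarrow> (\<lambda>k. sel (e (\<phi> k)) x) \<longlonglongrightarrow> F x"
    using bergman_compactness[OF p0 e(2) selA(1)[OF e(1)] selA(2)[OF e(1)] mu[OF e]] by metis
  have "(\<lambda>k. m_fun \<Omega> (u k) \<zeta> w) \<longlonglongrightarrow> F \<zeta>" if u: "\<And>k. u k \<in> T" "u \<longlonglongrightarrow> p" for u
  proof (rule tendsto_if_subsequences)
    fix \<psi> :: "nat \<Rightarrow> nat" assume \<psi>: "strict_mono \<psi>"
    define v where "v k = u (\<psi> k)" for k
    have v: "v k \<in> T" "v \<longlonglongrightarrow> p" for k
      using u(1) LIMSEQ_strict_mono_subsequence[OF u(2) \<psi>] by (auto simp: v_def[abs_def])
    obtain \<theta> :: "nat \<Rightarrow> nat" and G where \<theta>: "strict_mono \<theta>" and G: "G \<in> A p"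
      and limG: "\<And>x. x \<in> \<Omega> \<Longrightarrow> (\<lambda>k. sel (v (\<theta> k)) x) \<longlonglongrightarrow> G x"
      using bergman_compactness[OF p0 v(2) selA(1)[OF v(1)] selA(2)[OF v(1)] mu[OF v]] by metis
    have mT: "min (e (\<phi> k)) (v (\<theta> k)) \<in> T" for k using e(1) v(1) by (simp add: min_def)
    have lims: "(\<lambda>k. e (\<phi> k)) \<longlonglongrightarrow> p" "(\<lambda>k. v (\<theta> k)) \<longlonglongrightarrow> p"
      by (rule LIMSEQ_strict_mono_subsequence[OF e(2) \<phi>], rule LIMSEQ_strict_mono_subsequence[OF v(2) \<theta>])
    have mlim: "(\<lambda>k. min (e (\<phi> k)) (v (\<theta> k))) \<longlonglongrightarrow> p" using tendsto_min[OF lims] by simp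
    have "F \<zeta> = G \<zeta>"
      by (rule minimizer_limits_agree[OF p w T1[OF e(1)] lims(1) T1[OF v(1)] lims(2) sel[OF e(1)] sel[OF v(1)]
          mu[OF e(1) lims(1)] mu[OF v(1) lims(2)] mu[OF mT mlim] bergmanD(2)[OF F] limF bergmanD(2)[OF G] limG \<zeta>])
    then have "(\<lambda>k. m_fun \<Omega> (u (\<psi> (\<theta> k))) \<zeta> w) \<longlonglongrightarrow> F \<zeta>"
      using limG[OF \<zeta>] m[OF u(1)] by (simp add: v_def)
    then show "\<exists>\<theta>. strict_mono \<theta> \<and> (\<lambda>k. m_fun \<Omega> (u (\<psi> (\<theta> k))) \<zeta> w) \<longlonglongrightarrow> F \<zeta>"
      using \<theta> by blast
  qed
  then show ?thesis by blast
qed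

section \<open>Approximation in the Bergman norm\<close>

lemma avg_dominated:
  assumes cont: "\<And>k. continuous_on \<Omega> (h k)" "continuous_on \<Omega> g" and w: "int_dom w"
    and lim: "\<And>x. x \<in> \<Omega> \<Longrightarrow> (\<lambda>k. h k x) \<longlonglongrightarrow> g x"
    and le: "\<And>k x. x \<in> \<Omega> \<Longrightarrow> \<bar>h k x\<bar> \<le> w x"
  shows "(\<lambda>k. avg (h k)) \<longlonglongrightarrow> avg g"
proof -
  have "(\<lambda>k. LINT x|lborel. indicator \<Omega> x *\<^sub>R h k x) \<longlonglongrightarrow> (LINT x|lborel. indicator \<Omega> x *\<^sub>R g x)"
  proof (rule integral_dominated_convergence[where w = "\<lambda>x. indicator \<Omega> x *\<^sub>R w x"])
    show "AE x in lborel. (\<lambda>k. indicator \<Omega> x *\<^sub>R h k x) \<longlonglongrightarrow> indicator \<Omega> x *\<^sub>R g x"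
      using lim by (intro AE_I2) (auto split: split_indicator)
    show "AE x in lborel. norm (indicator \<Omega> x *\<^sub>R h k x) \<le> indicator \<Omega> x *\<^sub>R w x" for k
      using le by (intro AE_I2) (auto split: split_indicator)
  qed (use measurable_continuous_dom[OF cont(1)] measurable_continuous_dom[OF cont(2)] w in \<open>auto simp: set_integrable_def\<close>)
  then show ?thesis
    unfolding avg_def set_lebesgue_integral_def by (intro tendsto_divide tendsto_const) (use vol_pos in auto)
qed

text \<open>
  Dominated convergence with majorant \<open>1 + |h| powr p'\<close>. Exponents beyond \<open>p'\<close>, which may occur for
  finitely many indices, are first cut down to \<open>p'\<close>.
\<close>

lemma nrm_right_continuous:
  assumes p: "0 < p" "p < p'" and h: "h \<in> A p'" and u: "\<And>k. p \<le> u k" "u \<longlonglongrightarrow> p"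
  shows "(\<lambda>k. nrm (u k) h) \<longlonglongrightarrow> nrm p h"
proof -
  define v where "v k = min (u k) p'" for k
  have v: "p \<le> v k" "v k \<le> p'" for k using u p by (auto simp: v_def)
  then have v0: "0 < v k" for k using p less_le_trans by blast
  have vlim: "v \<longlonglongrightarrow> p" unfolding v_def using tendsto_min[OF u(2) tendsto_const[of p']] p by simp
  have "(\<lambda>k. avg (\<lambda>x. norm (h x) powr v k)) \<longlonglongrightarrow> avg (\<lambda>x. norm (h x) powr p)"
  proof (rule avg_dominated)
    show "int_dom (\<lambda>x. 1 * 1 + 1 * norm (h x) powr p')"
      by (intro int_dom_lincomb int_dom_const bergmanD(3) h)
    show "(\<lambda>k. norm (h x) powr v k) \<longlonglongrightarrow> norm (h x) powr p" for x
      using p by (intro tendsto_powr' tendsto_const vlim) auto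
    show "\<bar>norm (h x) powr v k\<bar> \<le> 1 * 1 + 1 * norm (h x) powr p'" for k x
    proof (cases "norm (h x) \<ge> 1")
      case True
      then show ?thesis using v powr_mono[of "v k" p' "norm (h x)"] by simp
    next
      case False
      then have "norm (h x) powr v k \<le> 1" using v0[of k] powr_le1[of "v k" "norm (h x)"] by simp
      then show ?thesis by (simp add: add_increasing2)
    qed
  qed (use continuous_on_norm_powr[OF bergmanD(4)[OF h]] v0 p in auto)
  then have "(\<lambda>k. nrm (v k) h) \<longlonglongrightarrow> nrm p h"
    unfolding nrm_def using p v0 by (intro tendsto_powr' tendsto_divide tendsto_const vlim) (auto intro!: always_eventually avg_nonneg)
  moreover have "\<forall>\<^sub>F k in sequentially. nrm (v k) h = nrm (u k) h"
    using order_tendstoD(2)[OF u(2) p(2)] by eventually_elim (simp add: v_def)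
  ultimately show ?thesis by (rule Lim_transform_eventually)
qed

lemma bergman_diff:
  assumes "f \<in> A p" "g \<in> A p" "p > 0"
  shows "restrict (\<lambda>x. f x - g x) \<Omega> \<in> A p"
proof -
  have "restrict (\<lambda>x. f x + restrict (\<lambda>x. - 1 * g x) \<Omega> x) \<Omega> \<in> A p"
    by (intro bergman_add bergman_scale assms)
  moreover have "restrict (\<lambda>x. f x + restrict (\<lambda>x. - 1 * g x) \<Omega> x) \<Omega> = restrict (\<lambda>x. f x - g x) \<Omega>"
    by (auto simp: restrict_def)
  ultimately show ?thesis by simp
qed

lemma bergman_derivative_bound:
  assumes z: "z \<in> \<Omega>" and p: "p > 0"
  shows "\<exists>C\<ge>0. \<forall>f\<in>A p. \<forall>v. norm (frechet_derivative f (at z) v) \<le> C * nrm p f * norm v"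
proof -
  obtain r C where rC: "r > 0" "C \<ge> 0" "ball z r \<subseteq> \<Omega>" "\<And>f x. f \<in> A p \<Longrightarrow> x \<in> ball z r \<Longrightarrow> norm (f x) \<le> C * nrm p f"
    using bergman_local_bound[OF z p] by blast
  have "norm (frechet_derivative f (at z) v) \<le> C / r * nrm p f * norm v" if f: "f \<in> A p" for f v
    using holo_on_Cauchy_estimate[OF holo_on_subset[OF bergmanD(2)[OF f] rC(3)] rC(4)[OF f] rC(1), of v] by simp
  then show ?thesis using rC(1,2) by (intro exI[of _ "C / r"]) auto
qed

text \<open>
  Values and derivatives are controlled by the norm through the local bounds. The norms themselves are
  controlled by \<open>avg_add_powr_le\<close> with \<open>\<eta>\<close> so small that \<open>(1 + \<eta>) * nrm p f\<close> is still below \<open>c\<close>.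
\<close>

lemma
  assumes p: "p > 0" and f: "f \<in> A p" and h: "\<And>k. h k \<in> A p"
    and lim: "(\<lambda>k. nrm p (\<lambda>x. f x - h k x)) \<longlonglongrightarrow> 0"
  shows nrm_limit_pointwise: "z \<in> \<Omega> \<Longrightarrow> (\<lambda>k. h k z) \<longlonglongrightarrow> f z"
    and nrm_limit_derivative: "z \<in> \<Omega> \<Longrightarrow> (\<lambda>k. frechet_derivative (h k) (at z) v) \<longlonglongrightarrow> frechet_derivative f (at z) v"
    and nrm_limit_eventually_less: "nrm p f < c \<Longrightarrow> \<forall>\<^sub>F k in sequentially. nrm p (h k) < c"
proof -
  define d where "d k = restrict (\<lambda>x. f x - h k x) \<Omega>" for k
  have d: "d k \<in> A p" for k unfolding d_def by (intro bergman_diff f h p)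
  have dlim: "(\<lambda>k. nrm p (d k)) \<longlonglongrightarrow> 0" using lim by (simp add: d_def)
  show "(\<lambda>k. h k z) \<longlonglongrightarrow> f z" if z: "z \<in> \<Omega>"
  proof -
    obtain r C where rC: "r > 0" "\<And>f x. f \<in> A p \<Longrightarrow> x \<in> ball z r \<Longrightarrow> norm (f x) \<le> C * nrm p f"
      using bergman_local_bound[OF z p] by blast
    have "(\<lambda>k. d k z) \<longlonglongrightarrow> 0"
    proof (rule Lim_null_comparison)
      show "\<forall>\<^sub>F k in sequentially. norm (d k z) \<le> C * nrm p (d k)"
        using rC(2)[OF d] rC(1) by simp
      show "(\<lambda>k. C * nrm p (d k)) \<longlonglongrightarrow> 0" using tendsto_mult_right_zero[OF dlim] .
    qed
    then have "(\<lambda>k. f z - d k z) \<longlonglongrightarrow> f z - 0" by (intro tendsto_intros)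
    then show ?thesis using z by (simp add: d_def)
  qed
  show "(\<lambda>k. frechet_derivative (h k) (at z) v) \<longlonglongrightarrow> frechet_derivative f (at z) v" if z: "z \<in> \<Omega>"
  proof -
    obtain C where C: "\<And>f v. f \<in> A p \<Longrightarrow> norm (frechet_derivative f (at z) v) \<le> C * nrm p f * norm v"
      using bergman_derivative_bound[OF z p] by blast
    have eq: "frechet_derivative (d k) (at z) v = 1 * frechet_derivative f (at z) v + (- 1) * frechet_derivative (h k) (at z) v" for k
    proof -
      have "frechet_derivative (d k) (at z) = frechet_derivative (\<lambda>x. 1 * f x + (- 1) * h k x) (at z)"
        by (rule frechet_derivative_cong_open[OF open_dom _ z]) (simp add: d_def)
      then show ?thesis
        using frechet_derivative_lincomb[OF bergmanD(2)[OF f] bergmanD(2)[OF h] z, of 1 "- 1"] by simp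
    qed
    have "(\<lambda>k. frechet_derivative (d k) (at z) v) \<longlonglongrightarrow> 0"
    proof (rule Lim_null_comparison)
      show "\<forall>\<^sub>F k in sequentially. norm (frechet_derivative (d k) (at z) v) \<le> C * nrm p (d k) * norm v"
        using C[OF d] by simp
      show "(\<lambda>k. C * nrm p (d k) * norm v) \<longlonglongrightarrow> 0"
        by (intro tendsto_mult_left_zero tendsto_mult_right_zero dlim)
    qed
    then have "(\<lambda>k. frechet_derivative f (at z) v - frechet_derivative (d k) (at z) v) \<longlonglongrightarrow> frechet_derivative f (at z) v - 0"
      by (intro tendsto_intros)
    then show ?thesis by (simp add: eq)
  qed
  show "\<forall>\<^sub>F k in sequentially. nrm p (h k) < c" if c: "nrm p f < c"
  proof -
    have c0: "c > 0" using c nrm_nonneg[of p f] by simp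
    obtain \<eta> where \<eta>: "\<eta> > 0" "(1 + \<eta>) * nrm p f < c"
    proof
      show "(c - nrm p f) / (c + 1) > 0" using c c0 by simp
      have "(c - nrm p f) * nrm p f < (c - nrm p f) * (c + 1)"
        using c by (intro mult_strict_left_mono) auto
      then have "(c - nrm p f) / (c + 1) * nrm p f < c - nrm p f"
        using c0 by (simp add: pos_divide_less_eq)
      then show "(1 + (c - nrm p f) / (c + 1)) * nrm p f < c" by (simp add: distrib_right)
    qed
    let ?b = "\<lambda>k. ((1 + \<eta>) * nrm p f) powr p + (1 + 1 / \<eta>) powr p * nrm p (d k) powr p"
    have le: "nrm p (h k) powr p \<le> ?b k" for k
    proof -
      have "avg (\<lambda>x. norm (h k x) powr p) = avg (\<lambda>x. norm (f x + restrict (\<lambda>x. - 1 * d k x) \<Omega> x) powr p)"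
        by (intro avg_cong) (simp add: d_def)
      also have "\<dots> \<le> (1 + \<eta>) powr p * avg (\<lambda>x. norm (f x) powr p)
          + (1 + 1 / \<eta>) powr p * avg (\<lambda>x. norm (restrict (\<lambda>x. - 1 * d k x) \<Omega> x) powr p)"
        by (rule avg_add_powr_le[OF f bergman_scale[OF d] p \<eta>(1)])
      also have "avg (\<lambda>x. norm (restrict (\<lambda>x. - 1 * d k x) \<Omega> x) powr p) = avg (\<lambda>x. norm (d k x) powr p)"
        by (intro avg_cong) simp
      finally show ?thesis using \<eta>(1) nrm_nonneg[of p f] by (simp add: nrm_powr[OF p, symmetric] powr_mult)
    qed
    have "?b \<longlonglongrightarrow> ((1 + \<eta>) * nrm p f) powr p + (1 + 1 / \<eta>) powr p * 0 powr p"
      using p nrm_nonneg by (intro tendsto_intros tendsto_powr' dlim) (auto intro!: always_eventually)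
    moreover have "((1 + \<eta>) * nrm p f) powr p + (1 + 1 / \<eta>) powr p * 0 powr p < c powr p"
      using p \<eta> nrm_nonneg[of p f] by (simp add: powr_less_mono2)
    ultimately have "\<forall>\<^sub>F k in sequentially. ?b k < c powr p" by (rule order_tendstoD(2))
    then show ?thesis
    proof eventually_elim
      case (elim k)
      then have "nrm p (h k) powr p < c powr p" using le[of k] by simp
      then show ?case using p c0 powr_mono2[of p c "nrm p (h k)"] by (meson less_imp_le not_less)
    qed
  qed
qed

lemma bergman_dense_sequence:
  assumes dense: "bergman_dense \<Omega> p' p" and p: "p > 0" and f: "f \<in> A p"
  obtains h where "\<And>k. h k \<in> A p'" "(\<lambda>k. nrm p (\<lambda>x. f x - h k x)) \<longlonglongrightarrow> 0"
proof -
  have "\<exists>g\<in>A p'. Lp_norm \<Omega> p (\<lambda>x. f x - g x) < vol powr (1 / p) * (1 / real (Suc k))" for k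
    using dense f vol_pos unfolding bergman_dense_def by simp
  then obtain h where h: "\<And>k. h k \<in> A p'" "\<And>k. Lp_norm \<Omega> p (\<lambda>x. f x - h k x) < vol powr (1 / p) * (1 / real (Suc k))"
    by metis
  have le: "nrm p (\<lambda>x. f x - h k x) < 1 / real (Suc k)" for k
    using h(2)[of k] vol_pos unfolding Lp_norm_eq_nrm[OF p] by (simp only: mult_less_cancel_left_pos powr_gt_zero)
  have "(\<lambda>k. nrm p (\<lambda>x. f x - h k x)) \<longlonglongrightarrow> 0"
  proof (rule Lim_null_comparison)
    show "\<forall>\<^sub>F k in sequentially. norm (nrm p (\<lambda>x. f x - h k x)) \<le> 1 / real (Suc k)"
      using le nrm_nonneg by (intro always_eventually) (auto simp: less_imp_le)
    show "(\<lambda>k. 1 / real (Suc k)) \<longlonglongrightarrow> 0"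
      using LIMSEQ_inverse_real_of_nat by (simp add: inverse_eq_divide)
  qed
  with that h(1) show thesis by blast
qed

text \<open>
  An element of the dense subspace close to the minimizer for \<open>p\<close>, divided by its value at \<open>w\<close>, is a
  competitor for all exponents up to \<open>p'\<close>; its norm is close to \<open>mu p w\<close> for exponent \<open>p\<close>, hence also for
  exponents slightly larger.
\<close>

theorem mu_right_continuous:
  assumes dense: "bergman_dense \<Omega> p' p" and p: "0 < p" "p < p'" and w: "w \<in> \<Omega>"
    and u: "\<And>k. p \<le> u k" "u \<longlonglongrightarrow> p"
  shows "(\<lambda>k. mu (u k) w) \<longlonglongrightarrow> mu p w"
proof (rule order_tendstoI)
  fix a assume "a < mu p w"
  then show "\<forall>\<^sub>F k in sequentially. a < mu (u k) w"
    using mu_mono[OF p(1) u(1) w] less_le_trans by (intro always_eventually) blast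
next
  fix a assume a: "mu p w < a"
  obtain f where f: "f \<in> A p" "f w = 1" "nrm p f = mu p w"
    using minimizer_exists[OF p(1) w] by (auto simp: minimizer_def)
  obtain h where h: "\<And>k. h k \<in> A p'" and lim: "(\<lambda>k. nrm p (\<lambda>x. f x - h k x)) \<longlonglongrightarrow> 0"
    using bergman_dense_sequence[OF dense p(1) f(1)] by blast
  have hp: "h k \<in> A p" for k using bergman_mono[OF h] p by simp
  obtain c where c: "mu p w < c" "c < a" using dense_order_class.dense[OF a] by blast
  have c0: "c > 0" using c mu_pos[OF p(1) w] by simp
  have "(\<lambda>k. norm (h k w)) \<longlonglongrightarrow> norm (f w)"
    by (intro tendsto_norm nrm_limit_pointwise[OF p(1) f(1) hp lim w])
  moreover have "c / a < norm (f w)" using c c0 f by simp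
  ultimately have "\<forall>\<^sub>F k in sequentially. c / a < norm (h k w)" by (rule order_tendstoD(1))
  moreover have "\<forall>\<^sub>F k in sequentially. nrm p (h k) < c"
    using nrm_limit_eventually_less[OF p(1) f(1) hp lim] c f by simp
  ultimately have "\<forall>\<^sub>F k in sequentially. c / a < norm (h k w) \<and> nrm p (h k) < c"
    by (rule eventually_conj)
  then obtain k where k: "c / a < norm (h k w)" "nrm p (h k) < c"
    using eventually_happens'[OF sequentially_bot] by blast
  have a0: "a > 0" using c c0 by simp
  have hw: "norm (h k w) > 0" using k(1) c0 a0 by (meson divide_pos_pos less_trans)
  define g where "g = restrict (\<lambda>x. inverse (h k w) * h k x) \<Omega>"
  have g: "g \<in> A p'" "g w = 1" using bergman_scale[OF h] hw w by (auto simp: g_def)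
  have "nrm p g = nrm p (h k) / norm (h k w)"
    by (simp add: g_def nrm_scale[OF p(1)] norm_inverse divide_inverse)
  also have "\<dots> < a"
  proof -
    have "c < a * norm (h k w)" using k(1) a0 by (simp add: pos_divide_less_eq mult.commute)
    then show ?thesis using k(2) hw by (simp add: pos_divide_less_eq)
  qed
  finally have "nrm p g < a" .
  then have "\<forall>\<^sub>F j in sequentially. nrm (u j) g < a"
    using order_tendstoD(2)[OF nrm_right_continuous[OF p g(1) u]] by blast
  moreover have "\<forall>\<^sub>F j in sequentially. u j < p'" using order_tendstoD(2)[OF u(2) p(2)] .
  ultimately show "\<forall>\<^sub>F j in sequentially. mu (u j) w < a"
  proof eventually_elim
    case (elim j)
    have u0: "0 < u j" using p(1) u(1)[of j] by linarith
    have "g \<in> A (u j)" using bergman_mono[OF g(1) u0] elim by simp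
    from mu_le[OF u0 this g(2)] show ?case using elim by simp
  qed
qed

lemma mu_at_right_limit:
  assumes p: "p > 0" and w: "w \<in> \<Omega>"
  shows "\<exists>L\<ge>mu p w. ((\<lambda>s. mu s w) \<longlongrightarrow> L) (at_right p)"
  by (rule mono_tendsto_at_right[of p "p + 1"]) (use p w in \<open>auto intro!: mu_mono\<close>)

lemma mu_at_left:
  assumes p: "p > 0" and w: "w \<in> \<Omega>"
  shows "((\<lambda>s. mu s w) \<longlongrightarrow> mu p w) (at_left p)"
  by (rule tendsto_at_left_if_sequences[OF p])
    (auto intro!: mu_left_continuous[OF p w] simp: less_imp_le)

lemma mu_at_right_dense:
  assumes "bergman_dense \<Omega> p' p" "0 < p" "p < p'" "w \<in> \<Omega>"
  shows "((\<lambda>s. mu s w) \<longlongrightarrow> mu p w) (at_right p)"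
  by (rule tendsto_at_right_if_sequences)
    (auto intro!: mu_right_continuous[OF assms] simp: less_imp_le)

section \<open>The extremal derivative\<close>

text \<open>
  The factor turns the constraint \<open>Lp_norm \<Omega> p f = 1\<close> into \<open>nrm p f = 1\<close>, and it cancels against the
  factor in \<open>mu\<close> when the two are multiplied.
\<close>

definition tau :: "real \<Rightarrow> complex ^ 'n \<Rightarrow> complex ^ 'n \<Rightarrow> real" where
  "tau p z X = vol powr (1 / p) *
     Sup {norm (dir_deriv X f z) | f. f \<in> A p \<and> f z = 0 \<and> Lp_norm \<Omega> p f = 1}"

text \<open>
  A coordinate function, shifted to vanish at \<open>z\<close>. It makes the set under the supremum in \<open>tau\<close> nonempty.
\<close>

lemma bergman_nontrivial_vanishing:
  assumes p: "p > 0" and z: "z \<in> \<Omega>"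
  shows "\<exists>f\<in>A p. f z = 0 \<and> nrm p f > 0"
proof -
  fix j :: 'n
  define f where "f = (\<lambda>x :: complex ^ 'n. 1 * x $ j + (- z $ j) * 1)"
  have hol: "holo_on f \<Omega>" unfolding f_def by (intro holo_on_lincomb holo_on_component holo_on_const)
  obtain M where M: "\<And>x. x \<in> \<Omega> \<Longrightarrow> norm x \<le> M" using bounded_dom unfolding bounded_iff by blast
  have "int_dom (\<lambda>x. norm (f x) powr p)"
  proof (rule int_dom_bound[OF int_dom_const[of "(M + norm z) powr p"]])
    show "continuous_on \<Omega> (\<lambda>x. norm (f x) powr p)"
      by (intro continuous_on_norm_powr holo_on_continuous_on hol p)
    fix x assume x: "x \<in> \<Omega>"
    have "norm (f x) \<le> norm (x $ j) + norm (z $ j)" unfolding f_def using norm_triangle_ineq4 by simp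
    also have "\<dots> \<le> M + norm z" using M[OF x] Finite_Cartesian_Product.norm_nth_le[of x j] Finite_Cartesian_Product.norm_nth_le[of z j] by linarith
    finally show "\<bar>norm (f x) powr p\<bar> \<le> (M + norm z) powr p" using p by (simp add: powr_mono2)
  qed
  then have fA: "restrict f \<Omega> \<in> A p" by (rule bergman_restrictI[OF hol])
  have "nrm p (restrict f \<Omega>) \<noteq> 0"
  proof
    assume "nrm p (restrict f \<Omega>) = 0"
    then have 0: "avg (\<lambda>x. norm (restrict f \<Omega> x) powr p) \<le> 0" using nrm_powr[OF p, of "restrict f \<Omega>"] by simp
    obtain r where r: "r > 0" "ball z r \<subseteq> \<Omega>" using open_dom z open_contains_ball by blast
    define y where "y = z + axis j (of_real (r / 2))"
    have "norm (axis j c :: complex ^ 'n) = norm c" for c :: complex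
      by (simp only: norm_eq_sqrt_inner inner_axis_axis refl if_True)
    then have "norm (axis j (complex_of_real (r / 2)) :: complex ^ 'n) = r / 2" using r by simp
    then have "y \<in> ball z r" using r by (simp add: y_def dist_norm)
    then have y: "y \<in> \<Omega>" using r by blast
    have "norm (restrict f \<Omega> y) powr p = 0"
      by (rule avg_eq_0_imp_0[OF bergmanD(3)[OF fA] continuous_on_norm_powr[OF bergmanD(4)[OF fA] p] _ 0 y]) simp
    then show False using y r p by (simp add: f_def y_def axis_def)
  qed
  then show ?thesis using fA z nrm_nonneg[of p "restrict f \<Omega>"] by (intro bexI[of _ "restrict f \<Omega>"]) (auto simp: f_def)
qed

text \<open>
  Scaling to norm one reduces both properties to the definition of the supremum; functions of norm zero
  cannot be scaled, but for them the derivative bound gives derivative zero.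
\<close>

lemma
  assumes p: "p > 0" and z: "z \<in> \<Omega>"
  shows tau_upper: "f \<in> A p \<Longrightarrow> f z = 0 \<Longrightarrow> norm (frechet_derivative f (at z) X) \<le> tau p z X * nrm p f"
    and tau_approx: "c < tau p z X \<Longrightarrow> \<exists>f\<in>A p. f z = 0 \<and> nrm p f \<le> 1 \<and> c < norm (frechet_derivative f (at z) X)"
    and tau_nonneg: "tau p z X \<ge> 0"
proof -
  define S where "S = {norm (dir_deriv X f z) | f. f \<in> A p \<and> f z = 0 \<and> Lp_norm \<Omega> p f = 1}"
  define V where "V = vol powr (1 / p)"
  have V: "V > 0" using vol_pos by (simp add: V_def)
  have tau: "tau p z X = V * Sup S" by (simp add: tau_def S_def V_def)
  have Lp: "Lp_norm \<Omega> p f = V * nrm p f" for f by (simp add: Lp_norm_eq_nrm[OF p] V_def)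
  have D: "dir_deriv X f z = frechet_derivative f (at z) X" if "f \<in> A p" for f
    using dir_deriv_eq_frechet[OF bergmanD(2)[OF that] z] .
  have scaled: "restrict (\<lambda>x. c * f x) \<Omega> \<in> A p" "restrict (\<lambda>x. c * f x) \<Omega> z = 0"
    "nrm p (restrict (\<lambda>x. c * f x) \<Omega>) = norm c * nrm p f"
    "frechet_derivative (restrict (\<lambda>x. c * f x) \<Omega>) (at z) X = c * frechet_derivative f (at z) X"
    if f: "f \<in> A p" "f z = 0" for f c
  proof -
    have "frechet_derivative (restrict (\<lambda>x. c * f x) \<Omega>) (at z) = frechet_derivative (\<lambda>x. c * f x + 0 * f x) (at z)"
      by (rule frechet_derivative_cong_open[OF open_dom _ z]) simp
    then show "frechet_derivative (restrict (\<lambda>x. c * f x) \<Omega>) (at z) X = c * frechet_derivative f (at z) X"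
      using frechet_derivative_lincomb[OF bergmanD(2)[OF f(1)] bergmanD(2)[OF f(1)] z, of c 0] by simp
  qed (use f z bergman_scale[OF f(1)] nrm_scale[OF p] in auto)
  obtain C where C: "\<And>f v. f \<in> A p \<Longrightarrow> norm (frechet_derivative f (at z) v) \<le> C * nrm p f * norm v"
    using bergman_derivative_bound[OF z p] by blast
  have bdd: "bdd_above S"
  proof (rule bdd_aboveI[of _ "C * (1 / V) * norm X"])
    fix y assume "y \<in> S"
    then obtain f where f: "f \<in> A p" "f z = 0" "V * nrm p f = 1" "y = norm (frechet_derivative f (at z) X)"
      unfolding S_def Lp using D by auto
    then have "nrm p f = 1 / V" using V by (simp add: field_simps)
    then show "y \<le> C * (1 / V) * norm X" using C[OF f(1)] f(4) by metis
  qed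
  have memS: "norm (frechet_derivative f (at z) X) / (V * nrm p f) \<in> S" if f: "f \<in> A p" "f z = 0" "nrm p f > 0" for f
  proof -
    define g where "g = restrict (\<lambda>x. of_real (1 / (V * nrm p f)) * f x) \<Omega>"
    note g = scaled[OF f(1,2), of "of_real (1 / (V * nrm p f))", folded g_def]
    have "Lp_norm \<Omega> p g = 1" unfolding Lp g(3) using V f(3) by (simp add: norm_divide norm_mult)
    moreover have "norm (dir_deriv X g z) = norm (frechet_derivative f (at z) X) / (V * nrm p f)"
      unfolding D[OF g(1)] g(4) using V f(3) by (simp add: norm_mult norm_divide)
    ultimately show ?thesis using g(1,2) unfolding S_def by force
  qed
  obtain f0 where f0: "f0 \<in> A p" "f0 z = 0" "nrm p f0 > 0" using bergman_nontrivial_vanishing[OF p z] by blast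
  have ne: "S \<noteq> {}" using memS[OF f0] by blast
  have S0: "0 \<le> Sup S"
    using cSup_upper[OF memS[OF f0] bdd] V f0(3) by (smt (verit) divide_nonneg_nonneg mult_nonneg_nonneg norm_ge_zero)
  then show "tau p z X \<ge> 0" using V tau by simp
  show "norm (frechet_derivative f (at z) X) \<le> tau p z X * nrm p f" if f: "f \<in> A p" "f z = 0"
  proof (cases "nrm p f > 0")
    case True
    have "norm (frechet_derivative f (at z) X) / (V * nrm p f) \<le> Sup S"
      using cSup_upper[OF memS[OF f True] bdd] .
    then show ?thesis using V True by (simp add: tau pos_divide_le_eq algebra_simps)
  next
    case False
    then have "nrm p f = 0" using nrm_nonneg[of p f] by simp
    then show ?thesis using C[OF f(1), of X] by simp
  qed
  show "\<exists>f\<in>A p. f z = 0 \<and> nrm p f \<le> 1 \<and> c < norm (frechet_derivative f (at z) X)" if c: "c < tau p z X"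
  proof -
    have "c / V < Sup S" using c V by (simp add: tau pos_divide_less_eq mult.commute)
    then obtain y where "y \<in> S" "c / V < y" using less_cSupD[OF ne] by blast
    then obtain f where f: "f \<in> A p" "f z = 0" "V * nrm p f = 1" "c / V < norm (frechet_derivative f (at z) X)"
      unfolding S_def Lp using D by auto
    note g = scaled[OF f(1,2), of "of_real V"]
    have "c < norm (of_real V * frechet_derivative f (at z) X)"
      using f(4) V by (simp add: norm_mult pos_divide_less_eq mult.commute)
    then show ?thesis using g f(3) V by (intro bexI[OF _ g(1)]) auto
  qed
qed

lemma B_metric_eq:
  assumes p: "p > 0" and z: "z \<in> \<Omega>"
  shows "B_metric \<Omega> p z X = mu p z * tau p z X"
proof -
  have "m_val \<Omega> p z > 0" using mu_pos[OF p z] vol_pos by (simp add: m_val_eq_mu)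
  then have "K_diag \<Omega> p z powr (- 1 / p) = m_val \<Omega> p z"
    using p by (simp add: K_diag_def powr_powr)
  then show ?thesis by (simp add: B_metric_def tau_def m_val_eq_mu)
qed

lemma tau_antimono:
  assumes "0 < s" "s \<le> t" "z \<in> \<Omega>"
  shows "tau t z X \<le> tau s z X"
proof (rule ccontr)
  assume "\<not> tau t z X \<le> tau s z X"
  then obtain f where f: "f \<in> A t" "f z = 0" "nrm t f \<le> 1" "tau s z X < norm (frechet_derivative f (at z) X)"
    using tau_approx[of t z "tau s z X" X] assms by auto
  have "norm (frechet_derivative f (at z) X) \<le> tau s z X * nrm s f"
    by (rule tau_upper[OF assms(1,3) bergman_mono[OF f(1) assms(1,2)] f(2)])
  also have "\<dots> \<le> tau s z X * 1"
    using nrm_mono[OF f(1) assms(1,2)] f(3) tau_nonneg[OF assms(1,3)] by (intro mult_left_mono) auto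
  finally show False using f(4) by simp
qed

text \<open>
  The left limit exists by monotonicity and is at least the value. Nearly extremal functions for
  exponents increasing to \<open>p\<close> have a limit that competes for \<open>p\<close>, and their derivatives converge, so the
  left limit is at most the value.
\<close>

theorem tau_at_left:
  assumes p: "p > 0" and z: "z \<in> \<Omega>"
  shows "((\<lambda>s. tau s z X) \<longlongrightarrow> tau p z X) (at_left p)"
proof -
  have "\<exists>L\<ge>tau p z X. ((\<lambda>x. tau (- x) z X) \<longlongrightarrow> L) (at_right (- p))"
    by (rule mono_tendsto_at_right[of "- p" 0]) (use p z in \<open>auto intro!: tau_antimono\<close>)
  then obtain L where L: "L \<ge> tau p z X" "((\<lambda>s. tau s z X) \<longlongrightarrow> L) (at_left p)"
    unfolding filterlim_at_left_to_right[of _ _ p] by auto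
  define u where "u k = p - p / real (Suc (Suc k))" for k
  have u: "0 < u k" "u k < p" for k
  proof -
    have "p / real (Suc (Suc k)) \<le> p / 2" using p by (intro divide_left_mono) auto
    moreover have "0 < p / real (Suc (Suc k))" using p by simp
    ultimately show "0 < u k" "u k < p" using p unfolding u_def by linarith+
  qed
  have ulim: "u \<longlonglongrightarrow> p"
  proof -
    have "(\<lambda>k. p - p * inverse (real (Suc (Suc k)))) \<longlonglongrightarrow> p - p * 0"
      by (intro tendsto_intros LIMSEQ_Suc[OF LIMSEQ_inverse_real_of_nat])
    then show ?thesis by (simp add: u_def[abs_def] divide_inverse)
  qed
  have tauL: "(\<lambda>k. tau (u k) z X) \<longlonglongrightarrow> L"
    using L(2) u ulim unfolding tendsto_at_iff_sequentially by (auto simp: o_def)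
  have "\<exists>f\<in>A (u k). f z = 0 \<and> nrm (u k) f \<le> 1 \<and> tau (u k) z X - 1 / real (Suc k) < norm (frechet_derivative f (at z) X)" for k
    by (rule tau_approx[OF u(1) z]) simp
  then obtain f where f: "\<And>k. f k \<in> A (u k)" "\<And>k. f k z = 0" "\<And>k. nrm (u k) (f k) \<le> 1"
    "\<And>k. tau (u k) z X - 1 / real (Suc k) < norm (frechet_derivative (f k) (at z) X)" by metis
  obtain \<phi> :: "nat \<Rightarrow> nat" and g where \<phi>: "strict_mono \<phi>" and g: "g \<in> A p" "nrm p g \<le> 1"
    and lim: "\<And>x. x \<in> \<Omega> \<Longrightarrow> (\<lambda>k. f (\<phi> k) x) \<longlonglongrightarrow> g x"
    and lim': "\<And>x v. x \<in> \<Omega> \<Longrightarrow> (\<lambda>k. frechet_derivative (f (\<phi> k)) (at x) v) \<longlonglongrightarrow> frechet_derivative g (at x) v"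
    using bergman_compactness[OF p ulim f(1) f(3) tendsto_const] by blast
  have gz: "g z = 0" using LIMSEQ_unique[OF lim[OF z]] f(2) by auto
  have "(\<lambda>k. tau (u k) z X - inverse (real (Suc k))) \<longlonglongrightarrow> L - 0"
    by (intro tendsto_intros tauL LIMSEQ_inverse_real_of_nat)
  from LIMSEQ_strict_mono_subsequence[OF this \<phi>]
  have "L \<le> norm (frechet_derivative g (at z) X)"
    using f(4) by (intro LIMSEQ_le[OF _ tendsto_norm[OF lim'[OF z]]]) (auto simp: inverse_eq_divide less_imp_le)
  also have "\<dots> \<le> tau p z X * nrm p g" by (rule tau_upper[OF p z g(1) gz])
  also have "\<dots> \<le> tau p z X * 1" using g(2) tau_nonneg[OF p z] by (intro mult_left_mono) auto
  finally have "L = tau p z X" using L(1) by simp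
  with L(2) show ?thesis by simp
qed

lemma tau_at_right_limit:
  assumes p: "p > 0" and z: "z \<in> \<Omega>"
  shows "\<exists>L. ((\<lambda>s. tau s z X) \<longlongrightarrow> L) (at_right p)"
proof -
  have "\<exists>L\<ge>- tau p z X. ((\<lambda>s. - tau s z X) \<longlongrightarrow> L) (at_right p)"
    by (rule mono_tendsto_at_right[of p "p + 1"]) (use p z in \<open>auto intro!: tau_antimono\<close>)
  then show ?thesis using tendsto_minus_cancel_left by blast
qed

text \<open>
  Functions in the dense subspace that vanish at \<open>z\<close> satisfy the extremal inequality with the right
  limit \<open>L\<close> in place of \<open>tau p z X\<close>. Approximating an arbitrary function that vanishes at \<open>z\<close> extends
  this to the whole space and gives \<open>tau p z X \<le> L\<close>.
\<close>

theorem tau_at_right_dense: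
  assumes dense: "bergman_dense \<Omega> p' p" and p: "0 < p" "p < p'" and z: "z \<in> \<Omega>"
  shows "((\<lambda>s. tau s z X) \<longlongrightarrow> tau p z X) (at_right p)"
proof -
  obtain L where L: "((\<lambda>s. tau s z X) \<longlongrightarrow> L) (at_right p)" using tau_at_right_limit[OF p(1) z] by blast
  define u where "u k = p + (p' - p) / real (Suc k)" for k
  have u: "p < u k" "u k \<le> p'" for k
  proof -
    define d where "d = (p' - p) / real (Suc k)"
    have "d \<le> (p' - p) / 1" unfolding d_def using p by (intro divide_left_mono) auto
    moreover have "0 < d" unfolding d_def using p by simp
    ultimately show "p < u k" "u k \<le> p'" unfolding u_def d_def[symmetric] by simp_all
  qed
  have u0: "0 < u k" for k using u(1)[of k] p(1) by linarith
  have ulim: "u \<longlonglongrightarrow> p"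
  proof -
    have "(\<lambda>k. p + (p' - p) * inverse (real (Suc k))) \<longlonglongrightarrow> p + (p' - p) * 0"
      by (intro tendsto_intros LIMSEQ_inverse_real_of_nat)
    then show ?thesis by (simp add: u_def[abs_def] divide_inverse)
  qed
  have tauL: "(\<lambda>k. tau (u k) z X) \<longlonglongrightarrow> L" by (rule tendsto_sequence_at_right[OF L u(1) ulim])
  have L0: "0 \<le> L" using LIMSEQ_le_const[OF tauL] tau_nonneg[OF u0 z] by blast
  have Lle: "L \<le> tau p z X" using LIMSEQ_le_const2[OF tauL] tau_antimono[OF p(1) _ z] u(1) by (meson less_imp_le)
  have key: "norm (frechet_derivative h (at z) X) \<le> L * nrm p h" if h: "h \<in> A p'" "h z = 0" for h
  proof (rule LIMSEQ_le_const)
    show "(\<lambda>k. tau (u k) z X * nrm (u k) h) \<longlonglongrightarrow> L * nrm p h"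
      by (intro tendsto_mult tauL nrm_right_continuous[OF p h(1)] ulim less_imp_le u)
    show "\<exists>N. \<forall>n\<ge>N. norm (frechet_derivative h (at z) X) \<le> tau (u n) z X * nrm (u n) h"
      using tau_upper[OF u0 z bergman_mono[OF h(1) u0 u(2)] h(2)] by blast
  qed
  have "tau p z X \<le> L"
  proof (rule ccontr)
    assume "\<not> tau p z X \<le> L"
    then obtain f where f: "f \<in> A p" "f z = 0" "nrm p f \<le> 1" "L < norm (frechet_derivative f (at z) X)"
      using tau_approx[OF p(1) z, of L X] by auto
    obtain h0 where h0: "\<And>k. h0 k \<in> A p'" and lim0: "(\<lambda>k. nrm p (\<lambda>x. f x - h0 k x)) \<longlonglongrightarrow> 0"
      using bergman_dense_sequence[OF dense p(1) f(1)] by blast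
    have h0p: "h0 k \<in> A p" for k using bergman_mono[OF h0] p by simp
    have p'0: "p' > 0" using p by simp
    \<comment> \<open>the approximants need not vanish at z; subtracting their values there costs little since these tend to 0\<close>
    define c where "c k = restrict (\<lambda>x. h0 k z) \<Omega>" for k
    have cA: "c k \<in> A q" for k q unfolding c_def by (rule bergman_const)
    define h where "h k = restrict (\<lambda>x. h0 k x - c k x) \<Omega>" for k
    have h: "h k \<in> A p'" "h k z = 0" for k
      unfolding h_def using z by (auto intro!: bergman_diff h0 cA p'0) (simp add: c_def)
    have hp: "h k \<in> A p" for k using bergman_mono[OF h(1)] p by simp
    have lim: "(\<lambda>k. nrm p (\<lambda>x. f x - h k x)) \<longlonglongrightarrow> 0"
    proof -
      let ?b = "\<lambda>k. (1 + 1) powr p * nrm p (\<lambda>x. f x - h0 k x) powr p + (1 + 1 / 1) powr p * norm (h0 k z) powr p"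
      have le: "nrm p (\<lambda>x. f x - h k x) powr p \<le> ?b k" for k
      proof -
        have "nrm p (\<lambda>x. f x - h k x) powr p = avg (\<lambda>x. norm (restrict (\<lambda>x. f x - h0 k x) \<Omega> x + c k x) powr p)"
          unfolding nrm_powr[OF p(1)] by (intro avg_cong) (simp add: h_def c_def algebra_simps)
        also have "\<dots> \<le> (1 + 1) powr p * avg (\<lambda>x. norm (restrict (\<lambda>x. f x - h0 k x) \<Omega> x) powr p)
           + (1 + 1 / 1) powr p * avg (\<lambda>x. norm (c k x) powr p)"
          by (intro avg_add_powr_le bergman_diff f(1) h0p cA p(1)) simp
        also have "avg (\<lambda>x. norm (restrict (\<lambda>x. f x - h0 k x) \<Omega> x) powr p) = nrm p (\<lambda>x. f x - h0 k x) powr p"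
          by (simp only: nrm_powr[OF p(1), symmetric] nrm_restrict)
        also have "avg (\<lambda>x. norm (c k x) powr p) = avg (\<lambda>x. norm (h0 k z) powr p)"
          by (intro avg_cong) (simp add: c_def)
        also have "\<dots> = norm (h0 k z) powr p" by (rule avg_const)
        finally show ?thesis .
      qed
      have "?b \<longlonglongrightarrow> (1 + 1) powr p * 0 powr p + (1 + 1 / 1) powr p * norm (f z) powr p"
        using p(1) nrm_nonneg
        by (intro tendsto_intros tendsto_powr' lim0 nrm_limit_pointwise[OF p(1) f(1) h0p lim0 z])
          (auto intro!: always_eventually)
      then have "?b \<longlonglongrightarrow> 0" using f(2) p(1) by simp
      then have "(\<lambda>k. nrm p (\<lambda>x. f x - h k x) powr p) \<longlonglongrightarrow> 0"
        by (rule Lim_null_comparison[rotated]) (use le in auto)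
      then have "(\<lambda>k. (nrm p (\<lambda>x. f x - h k x) powr p) powr (1 / p)) \<longlonglongrightarrow> 0 powr (1 / p)"
        using p(1) by (intro tendsto_powr' tendsto_const) auto
      then show ?thesis using p(1) nrm_nonneg by (simp add: powr_powr)
    qed
    \<comment> \<open>the norms of the approximants are only eventually below a number larger than 1\<close>
    obtain e where e: "e > 1" "L * e < norm (frechet_derivative f (at z) X)"
    proof -
      let ?d = "norm (frechet_derivative f (at z) X) - L"
      have d: "?d > 0" using f(4) by simp
      have "L * (?d / (L + 1)) < ?d"
      proof -
        have "L * ?d < ?d * (L + 1)" using d by (simp add: algebra_simps)
        then show ?thesis using L0 by (simp add: pos_divide_less_eq add_nonneg_pos)
      qed
      then have "L * (1 + ?d / (L + 1)) < norm (frechet_derivative f (at z) X)" by (simp add: distrib_left)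
      moreover have "1 + ?d / (L + 1) > 1" using d L0 by simp
      ultimately show thesis using that by blast
    qed
    have "\<forall>\<^sub>F k in sequentially. nrm p (h k) < e"
      by (rule nrm_limit_eventually_less[OF p(1) f(1) hp lim]) (use f(3) e(1) in simp)
    then have "\<forall>\<^sub>F k in sequentially. norm (frechet_derivative (h k) (at z) X) \<le> L * e"
    proof eventually_elim
      case (elim k)
      then show ?case using key[OF h(1,2)] mult_left_mono[of "nrm p (h k)" e L] L0 by (meson less_imp_le order_trans)
    qed
    then have "norm (frechet_derivative f (at z) X) \<le> L * e"
      by (rule tendsto_upperbound[OF tendsto_norm[OF nrm_limit_derivative[OF p(1) f(1) hp lim z]]]) simp
    then show False using e(2) by simp
  qed
  then show ?thesis using L Lle by simp
qed

section \<open>One-sided limits of minimizers, kernels and metrics\<close>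

text \<open>
  The strict bound \<open>p > 1\<close> leaves room for exponents below \<open>p\<close> for which minimizers are unique.
\<close>

lemma m_fun_at_left:
  assumes p: "p > 1" and z: "z \<in> \<Omega>" and w: "w \<in> \<Omega>"
  shows "((\<lambda>s. m_fun \<Omega> s z w) \<longlongrightarrow> m_fun \<Omega> p z w) (at_left p)"
proof -
  have "\<exists>l. \<forall>u. (\<forall>k. u k \<in> {1<..p}) \<longrightarrow> u \<longlonglongrightarrow> p \<longrightarrow> (\<lambda>k. m_fun \<Omega> (u k) z w) \<longlonglongrightarrow> l"
  proof (rule minimizer_limit[OF _ w z, where e = "\<lambda>_. p" and L = "mu p w"])
    fix u :: "nat \<Rightarrow> real" assume u: "\<And>k. u k \<in> {1<..p}" "u \<longlonglongrightarrow> p"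
    have "0 < u k" "u k \<le> p" for k using u(1)[of k] by auto
    then show "(\<lambda>k. mu (u k) w) \<longlonglongrightarrow> mu p w" using p u(2) by (intro mu_left_continuous w) auto
  qed (use p in auto)
  then obtain l where l: "\<And>u. (\<And>k. u k \<in> {1<..p}) \<Longrightarrow> u \<longlonglongrightarrow> p \<Longrightarrow> (\<lambda>k. m_fun \<Omega> (u k) z w) \<longlonglongrightarrow> l"
    by blast
  have "m_fun \<Omega> p z w = l" using l[of "\<lambda>_. p"] p LIMSEQ_const_iff by auto
  then show ?thesis using l by (intro tendsto_at_left_if_sequences[OF p]) (auto simp: less_imp_le)
qed

lemma m_fun_at_right_limit:
  assumes p: "p \<ge> 1" and z: "z \<in> \<Omega>" and w: "w \<in> \<Omega>"
  shows "\<exists>l. ((\<lambda>s. m_fun \<Omega> s z w) \<longlongrightarrow> l) (at_right p)"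
proof -
  obtain L where L: "((\<lambda>s. mu s w) \<longlongrightarrow> L) (at_right p)" using mu_at_right_limit[OF _ w, of p] p by auto
  have "\<exists>l. \<forall>u. (\<forall>k. u k \<in> {p<..}) \<longrightarrow> u \<longlonglongrightarrow> p \<longrightarrow> (\<lambda>k. m_fun \<Omega> (u k) z w) \<longlonglongrightarrow> l"
  proof (rule minimizer_limit[OF p w z, where e = "\<lambda>k. p + inverse (real (Suc k))" and L = L])
    show "(\<lambda>k. p + inverse (real (Suc k))) \<longlonglongrightarrow> p"
      using tendsto_add[OF tendsto_const LIMSEQ_inverse_real_of_nat] by simp
  qed (use p tendsto_sequence_at_right[OF L] in auto)
  then obtain l where "\<And>u. (\<And>k. u k \<in> {p<..}) \<Longrightarrow> u \<longlonglongrightarrow> p \<Longrightarrow> (\<lambda>k. m_fun \<Omega> (u k) z w) \<longlonglongrightarrow> l"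
    by blast
  then have "((\<lambda>s. m_fun \<Omega> s z w) \<longlongrightarrow> l) (at_right p)" by (intro tendsto_at_right_if_sequences) auto
  then show ?thesis by blast
qed

lemma m_fun_at_right_dense:
  assumes dense: "bergman_dense \<Omega> p' p" "p < p'" and p: "p \<ge> 1" and z: "z \<in> \<Omega>" and w: "w \<in> \<Omega>"
  shows "((\<lambda>s. m_fun \<Omega> s z w) \<longlongrightarrow> m_fun \<Omega> p z w) (at_right p)"
proof -
  have "\<exists>l. \<forall>u. (\<forall>k. u k \<in> {p..}) \<longrightarrow> u \<longlonglongrightarrow> p \<longrightarrow> (\<lambda>k. m_fun \<Omega> (u k) z w) \<longlonglongrightarrow> l"
  proof (rule minimizer_limit[OF p w z, where e = "\<lambda>_. p" and L = "mu p w"])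
    fix u :: "nat \<Rightarrow> real" assume "\<And>k. u k \<in> {p..}" "u \<longlonglongrightarrow> p"
    then show "(\<lambda>k. mu (u k) w) \<longlonglongrightarrow> mu p w" using p by (intro mu_right_continuous[OF dense(1) _ dense(2) w]) auto
  qed (use p in auto)
  then obtain l where l: "\<And>u. (\<And>k. u k \<in> {p..}) \<Longrightarrow> u \<longlonglongrightarrow> p \<Longrightarrow> (\<lambda>k. m_fun \<Omega> (u k) z w) \<longlonglongrightarrow> l"
    by blast
  have "m_fun \<Omega> p z w = l" using l[of "\<lambda>_. p"] LIMSEQ_const_iff by auto
  then show ?thesis using l by (intro tendsto_at_right_if_sequences) (auto simp: less_imp_le)
qed

lemma K_diag_eq:
  assumes "s > 0" "w \<in> \<Omega>"
  shows "K_diag \<Omega> s w = inverse vol * mu s w powr (- s)"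
  using assms vol_pos mu_pos[OF assms] by (simp add: K_diag_def m_val_eq_mu powr_mult powr_powr powr_neg_one inverse_eq_divide)

lemma K_off_tendsto:
  assumes m: "((\<lambda>s. m_fun \<Omega> s z w) \<longlongrightarrow> l) F" and mu: "((\<lambda>s. mu s w) \<longlongrightarrow> L) F" and L: "L > 0"
    and id: "((\<lambda>s. s) \<longlongrightarrow> p) F" and pos: "p > 0" and w: "w \<in> \<Omega>"
  shows "((\<lambda>s. K_off \<Omega> s z w) \<longlongrightarrow> l * of_real (inverse vol * L powr (- p))) F"
proof -
  have "((\<lambda>s. m_fun \<Omega> s z w * of_real (inverse vol * mu s w powr (- s))) \<longlongrightarrow> l * of_real (inverse vol * L powr (- p))) F"
    using L by (intro tendsto_intros m mu id) auto
  moreover have "\<forall>\<^sub>F s in F. m_fun \<Omega> s z w * of_real (inverse vol * mu s w powr (- s)) = K_off \<Omega> s z w"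
    using order_tendstoD(1)[OF id pos] by eventually_elim (simp add: K_off_def K_diag_eq[OF _ w])
  ultimately show ?thesis by (rule Lim_transform_eventually)
qed

lemma K_off_eq: "p > 0 \<Longrightarrow> w \<in> \<Omega> \<Longrightarrow> K_off \<Omega> p z w = m_fun \<Omega> p z w * of_real (inverse vol * mu p w powr (- p))"
  by (simp add: K_off_def K_diag_eq)

lemma B_metric_tendsto:
  assumes mu: "((\<lambda>s. mu s z) \<longlongrightarrow> L) F" and tau: "((\<lambda>s. tau s z X) \<longlongrightarrow> T) F"
    and id: "((\<lambda>s. s) \<longlongrightarrow> p) F" and pos: "p > 0" and z: "z \<in> \<Omega>"
  shows "((\<lambda>s. B_metric \<Omega> s z X) \<longlongrightarrow> L * T) F"
proof -
  have "\<forall>\<^sub>F s in F. mu s z * tau s z X = B_metric \<Omega> s z X"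
    using order_tendstoD(1)[OF id pos] by eventually_elim (simp add: B_metric_eq[OF _ z])
  with tendsto_mult[OF mu tau] show ?thesis by (rule Lim_transform_eventually)
qed

end

theorem theorem1p6:
  fixes \<Omega> :: "(complex ^ 'n) set"
  assumes "open \<Omega>" and "connected \<Omega>" and "\<Omega> \<noteq> {}" and "bounded \<Omega>"
  shows
    "(\<forall>z\<in>\<Omega>. \<forall>w\<in>\<Omega>.
        (\<forall>p>1. ((\<lambda>s. m_fun \<Omega> s z w) \<longlongrightarrow> m_fun \<Omega> p z w) (at_left p)) \<and>
        (\<forall>p\<ge>1. \<exists>l. ((\<lambda>s. m_fun \<Omega> s z w) \<longlongrightarrow> l) (at_right p)) \<and>
        (\<forall>p\<ge>1. (\<exists>p'>p. bergman_dense \<Omega> p' p) \<longrightarrow>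
           ((\<lambda>s. m_fun \<Omega> s z w) \<longlongrightarrow> m_fun \<Omega> p z w) (at_right p)))
     \<and>
     (\<forall>z\<in>\<Omega>. \<forall>X. \<forall>p>0.
        (\<exists>l. ((\<lambda>s. B_metric \<Omega> s z X) \<longlongrightarrow> l) (at_left p)) \<and>
        (\<exists>l. ((\<lambda>s. B_metric \<Omega> s z X) \<longlongrightarrow> l) (at_right p)) \<and>
        ((\<lambda>s. B_metric \<Omega> s z X) \<longlongrightarrow> B_metric \<Omega> p z X) (at_left p) \<and>
        ((\<exists>p'>p. bergman_dense \<Omega> p' p) \<longrightarrow>
           ((\<lambda>s. B_metric \<Omega> s z X) \<longlongrightarrow> B_metric \<Omega> p z X) (at p)))
     \<and>
     (\<forall>z\<in>\<Omega>. \<forall>w\<in>\<Omega>.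
        (\<forall>p>1. ((\<lambda>s. K_off \<Omega> s z w) \<longlongrightarrow> K_off \<Omega> p z w) (at_left p)) \<and>
        (\<forall>p\<ge>1. \<exists>l. ((\<lambda>s. K_off \<Omega> s z w) \<longlongrightarrow> l) (at_right p)) \<and>
        (\<forall>p\<ge>1. (\<exists>p'>p. bergman_dense \<Omega> p' p) \<longrightarrow>
           ((\<lambda>s. K_off \<Omega> s z w) \<longlongrightarrow> K_off \<Omega> p z w) (at_right p)))"
proof -
  interpret bounded_domain \<Omega> using assms by unfold_locales
  have B_left: "((\<lambda>s. B_metric \<Omega> s z X) \<longlongrightarrow> B_metric \<Omega> p z X) (at_left p)" if "p > 0" "z \<in> \<Omega>" for p z X
    unfolding B_metric_eq[OF that]
    by (rule B_metric_tendsto[OF mu_at_left[OF that] tau_at_left[OF that] tendsto_ident_at that])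
  have B_right: "\<exists>l. ((\<lambda>s. B_metric \<Omega> s z X) \<longlongrightarrow> l) (at_right p)" if p: "p > 0" and z: "z \<in> \<Omega>" for p z X
    using mu_at_right_limit[OF p z] tau_at_right_limit[OF p z, of X]
      B_metric_tendsto[OF _ _ tendsto_ident_at p z] by blast
  have B_dense: "((\<lambda>s. B_metric \<Omega> s z X) \<longlongrightarrow> B_metric \<Omega> p z X) (at p)"
    if p: "p > 0" and z: "z \<in> \<Omega>" and d: "p < p'" "bergman_dense \<Omega> p' p" for p p' z X
  proof -
    have "((\<lambda>s. B_metric \<Omega> s z X) \<longlongrightarrow> B_metric \<Omega> p z X) (at_right p)"
      unfolding B_metric_eq[OF p z]
      by (rule B_metric_tendsto[OF mu_at_right_dense[OF d(2) p d(1) z] tau_at_right_dense[OF d(2) p d(1) z]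
          tendsto_ident_at p z])
    with B_left[OF p z] show ?thesis by (simp add: filterlim_split_at)
  qed
  have K_left: "((\<lambda>s. K_off \<Omega> s z w) \<longlongrightarrow> K_off \<Omega> p z w) (at_left p)" if "p > 1" "z \<in> \<Omega>" "w \<in> \<Omega>" for p z w
  proof -
    have p: "p > 0" using that by simp
    show ?thesis unfolding K_off_eq[OF p that(3)]
      by (rule K_off_tendsto[OF m_fun_at_left[OF that] mu_at_left[OF p that(3)] mu_pos[OF p that(3)]
          tendsto_ident_at p that(3)])
  qed
  have K_right: "\<exists>l. ((\<lambda>s. K_off \<Omega> s z w) \<longlongrightarrow> l) (at_right p)"
    if p1: "p \<ge> 1" and z: "z \<in> \<Omega>" and w: "w \<in> \<Omega>" for p z w
  proof -
    have p: "p > 0" using p1 by simp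
    obtain L where L: "L \<ge> mu p w" "((\<lambda>s. mu s w) \<longlongrightarrow> L) (at_right p)" using mu_at_right_limit[OF p w] by blast
    then have "L > 0" using mu_pos[OF p w] by simp
    then show ?thesis
      using m_fun_at_right_limit[OF p1 z w] K_off_tendsto[OF _ L(2) _ tendsto_ident_at p w] by blast
  qed
  have K_dense: "((\<lambda>s. K_off \<Omega> s z w) \<longlongrightarrow> K_off \<Omega> p z w) (at_right p)"
    if p1: "p \<ge> 1" and z: "z \<in> \<Omega>" and w: "w \<in> \<Omega>" and d: "p < p'" "bergman_dense \<Omega> p' p" for p p' z w
  proof -
    have p: "p > 0" using p1 by simp
    show ?thesis unfolding K_off_eq[OF p w]
      by (rule K_off_tendsto[OF m_fun_at_right_dense[OF d(2,1) p1 z w] mu_at_right_dense[OF d(2) p d(1) w]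
          mu_pos[OF p w] tendsto_ident_at p w])
  qed
  show ?thesis
    by (intro conjI ballI allI impI)
      (blast intro: m_fun_at_left m_fun_at_right_limit m_fun_at_right_dense
        B_left B_right B_dense K_left K_right K_dense)+
qed

end
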